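(* Let $\mathcal{H}$ be a Hopf algebra over a field $F$ containing $\mathbb{Q}$, let $\mathcal{K}\subset\mathcal{H}$ be a Hopf subalgebra, and let $M$ be a right $\mathcal{H}$-module and left $\mathcal{H}$-comodule that is a stable anti-Yetter–Drinfeld module. Let $\mathcal{C}=\mathcal{H}\otimes_{\mathcal{K}}F$ and $$C^*(\mathcal{H},\mathcal{K};M)=\{C^n(\mathcal{H},\mathcal{K};M):=M\otimes_{\mathcal{K}}\mathcal{C}^{\otimes n}\}_{n\ge0},$$ where the tensor product over $\mathcal{K}$ is with respect to the diagonal action on $\mathcal{C}^{\otimes n}$. The following operators are well-defined and endow $C^*(\mathcal{H},\mathcal{K};M)$ with a cyclic structure: $$\delta_0(m\otimes_{\mathcal{K}}c^1\otimes\cdots\otimes c^{n-1})=m\otimes_{\mathcal{K}}\dot1\otimes c^1\otimes\cdots\otimes c^{n-1},$$ $$\delta_i(m\otimes_{\mathcal{K}}c^1\otimes\cdots\otimes c^{n-1})=m\otimes_{\mathcal{K}}c^1\otimes\cdots\otimes c^i_{(1)}\otimes c^i_{(2)}\otimes\cdots\otimes c^{n-1},\quad 1\le i\le n-1,$$ $$\delta_n(m\otimes_{\mathcal{K}}c^1\otimes\cdots\otimes c^{n-1})=m_{(0)}\otimes_{\mathcal{K}}c^1\otimes\cdots\otimes c^{n-1}\otimes\dot m_{(-1)},$$ $$\sigma_i(m\otimes_{\mathcal{K}}c^1\otimes\cdots\otimes c^{n+1})=m\otimes_{\mathcal{K}}c^1\otimes\cdots\otimes\varepsilon_{\mathcal{C}}(c^{i+1})\otimes\cdots\otimes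 c^{n+1},\quad 0\le i\le n,$$ $$\tau_n(m\otimes_{\mathcal{K}}\dot h^1\otimes c^2\otimes\cdots\otimes c^n)=m_{(0)}h^1_{(1)}\otimes_{\mathcal{K}}S(h^1_{(2)})\cdot(c^2\otimes\cdots\otimes c^n\otimes\dot m_{(-1)}).$$
   Context: $\mathcal{H}$ has coproduct $\Delta h=h_{(1)}\otimes h_{(2)}$ (Sweedler notation, summation omitted), counit $\varepsilon$, antipode $S$. In $\mathcal{C}=\mathcal{H}\otimes_{\mathcal{K}}F$, $\mathcal{K}$ acts on $\mathcal{H}$ by right multiplication and on $F$ by the counit; write $\dot h=h\otimes_{\mathcal{K}}1\in\mathcal{C}$ for $h\in\mathcal{H}$. $\mathcal{C}$ is a left $\mathcal{H}$-module by left multiplication and a coalgebra with $\Delta_{\mathcal{C}}(\dot h)=\dot h_{(1)}\otimes\dot h_{(2)}$ and $\varepsilon_{\mathcal{C}}(\dot h)=\varepsilon(h)$; for $c\in\mathcal{C}$ write $\Delta_{\mathcal{C}}c=c_{(1)}\otimes c_{(2)}$. $\mathcal{H}$ acts diagonally on $\mathcal{C}^{\otimes n}$ via the iterated coproduct. The coaction of $M$ is written ${}_M\Delta(m)=m_{(-1)}\otimes m_{(0)}\in\mathcal{H}\otimes M$. $M$ is a stable anti-Yetter–Drinfeld module if for all $m\in M$, $h\in\mathcal{H}$: $$m_{(0)}\,m_{(-1)}=m,\qquad {}_M\Delta(mh)=S(h_{(3)})\,m_{(-1)}\,h_{(1)}\otimes m_{(0)}h_{(2)} .$$ In degree $0$,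 $\mathcal{C}^{\otimes0}=F$ (with $\mathcal{K}$ acting by $\varepsilon$) and $\tau_0=\mathrm{id}$. A cyclic structure means that the operators $\delta_i:C^{n-1}\to C^n$, $\sigma_i:C^{n+1}\to C^n$ ($0\le i\le n$), $\tau_n:C^n\to C^n$ satisfy the relations of the cyclic category: $\delta_j\delta_i=\delta_i\delta_{j-1}$ for $i<j$; $\sigma_j\sigma_i=\sigma_i\sigma_{j+1}$ for $i\le j$; $\sigma_j\delta_i=\delta_i\sigma_{j-1}$ for $i<j$, $\sigma_j\delta_i=1$ for $i=j,j+1$, $\sigma_j\delta_i=\delta_{i-1}\sigma_j$ for $i>j+1$; $\tau_n\delta_i=\delta_{i-1}\tau_{n-1}$ for $1\le i\le n$, $\tau_n\delta_0=\delta_n$; $\tau_n\sigma_i=\sigma_{i-1}\tau_{n+1}$ for $1\le i\le n$, $\tau_n\sigma_0=\sigma_n\tau_{n+1}^2$; $\tau_n^{n+1}=1$. *)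

theory Defs
  imports Complex_Main "HOL-Library.Poly_Mapping"
begin

section \<open>Vector spaces presented by generators and relations\<close>

text \<open>
  Hopf algebras and their modules live on whole types, with the scalar multiplication as a
  parameter. Tensor products depend on values (subalgebras, actions, the tensor degree), so they
  are vector spaces on an explicit carrier. The zero vector and negatives are
  \<open>smul 0 x\<close> and \<open>smul (- 1) x\<close>.
\<close>

record ('f, 'v) vspace =
  carrier :: "'v set"
  vadd :: "'v \<Rightarrow> 'v \<Rightarrow> 'v"
  smul :: "'f \<Rightarrow> 'v \<Rightarrow> 'v"

definition full_space :: "('f \<Rightarrow> 'v \<Rightarrow> 'v) \<Rightarrow> ('f, 'v::plus) vspace" where
  "full_space s = \<lparr>carrier = UNIV, vadd = (+), smul = s\<rparr>"

definition linear_on ::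
  "('f, 'v) vspace \<Rightarrow> ('f, 'w) vspace \<Rightarrow> ('v \<Rightarrow> 'w) \<Rightarrow> bool" where
  "linear_on V W f \<longleftrightarrow>
     (\<forall>x\<in>carrier V. f x \<in> carrier W) \<and>
     (\<forall>x\<in>carrier V. \<forall>y\<in>carrier V. f (vadd V x y) = vadd W (f x) (f y)) \<and>
     (\<forall>a. \<forall>x\<in>carrier V. f (smul V a x) = smul W a (f x))"

text \<open>
  The free vector space on \<open>'x\<close> is \<open>'x \<Rightarrow>\<^sub>0 'f\<close>. An element of a presented space is a coset, that is,
  the set of all formal sums representing it.
\<close>

definition fscale :: "'f::field \<Rightarrow> ('x \<Rightarrow>\<^sub>0 'f) \<Rightarrow> ('x \<Rightarrow>\<^sub>0 'f)" where
  "fscale a p = Poly_Mapping.map (\<lambda>b. a * b) p"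

abbreviation gen :: "'x \<Rightarrow> ('x \<Rightarrow>\<^sub>0 'f::field)" where
  "gen x \<equiv> Poly_Mapping.single x 1"

definition cls :: "('x \<Rightarrow>\<^sub>0 'f::field) set \<Rightarrow> ('x \<Rightarrow>\<^sub>0 'f) \<Rightarrow> ('x \<Rightarrow>\<^sub>0 'f) set" where
  "cls R p = {q. q - p \<in> module.span fscale R}"

definition rep :: "'p set \<Rightarrow> 'p" where
  "rep t = (SOME p. p \<in> t)"

definition presented ::
  "'x set \<Rightarrow> ('x \<Rightarrow>\<^sub>0 'f::field) set \<Rightarrow> ('f, ('x \<Rightarrow>\<^sub>0 'f) set) vspace" where
  "presented X R =
     \<lparr>carrier = {cls R p |p. Poly_Mapping.keys p \<subseteq> X},
      vadd = (\<lambda>t u. cls R (rep t + rep u)),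
      smul = (\<lambda>a t. cls R (fscale a (rep t)))\<rparr>"

definition lin_ext ::
  "('f \<Rightarrow> 'v \<Rightarrow> 'v) \<Rightarrow> ('x \<Rightarrow> 'v::comm_monoid_add) \<Rightarrow> ('x \<Rightarrow>\<^sub>0 'f::field) \<Rightarrow> 'v" where
  "lin_ext s g p = (\<Sum>x\<in>Poly_Mapping.keys p. s (Poly_Mapping.lookup p x) (g x))"

text \<open>
  Sweedler notation: if \<open>t\<close> is the class of \<open>\<Sum>\<^sub>j a\<^sub>j (x\<^sub>j \<otimes> y\<^sub>j)\<close>, then
  \<open>sweedler s (\<lambda>(x, y). g x y) t\<close> is \<open>\<Sum>\<^sub>j a\<^sub>j g x\<^sub>j y\<^sub>j\<close>. The value (or, when \<open>g\<close> takes values in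
  formal sums, its class) does not depend on the chosen representative as long as \<open>g\<close> respects
  the relations; see lemmas \<open>sweedler_cls\<close> and \<open>cls_fsweedler_cls\<close>.
\<close>

definition sweedler ::
  "('f \<Rightarrow> 'v \<Rightarrow> 'v) \<Rightarrow> ('x \<Rightarrow> 'v::comm_monoid_add) \<Rightarrow> ('x \<Rightarrow>\<^sub>0 'f::field) set \<Rightarrow> 'v" where
  "sweedler s g t = lin_ext s g (rep t)"

abbreviation fsweedler ::
  "('x \<Rightarrow> ('y \<Rightarrow>\<^sub>0 'f)) \<Rightarrow> ('x \<Rightarrow>\<^sub>0 'f::field) set \<Rightarrow> ('y \<Rightarrow>\<^sub>0 'f)" where
  "fsweedler \<equiv> sweedler fscale"

lemma lookup_fscale [simp]:
  "Poly_Mapping.lookup (fscale a p) x = a * Poly_Mapping.lookup p x"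
  by (simp add: fscale_def map.rep_eq when_def)

lemma vector_space_fscale: "vector_space (fscale :: 'f::field \<Rightarrow> ('x \<Rightarrow>\<^sub>0 'f) \<Rightarrow> _)"
  by unfold_locales (auto intro!: poly_mapping_eqI simp: lookup_add algebra_simps)

interpretation free: vector_space "fscale :: 'f::field \<Rightarrow> ('x \<Rightarrow>\<^sub>0 'f) \<Rightarrow> _"
  by (rule vector_space_fscale)

lemma cls_eq_iff: "cls R p = cls R q \<longleftrightarrow> p - q \<in> free.span R"
proof
  assume "cls R p = cls R q"
  moreover have "p \<in> cls R p" by (simp add: cls_def free.span_zero)
  ultimately show "p - q \<in> free.span R" by (simp add: cls_def)
next
  assume pq: "p - q \<in> free.span R"
  have "r - p \<in> free.span R \<longleftrightarrow> r - q \<in> free.span R" for r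
    using free.span_add[OF _ pq, of "r - p"] free.span_diff[OF _ pq, of "r - q"] by auto
  then show "cls R p = cls R q" by (simp add: cls_def)
qed

lemma rep_cls: "rep (cls R p) - p \<in> free.span R"
proof -
  have "p \<in> cls R p" by (simp add: cls_def free.span_zero)
  then have "rep (cls R p) \<in> cls R p" unfolding rep_def by (rule someI)
  then show ?thesis by (simp add: cls_def)
qed

lemma vadd_presented: "vadd (presented X R) (cls R p) (cls R q) = cls R (p + q)"
  using free.span_add[OF rep_cls[of R p] rep_cls[of R q]]
  by (simp add: presented_def cls_eq_iff algebra_simps)

lemma smul_presented: "smul (presented X R) a (cls R p) = cls R (fscale a p)"
  using free.span_scale[OF rep_cls[of R p], of a]
  by (simp add: presented_def cls_eq_iff free.scale_right_diff_distrib)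

lemma lin_ext_linear:
  fixes s :: "'f::field \<Rightarrow> 'v::ab_group_add \<Rightarrow> 'v"
  assumes "vector_space s"
  shows "Vector_Spaces.linear fscale s (lin_ext s g)"
proof -
  interpret s: vector_space s by fact
  have sup: "lin_ext s g p = (\<Sum>x\<in>A. s (Poly_Mapping.lookup p x) (g x))"
    if "finite A" "Poly_Mapping.keys p \<subseteq> A" for p A
    unfolding lin_ext_def using that
    by (intro sum.mono_neutral_left) (auto simp: in_keys_iff)
  have add: "lin_ext s g (p + q) = lin_ext s g p + lin_ext s g q" for p q
  proof -
    let ?A = "Poly_Mapping.keys p \<union> Poly_Mapping.keys q"
    have "Poly_Mapping.keys (p + q) \<subseteq> ?A" by (rule Poly_Mapping.keys_add)
    then show ?thesis
      by (simp add: sup[of ?A] lookup_add s.scale_left_distrib sum.distrib)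
  qed
  have scale: "lin_ext s g (fscale a p) = s a (lin_ext s g p)" for a p
  proof -
    have "Poly_Mapping.keys (fscale a p) \<subseteq> Poly_Mapping.keys p"
      by (auto simp: in_keys_iff)
    then show ?thesis
      by (simp add: sup[of "Poly_Mapping.keys p"] s.scale_sum_right)
  qed
  show ?thesis
    by unfold_locales (auto simp: add scale)
qed

lemma sweedler_cls:
  fixes s :: "'f::field \<Rightarrow> 'v::ab_group_add \<Rightarrow> 'v"
  assumes "vector_space s" and "\<And>r. r \<in> R \<Longrightarrow> lin_ext s g r = 0"
  shows "sweedler s g (cls R p) = lin_ext s g p"
proof -
  interpret l: Vector_Spaces.linear fscale s "lin_ext s g"
    by (rule lin_ext_linear[OF assms(1)])
  have "lin_ext s g (rep (cls R p) - p) = 0"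
    using rep_cls l.eq_0_on_span[OF assms(2)] by blast
  then show ?thesis by (simp add: sweedler_def l.diff)
qed

lemma cls_fsweedler_cls:
  assumes "\<And>r. r \<in> R \<Longrightarrow> lin_ext fscale g r \<in> free.span R'"
  shows "cls R' (fsweedler g (cls R p)) = cls R' (lin_ext fscale g p)"
proof -
  interpret l: Vector_Spaces.linear fscale fscale "lin_ext fscale g"
    by (rule lin_ext_linear[OF vector_space_fscale])
  have "lin_ext fscale g ` free.span R \<subseteq> free.span R'"
    unfolding l.span_image[symmetric] by (rule free.span_minimal) (use assms in auto)
  then have "lin_ext fscale g (rep (cls R p) - p) \<in> free.span R'"
    using rep_cls by blast
  then show ?thesis by (simp add: sweedler_def cls_eq_iff l.diff)
qed

section \<open>Tensor products\<close>

definition tensor_rels ::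
  "('f::field, 'v) vspace \<Rightarrow> ('f, 'w) vspace \<Rightarrow> ('v \<times> 'w \<Rightarrow>\<^sub>0 'f) set" where
  "tensor_rels V W =
     {gen (vadd V v v', w) - gen (v, w) - gen (v', w) |v v' w.
        v \<in> carrier V \<and> v' \<in> carrier V \<and> w \<in> carrier W} \<union>
     {gen (v, vadd W w w') - gen (v, w) - gen (v, w') |v w w'.
        v \<in> carrier V \<and> w \<in> carrier W \<and> w' \<in> carrier W} \<union>
     {gen (smul V a v, w) - fscale a (gen (v, w)) |a v w. v \<in> carrier V \<and> w \<in> carrier W} \<union>
     {gen (v, smul W a w) - fscale a (gen (v, w)) |a v w. v \<in> carrier V \<and> w \<in> carrier W}"

definition tensor ::
  "('f::field, 'v) vspace \<Rightarrow> ('f, 'w) vspace \<Rightarrow> ('f, ('v \<times> 'w \<Rightarrow>\<^sub>0 'f) set) vspace" where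
  "tensor V W = presented (carrier V \<times> carrier W) (tensor_rels V W)"

text \<open>\<open>V \<otimes>\<^sub>K W\<close> for a right action \<open>ra\<close> of \<open>K\<close> on \<open>V\<close> and a left action \<open>la\<close> on \<open>W\<close>\<close>

definition bal_tensor_rels ::
  "('f::field, 'v) vspace \<Rightarrow> ('f, 'w) vspace \<Rightarrow> 'k set \<Rightarrow> ('v \<Rightarrow> 'k \<Rightarrow> 'v) \<Rightarrow> ('k \<Rightarrow> 'w \<Rightarrow> 'w)
     \<Rightarrow> ('v \<times> 'w \<Rightarrow>\<^sub>0 'f) set" where
  "bal_tensor_rels V W K ra la =
     tensor_rels V W \<union>
     {gen (ra v k, w) - gen (v, la k w) |v k w. v \<in> carrier V \<and> k \<in> K \<and> w \<in> carrier W}"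

definition bal_tensor ::
  "('f::field, 'v) vspace \<Rightarrow> ('f, 'w) vspace \<Rightarrow> 'k set \<Rightarrow> ('v \<Rightarrow> 'k \<Rightarrow> 'v) \<Rightarrow> ('k \<Rightarrow> 'w \<Rightarrow> 'w)
     \<Rightarrow> ('f, ('v \<times> 'w \<Rightarrow>\<^sub>0 'f) set) vspace" where
  "bal_tensor V W K ra la = presented (carrier V \<times> carrier W) (bal_tensor_rels V W K ra la)"

text \<open>
  The generator \<open>[v\<^sub>1, \<dots>, v\<^sub>n]\<close> of the tensor power stands for \<open>v\<^sub>1 \<otimes> \<dots> \<otimes> v\<^sub>n\<close>. For \<open>n = 0\<close> there are no
  relations and the space is the ground field with basis the empty tensor.
\<close>

definition tpow_rels :: "('f::field, 'v) vspace \<Rightarrow> nat \<Rightarrow> ('v list \<Rightarrow>\<^sub>0 'f) set" where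
  "tpow_rels V n =
     {gen (us @ [vadd V v v'] @ ws) - gen (us @ [v] @ ws) - gen (us @ [v'] @ ws) |us v v' ws.
        length us + length ws + 1 = n \<and> set us \<union> set ws \<union> {v, v'} \<subseteq> carrier V} \<union>
     {gen (us @ [smul V a v] @ ws) - fscale a (gen (us @ [v] @ ws)) |a us v ws.
        length us + length ws + 1 = n \<and> set us \<union> set ws \<union> {v} \<subseteq> carrier V}"

definition tpow :: "('f::field, 'v) vspace \<Rightarrow> nat \<Rightarrow> ('f, ('v list \<Rightarrow>\<^sub>0 'f) set) vspace" where
  "tpow V n = presented {vs. length vs = n \<and> set vs \<subseteq> carrier V} (tpow_rels V n)"

section \<open>Hopf algebras\<close>

record (overloaded) ('f::zero, 'h) hopf =
  hscale :: "'f \<Rightarrow> 'h \<Rightarrow> 'h"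
  comult :: "'h \<Rightarrow> ('h \<times> 'h \<Rightarrow>\<^sub>0 'f) set"
  counit :: "'h \<Rightarrow> 'f"
  antipode :: "'h \<Rightarrow> 'h"

abbreviation hspace :: "('f::field, 'h::ring_1) hopf \<Rightarrow> ('f, 'h) vspace" where
  "hspace H \<equiv> full_space (hscale H)"

locale hopf_algebra =
  fixes H :: "('f::field, 'h::ring_1) hopf"
  assumes vector_space: "vector_space (hscale H)"
    and scale_mult_left: "hscale H a x * y = hscale H a (x * y)"
    and scale_mult_right: "x * hscale H a y = hscale H a (x * y)"
    and comult_linear: "linear_on (hspace H) (tensor (hspace H) (hspace H)) (comult H)"
    and counit_linear: "Vector_Spaces.linear (hscale H) (*) (counit H)"
    and antipode_linear: "Vector_Spaces.linear (hscale H) (hscale H) (antipode H)"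
    and coassoc:
      "cls (tensor_rels (hspace H) (tensor (hspace H) (hspace H)))
         (fsweedler (\<lambda>(a, b). gen (a, comult H b)) (comult H x)) =
       cls (tensor_rels (hspace H) (tensor (hspace H) (hspace H)))
         (fsweedler (\<lambda>(a, b).
            fsweedler (\<lambda>(a1, a2). gen (a1, cls (tensor_rels (hspace H) (hspace H)) (gen (a2, b))))
              (comult H a)) (comult H x))"
    and counit_left: "sweedler (hscale H) (\<lambda>(a, b). hscale H (counit H a) b) (comult H x) = x"
    and counit_right: "sweedler (hscale H) (\<lambda>(a, b). hscale H (counit H b) a) (comult H x) = x"
    and comult_mult:
      "comult H (x * y) = cls (tensor_rels (hspace H) (hspace H))
         (fsweedler (\<lambda>(x1, x2). fsweedler (\<lambda>(y1, y2). gen (x1 * y1, x2 * y2)) (comult H y))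
           (comult H x))"
    and comult_one: "comult H 1 = cls (tensor_rels (hspace H) (hspace H)) (gen (1, 1))"
    and counit_mult: "counit H (x * y) = counit H x * counit H y"
    and counit_one: "counit H 1 = 1"
    and antipode_left:
      "sweedler (hscale H) (\<lambda>(a, b). antipode H a * b) (comult H x) = hscale H (counit H x) 1"
    and antipode_right:
      "sweedler (hscale H) (\<lambda>(a, b). a * antipode H b) (comult H x) = hscale H (counit H x) 1"

text \<open>
  Over a field, \<open>K \<otimes> K\<close> is a subspace of \<open>H \<otimes> H\<close>, so \<open>comult_closed\<close> says \<open>\<Delta>(K) \<subseteq> K \<otimes> K\<close>.
\<close>

locale hopf_subalgebra = hopf_algebra H
  for H :: "('f::field, 'h::ring_1) hopf" +
  fixes K :: "'h set"
  assumes subspace: "module.subspace (hscale H) K"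
    and one_closed: "1 \<in> K"
    and mult_closed: "x \<in> K \<Longrightarrow> y \<in> K \<Longrightarrow> x * y \<in> K"
    and antipode_closed: "x \<in> K \<Longrightarrow> antipode H x \<in> K"
    and comult_closed: "x \<in> K \<Longrightarrow> \<exists>p\<in>comult H x. Poly_Mapping.keys p \<subseteq> K \<times> K"

text \<open>\<open>iter_comult H n x\<close> is \<open>x\<^sub>(\<^sub>1\<^sub>) \<otimes> \<dots> \<otimes> x\<^sub>(\<^sub>n\<^sub>)\<close>, with \<open>iter_comult H 0 = counit\<close>.\<close>

primrec iter_comult ::
  "('f::field, 'h::ring_1) hopf \<Rightarrow> nat \<Rightarrow> 'h \<Rightarrow> ('h list \<Rightarrow>\<^sub>0 'f) set" where
  "iter_comult H 0 x = cls (tpow_rels (hspace H) 0) (fscale (counit H x) (gen []))"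
| "iter_comult H (Suc n) x = cls (tpow_rels (hspace H) (Suc n))
     (fsweedler (\<lambda>(a, b). fsweedler (\<lambda>bs. gen (a # bs)) (iter_comult H n b)) (comult H x))"

section \<open>Stable anti-Yetter--Drinfeld modules\<close>

record (overloaded) ('f::zero, 'h, 'm) hmodule =
  mscale :: "'f \<Rightarrow> 'm \<Rightarrow> 'm"
  mact :: "'m \<Rightarrow> 'h \<Rightarrow> 'm"
  coact :: "'m \<Rightarrow> ('h \<times> 'm \<Rightarrow>\<^sub>0 'f) set"

abbreviation mspace :: "('f::field, 'h, 'm::ab_group_add) hmodule \<Rightarrow> ('f, 'm) vspace" where
  "mspace M \<equiv> full_space (mscale M)"

locale right_module_left_comodule = hopf_algebra H
  for H :: "('f::field, 'h::ring_1) hopf" +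
  fixes M :: "('f, 'h, 'm::ab_group_add) hmodule"
  assumes m_vector_space: "vector_space (mscale M)"
    and mact_add_left: "mact M (m + m') x = mact M m x + mact M m' x"
    and mact_add_right: "mact M m (x + y) = mact M m x + mact M m y"
    and mact_scale_left: "mact M (mscale M a m) x = mscale M a (mact M m x)"
    and mact_scale_right: "mact M m (hscale H a x) = mscale M a (mact M m x)"
    and mact_one: "mact M m 1 = m"
    and mact_mult: "mact M m (x * y) = mact M (mact M m x) y"
    and coact_linear: "linear_on (mspace M) (tensor (hspace H) (mspace M)) (coact M)"
    and coact_counit: "sweedler (mscale M) (\<lambda>(a, m0). mscale M (counit H a) m0) (coact M m) = m"
    and coact_coassoc:
      "cls (tensor_rels (hspace H) (tensor (hspace H) (mspace M)))
         (fsweedler (\<lambda>(a, m0). gen (a, coact M m0)) (coact M m)) =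
       cls (tensor_rels (hspace H) (tensor (hspace H) (mspace M)))
         (fsweedler (\<lambda>(a, m0).
            fsweedler (\<lambda>(a1, a2). gen (a1, cls (tensor_rels (hspace H) (mspace M)) (gen (a2, m0))))
              (comult H a)) (coact M m))"

locale sayd_module = right_module_left_comodule H M
  for H :: "('f::field, 'h::ring_1) hopf" and M :: "('f, 'h, 'm::ab_group_add) hmodule" +
  assumes stable: "sweedler (mscale M) (\<lambda>(a, m0). mact M m0 a) (coact M m) = m"
    and anti_yetter_drinfeld:
      "coact M (mact M m x) = cls (tensor_rels (hspace H) (mspace M))
         (fsweedler (\<lambda>(a, m0).
            fsweedler (\<lambda>(x1, x').
              fsweedler (\<lambda>(x2, x3). gen (antipode H x3 * a * x1, mact M m0 x2))
                (comult H x')) (comult H x)) (coact M m))"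

section \<open>The coalgebra \<open>C = H \<otimes>\<^sub>K F\<close>\<close>

type_synonym ('f, 'h) celem = "('h \<times> 'f \<Rightarrow>\<^sub>0 'f) set"

definition C_rels ::
  "('f::field, 'h::ring_1) hopf \<Rightarrow> 'h set \<Rightarrow> ('h \<times> 'f \<Rightarrow>\<^sub>0 'f) set" where
  "C_rels H K =
     bal_tensor_rels (hspace H) (full_space (*)) K (\<lambda>x k. x * k) (\<lambda>k a. counit H k * a)"

definition C_space ::
  "('f::field, 'h::ring_1) hopf \<Rightarrow> 'h set \<Rightarrow> ('f, ('f, 'h) celem) vspace" where
  "C_space H K =
     bal_tensor (hspace H) (full_space (*)) K (\<lambda>x k. x * k) (\<lambda>k a. counit H k * a)"

definition dot :: "('f::field, 'h::ring_1) hopf \<Rightarrow> 'h set \<Rightarrow> 'h \<Rightarrow> ('f, 'h) celem" where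
  "dot H K x = cls (C_rels H K) (gen (x, 1))"

definition C_act ::
  "('f::field, 'h::ring_1) hopf \<Rightarrow> 'h set \<Rightarrow> 'h \<Rightarrow> ('f, 'h) celem \<Rightarrow> ('f, 'h) celem" where
  "C_act H K y c = cls (C_rels H K) (fsweedler (\<lambda>(x, a). gen (y * x, a)) c)"

text \<open>Since \<open>x \<otimes>\<^sub>K a = a \<cdot> dot x\<close>, these are the linear maps with
  \<open>dot x \<mapsto> dot x\<^sub>(\<^sub>1\<^sub>) \<otimes> dot x\<^sub>(\<^sub>2\<^sub>)\<close> and \<open>dot x \<mapsto> \<epsilon>(x)\<close>.\<close>

definition C_comult ::
  "('f::field, 'h::ring_1) hopf \<Rightarrow> 'h set \<Rightarrow> ('f, 'h) celem
     \<Rightarrow> (('f, 'h) celem \<times> ('f, 'h) celem \<Rightarrow>\<^sub>0 'f) set" where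
  "C_comult H K c = cls (tensor_rels (C_space H K) (C_space H K))
     (fsweedler (\<lambda>(x, a).
        fscale a (fsweedler (\<lambda>(x1, x2). gen (dot H K x1, dot H K x2)) (comult H x))) c)"

definition C_counit ::
  "('f::field, 'h::ring_1) hopf \<Rightarrow> 'h set \<Rightarrow> ('f, 'h) celem \<Rightarrow> 'f" where
  "C_counit H K c = sweedler (*) (\<lambda>(x, a). a * counit H x) c"

definition C_tens ::
  "('f::field, 'h::ring_1) hopf \<Rightarrow> 'h set \<Rightarrow> ('f, 'h) celem list
     \<Rightarrow> (('f, 'h) celem list \<Rightarrow>\<^sub>0 'f) set" where
  "C_tens H K cs = cls (tpow_rels (C_space H K) (length cs)) (gen cs)"

definition diag_act ::
  "('f::field, 'h::ring_1) hopf \<Rightarrow> 'h set \<Rightarrow> nat \<Rightarrow> 'h \<Rightarrow> (('f, 'h) celem list \<Rightarrow>\<^sub>0 'f) set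
     \<Rightarrow> (('f, 'h) celem list \<Rightarrow>\<^sub>0 'f) set" where
  "diag_act H K n y t = cls (tpow_rels (C_space H K) n)
     (fsweedler (\<lambda>cs. fsweedler (\<lambda>ys. gen (map2 (C_act H K) ys cs)) (iter_comult H n y)) t)"

section \<open>The spaces \<open>M \<otimes>\<^sub>K C\<^sup>\<otimes>\<^sup>n\<close> and the operators\<close>

type_synonym ('f, 'h, 'm) cochain_elem =
  "('m \<times> (('f, 'h) celem list \<Rightarrow>\<^sub>0 'f) set \<Rightarrow>\<^sub>0 'f) set"

definition cochain_rels ::
  "('f::field, 'h::ring_1) hopf \<Rightarrow> 'h set \<Rightarrow> ('f, 'h, 'm::ab_group_add) hmodule \<Rightarrow> nat
     \<Rightarrow> ('m \<times> (('f, 'h) celem list \<Rightarrow>\<^sub>0 'f) set \<Rightarrow>\<^sub>0 'f) set" where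
  "cochain_rels H K M n =
     bal_tensor_rels (mspace M) (tpow (C_space H K) n) K (mact M) (diag_act H K n)"

definition cochain ::
  "('f::field, 'h::ring_1) hopf \<Rightarrow> 'h set \<Rightarrow> ('f, 'h, 'm::ab_group_add) hmodule \<Rightarrow> nat
     \<Rightarrow> ('f, ('f, 'h, 'm) cochain_elem) vspace" where
  "cochain H K M n =
     bal_tensor (mspace M) (tpow (C_space H K) n) K (mact M) (diag_act H K n)"

definition mtens ::
  "('f::field, 'h::ring_1) hopf \<Rightarrow> 'h set \<Rightarrow> ('f, 'h, 'm::ab_group_add) hmodule
     \<Rightarrow> 'm \<Rightarrow> ('f, 'h) celem list \<Rightarrow> ('f, 'h, 'm) cochain_elem" where
  "mtens H K M m cs = cls (cochain_rels H K M (length cs)) (gen (m, C_tens H K cs))"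

text \<open>
  \<open>\<delta> n i\<close> is the operator \<open>\<delta>\<^sub>i\<close> with values in degree \<open>n\<close>, and \<open>\<sigma> n i\<close> is the operator \<open>\<sigma>\<^sub>i\<close> with
  values in degree \<open>n\<close>. Lists are indexed from 0, so \<open>c\<^sup>i\<close> is \<open>cs ! (i - 1)\<close>.
\<close>

definition coface_operators ::
  "('f::field, 'h::ring_1) hopf \<Rightarrow> 'h set \<Rightarrow> ('f, 'h, 'm::ab_group_add) hmodule
     \<Rightarrow> (nat \<Rightarrow> nat \<Rightarrow> ('f, 'h, 'm) cochain_elem \<Rightarrow> ('f, 'h, 'm) cochain_elem) \<Rightarrow> bool" where
  "coface_operators H K M \<delta> \<longleftrightarrow>
     (\<forall>n\<ge>1. \<forall>i\<le>n. linear_on (cochain H K M (n - 1)) (cochain H K M n) (\<delta> n i)) \<and>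
     (\<forall>n\<ge>1. \<forall>m cs. length cs = n - 1 \<and> set cs \<subseteq> carrier (C_space H K) \<longrightarrow>
        \<delta> n 0 (mtens H K M m cs) = mtens H K M m (dot H K 1 # cs) \<and>
        (\<forall>i. 1 \<le> i \<and> i \<le> n - 1 \<longrightarrow>
           \<delta> n i (mtens H K M m cs) = cls (cochain_rels H K M n)
             (fsweedler
               (\<lambda>(c1, c2). gen (m, C_tens H K (take (i - 1) cs @ [c1, c2] @ drop i cs)))
               (C_comult H K (cs ! (i - 1))))) \<and>
        \<delta> n n (mtens H K M m cs) = cls (cochain_rels H K M n)
          (fsweedler (\<lambda>(a, m0). gen (m0, C_tens H K (cs @ [dot H K a]))) (coact M m)))"

definition codegeneracy_operators ::
  "('f::field, 'h::ring_1) hopf \<Rightarrow> 'h set \<Rightarrow> ('f, 'h, 'm::ab_group_add) hmodule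
     \<Rightarrow> (nat \<Rightarrow> nat \<Rightarrow> ('f, 'h, 'm) cochain_elem \<Rightarrow> ('f, 'h, 'm) cochain_elem) \<Rightarrow> bool" where
  "codegeneracy_operators H K M \<sigma> \<longleftrightarrow>
     (\<forall>n. \<forall>i\<le>n. linear_on (cochain H K M (n + 1)) (cochain H K M n) (\<sigma> n i)) \<and>
     (\<forall>n m cs. length cs = n + 1 \<and> set cs \<subseteq> carrier (C_space H K) \<longrightarrow>
        (\<forall>i\<le>n. \<sigma> n i (mtens H K M m cs) =
           smul (cochain H K M n) (C_counit H K (cs ! i))
             (mtens H K M m (take i cs @ drop (i + 1) cs))))"

definition cyclic_operators ::
  "('f::field, 'h::ring_1) hopf \<Rightarrow> 'h set \<Rightarrow> ('f, 'h, 'm::ab_group_add) hmodule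
     \<Rightarrow> (nat \<Rightarrow> ('f, 'h, 'm) cochain_elem \<Rightarrow> ('f, 'h, 'm) cochain_elem) \<Rightarrow> bool" where
  "cyclic_operators H K M \<tau> \<longleftrightarrow>
     (\<forall>n. linear_on (cochain H K M n) (cochain H K M n) (\<tau> n)) \<and>
     (\<forall>t\<in>carrier (cochain H K M 0). \<tau> 0 t = t) \<and>
     (\<forall>n\<ge>1. \<forall>m h cs. length cs = n - 1 \<and> set cs \<subseteq> carrier (C_space H K) \<longrightarrow>
        \<tau> n (mtens H K M m (dot H K h # cs)) = cls (cochain_rels H K M n)
          (fsweedler (\<lambda>(a, m0).
             fsweedler (\<lambda>(h1, h2).
               gen (mact M m0 h1,
                    diag_act H K n (antipode H h2) (C_tens H K (cs @ [dot H K a]))))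
               (comult H h)) (coact M m)))"

definition cocyclic ::
  "(nat \<Rightarrow> ('f, 'x) vspace) \<Rightarrow> (nat \<Rightarrow> nat \<Rightarrow> 'x \<Rightarrow> 'x) \<Rightarrow> (nat \<Rightarrow> nat \<Rightarrow> 'x \<Rightarrow> 'x) \<Rightarrow>
     (nat \<Rightarrow> 'x \<Rightarrow> 'x) \<Rightarrow> bool" where
  "cocyclic X \<delta> \<sigma> \<tau> \<longleftrightarrow>
     \<comment> \<open>linear maps \<open>\<delta>\<^sub>i : X\<^sup>n\<^sup>-\<^sup>1 \<rightarrow> X\<^sup>n\<close>, \<open>\<sigma>\<^sub>i : X\<^sup>n\<^sup>+\<^sup>1 \<rightarrow> X\<^sup>n\<close>, \<open>\<tau>\<^sub>n : X\<^sup>n \<rightarrow> X\<^sup>n\<close>\<close>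
     (\<forall>n\<ge>1. \<forall>i\<le>n. linear_on (X (n - 1)) (X n) (\<delta> n i)) \<and>
     (\<forall>n. \<forall>i\<le>n. linear_on (X (n + 1)) (X n) (\<sigma> n i)) \<and>
     (\<forall>n. linear_on (X n) (X n) (\<tau> n)) \<and>
     \<comment> \<open>cosimplicial relations\<close>
     (\<forall>n\<ge>1. \<forall>j\<le>n + 1. \<forall>i<j. \<forall>t\<in>carrier (X (n - 1)).
        \<delta> (n + 1) j (\<delta> n i t) = \<delta> (n + 1) i (\<delta> n (j - 1) t)) \<and>
     (\<forall>n. \<forall>j\<le>n. \<forall>i\<le>j. \<forall>t\<in>carrier (X (n + 2)).
        \<sigma> n j (\<sigma> (n + 1) i t) = \<sigma> n i (\<sigma> (n + 1) (j + 1) t)) \<and>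
     (\<forall>n. \<forall>j\<le>n. \<forall>i<j. \<forall>t\<in>carrier (X n).
        \<sigma> n j (\<delta> (n + 1) i t) = \<delta> n i (\<sigma> (n - 1) (j - 1) t)) \<and>
     (\<forall>n. \<forall>j\<le>n. \<forall>i\<in>{j, j + 1}. \<forall>t\<in>carrier (X n). \<sigma> n j (\<delta> (n + 1) i t) = t) \<and>
     (\<forall>n. \<forall>j\<le>n. \<forall>i\<le>n + 1. i > j + 1 \<longrightarrow> (\<forall>t\<in>carrier (X n).
        \<sigma> n j (\<delta> (n + 1) i t) = \<delta> n (i - 1) (\<sigma> (n - 1) j t))) \<and>
     \<comment> \<open>compatibility with the cyclic operators\<close>
     (\<forall>n\<ge>1. \<forall>i\<in>{1..n}. \<forall>t\<in>carrier (X (n - 1)). \<tau> n (\<delta> n i t) = \<delta> n (i - 1) (\<tau> (n - 1) t)) \<and>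
     (\<forall>n\<ge>1. \<forall>t\<in>carrier (X (n - 1)). \<tau> n (\<delta> n 0 t) = \<delta> n n t) \<and>
     (\<forall>n. \<forall>i\<in>{1..n}. \<forall>t\<in>carrier (X (n + 1)). \<tau> n (\<sigma> n i t) = \<sigma> n (i - 1) (\<tau> (n + 1) t)) \<and>
     (\<forall>n. \<forall>t\<in>carrier (X (n + 1)). \<tau> n (\<sigma> n 0 t) = \<sigma> n n (\<tau> (n + 1) (\<tau> (n + 1) t))) \<and>
     (\<forall>n. \<forall>t\<in>carrier (X n). (\<tau> n ^^ (n + 1)) t = t)"

end

theory Submission
  imports Defs
begin

text \<open>
Over a field, two elements of a presented space are equal as soon as every linear functional that
vanishes on the relations takes the same value on both (lemma \<open>cls_eqI\<close>). All identities between
cosets are therefore tested on functionals. There Sweedler notation turns into finite sums of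
scalars, \<open>comult_sum\<close>, \<open>coact_sum\<close> and \<open>diag_sum\<close>, and the axioms of Hopf algebras and comodules
become rewriting rules for sums of multilinear functions.

The operators are awkward on \<open>M \<otimes>\<^sub>K C\<^sup>\<otimes>\<^sup>n\<close> because \<open>\<tau>\<^sub>n\<close> involves the antipode. They become transparent
under the isomorphism
  \<open>M \<otimes>\<^sub>K C\<^sup>\<otimes>\<^sup>n \<cong> M \<otimes>\<^sub>H C\<^sup>\<otimes>\<^sup>n\<^sup>+\<^sup>1\<close>, \<open>m \<otimes> c \<mapsto> m \<otimes> dot 1 \<otimes> c\<close>,
with inverse \<open>m \<otimes> dot h \<otimes> c \<mapsto> m h\<^sub>(\<^sub>1\<^sub>) \<otimes> S(h\<^sub>(\<^sub>2\<^sub>)) c\<close>. On the right-hand side \<open>\<tau>\<^sub>n\<close> moves \<open>c\<^sup>0\<close> to the end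
and lets the coaction of \<open>M\<close> act on it,
  \<open>m \<otimes> c\<^sup>0 \<otimes> \<dots> \<otimes> c\<^sup>n \<mapsto> m\<^sub>(\<^sub>0\<^sub>) \<otimes> c\<^sup>1 \<otimes> \<dots> \<otimes> c\<^sup>n \<otimes> m\<^sub>(\<^sub>-\<^sub>1\<^sub>) c\<^sup>0\<close>,
while \<open>\<delta>\<^sub>i\<close> with \<open>i < n\<close> applies the coproduct to slot \<open>i\<close>, \<open>\<sigma>\<^sub>i\<close> applies the counit to slot \<open>i + 1\<close>, and
\<open>\<delta>\<^sub>n = \<tau>\<^sub>n \<delta>\<^sub>0\<close>. The cosimplicial relations and the commutation rules with \<open>\<tau>\<close> are now coassociativity
and counit laws in separate slots. The power \<open>\<tau>\<^sub>n\<^sup>n\<^sup>+\<^sup>1\<close> maps \<open>m \<otimes> c\<close> to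
\<open>m\<^sub>(\<^sub>0\<^sub>) \<otimes> m\<^sub>(\<^sub>-\<^sub>1\<^sub>) c = m\<^sub>(\<^sub>0\<^sub>) m\<^sub>(\<^sub>-\<^sub>1\<^sub>) \<otimes> c\<close>, which is \<open>m \<otimes> c\<close> by stability (lemma \<open>rotate_form_cyclic\<close>).
The anti-Yetter--Drinfeld condition makes the displayed formula for \<open>\<tau>\<^sub>n\<close> compatible
with the tensor product over \<open>H\<close> (lemma \<open>rotate_form_forms\<close>).

The proof works with the functionals on \<open>M \<otimes>\<^sub>H C\<^sup>\<otimes>\<^sup>n\<^sup>+\<^sup>1\<close>. They are the invariant forms \<open>forms n\<close>, and they
pair with cochains by putting \<open>1\<close> into slot 0. The isomorphism appears as the statement that
invariant forms separate cochains (lemma \<open>forms_separate\<close>). The transposes of the operators are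
explicit operators on invariant forms, for which all relations of the cyclic category hold as
equations of functions. A formula on generators whose pairing with every form is given by such
a transpose extends to a unique linear operator on cochains (\<open>realize\<close>), so well-definedness follows
from the fact that the transposes preserve invariant forms, and the relations carry over to cochains
by separation.
\<close>

section \<open>Linear functionals on presented spaces\<close>

text \<open>
A function on the generators is the same thing as a linear functional on the free space. \<open>fval\<close>
evaluates it on a formal sum, \<open>sval\<close> on a coset.
\<close>

abbreviation fval :: "('x \<Rightarrow> 'f) \<Rightarrow> ('x \<Rightarrow>\<^sub>0 'f::field) \<Rightarrow> 'f" where
  "fval \<equiv> lin_ext (*)"

abbreviation sval :: "('x \<Rightarrow> 'f) \<Rightarrow> ('x \<Rightarrow>\<^sub>0 'f::field) set \<Rightarrow> 'f" where
  "sval \<equiv> sweedler (*)"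

definition kills :: "('x \<Rightarrow> 'f::field) \<Rightarrow> ('x \<Rightarrow>\<^sub>0 'f) set \<Rightarrow> bool" where
  "kills \<phi> R \<longleftrightarrow> (\<forall>r\<in>R. fval \<phi> r = 0)"

definition is_lin :: "('f \<Rightarrow> 'v \<Rightarrow> 'v) \<Rightarrow> ('v::plus \<Rightarrow> 'f::field) \<Rightarrow> bool" where
  "is_lin s f \<longleftrightarrow> (\<forall>x y. f (x + y) = f x + f y) \<and> (\<forall>a x. f (s a x) = a * f x)"

definition bilin :: "('f \<Rightarrow> 'v \<Rightarrow> 'v) \<Rightarrow> ('f \<Rightarrow> 'w \<Rightarrow> 'w) \<Rightarrow> ('v::plus \<Rightarrow> 'w::plus \<Rightarrow> 'f::field) \<Rightarrow> bool" where
  "bilin s s' B \<longleftrightarrow> (\<forall>b. is_lin s (\<lambda>a. B a b)) \<and> (\<forall>a. is_lin s' (B a))"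

lemma vector_space_field: "vector_space ((*) :: 'f::field \<Rightarrow> 'f \<Rightarrow> 'f)"
  by unfold_locales (auto simp: algebra_simps)

lemma is_linI: "(\<And>x y. f (x + y) = f x + f y) \<Longrightarrow> (\<And>a x. f (s a x) = a * f x) \<Longrightarrow> is_lin s f"
  by (simp add: is_lin_def)

lemma is_linear_iff_is_lin:
  assumes "vector_space s"
  shows "Vector_Spaces.linear s (*) f \<longleftrightarrow> is_lin s f"
  using assms vector_space_field
  by (auto simp: is_lin_def Vector_Spaces.linear_iff)

lemma lin_ext_gen [simp]:
  fixes s :: "'f::field \<Rightarrow> 'v::ab_group_add \<Rightarrow> 'v"
  assumes "vector_space s"
  shows "lin_ext s g (gen x) = g x"
proof -
  interpret vector_space s by fact
  show ?thesis by (simp add: lin_ext_def)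
qed

lemma
  fixes s :: "'f::field \<Rightarrow> 'v::ab_group_add \<Rightarrow> 'v"
  assumes "vector_space s"
  shows lin_ext_add: "lin_ext s g (p + q) = lin_ext s g p + lin_ext s g q"
    and lin_ext_diff: "lin_ext s g (p - q) = lin_ext s g p - lin_ext s g q"
    and lin_ext_scale: "lin_ext s g (fscale a p) = s a (lin_ext s g p)"
    and lin_ext_zero: "lin_ext s g 0 = 0"
proof -
  interpret l: Vector_Spaces.linear fscale s "lin_ext s g"
    by (rule lin_ext_linear[OF assms])
  show "lin_ext s g (p + q) = lin_ext s g p + lin_ext s g q"
    "lin_ext s g (p - q) = lin_ext s g p - lin_ext s g q"
    "lin_ext s g (fscale a p) = s a (lin_ext s g p)" "lin_ext s g 0 = 0"
    by (simp_all add: l.add l.diff l.scale l.zero)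
qed

lemmas fval_simps [simp] =
  lin_ext_gen[OF vector_space_field] lin_ext_add[OF vector_space_field]
  lin_ext_diff[OF vector_space_field] lin_ext_scale[OF vector_space_field]
  lin_ext_zero[OF vector_space_field]

lemma lin_ext_cong:
  "(\<And>x. x \<in> Poly_Mapping.keys p \<Longrightarrow> g x = h x) \<Longrightarrow> lin_ext s g p = lin_ext s h p"
  by (simp add: lin_ext_def)

lemma fval_fun_add: "fval (\<lambda>x. f x + g x) p = fval f p + fval g p"
  by (simp add: lin_ext_def sum.distrib algebra_simps)

lemma fval_fun_mult: "fval (\<lambda>x. c * f x) p = c * fval f p"
  by (simp add: lin_ext_def sum_distrib_left algebra_simps)

text \<open>
Fubini for finite sums, used to interchange Sweedler sums over independent elements.
\<close>

lemma fval_swap: "fval (\<lambda>x. fval (\<lambda>y. g x y) q) p = fval (\<lambda>y. fval (\<lambda>x. g x y) p) q"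
  unfolding lin_ext_def sum_distrib_left
  by (subst sum.swap) (simp add: mult.left_commute)

lemma is_lin_lin_ext:
  fixes s :: "'f::field \<Rightarrow> 'v::ab_group_add \<Rightarrow> 'v"
  assumes s: "vector_space s" and f: "is_lin s f"
  shows "f (lin_ext s g p) = fval (\<lambda>x. f (g x)) p"
proof -
  interpret Vector_Spaces.linear s "(*)" f
    using is_linear_iff_is_lin[OF s] f by blast
  show ?thesis by (simp add: lin_ext_def sum scale)
qed

lemma is_lin_sweedler:
  fixes s :: "'f::field \<Rightarrow> 'v::ab_group_add \<Rightarrow> 'v"
  assumes "vector_space s" "is_lin s f"
  shows "f (sweedler s g t) = sval (\<lambda>x. f (g x)) t"
  unfolding sweedler_def by (rule is_lin_lin_ext[OF assms])

lemma fval_fsweedler: "fval \<phi> (fsweedler g t) = sval (\<lambda>x. fval \<phi> (g x)) t"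
  by (rule is_lin_sweedler[OF vector_space_fscale]) (simp add: is_lin_def)

lemma sval_fun_add: "sval (\<lambda>x. f x + g x) t = sval f t + sval g t"
  by (simp add: sweedler_def fval_fun_add)

lemma sval_fun_mult: "sval (\<lambda>x. c * f x) t = c * sval f t"
  by (simp add: sweedler_def fval_fun_mult)

lemma sval_cls: "kills \<phi> R \<Longrightarrow> sval \<phi> (cls R p) = fval \<phi> p"
  by (rule sweedler_cls[OF vector_space_field]) (simp add: kills_def)

lemma lin_ext_fscale_gen: "lin_ext fscale gen p = p"
proof (rule poly_mapping_eqI)
  fix x
  have "Poly_Mapping.lookup (lin_ext fscale gen p) x =
      fval (\<lambda>y. Poly_Mapping.lookup (gen y) x) p"
    by (rule is_lin_lin_ext[OF vector_space_fscale]) (simp add: is_lin_def lookup_add)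
  also have "\<dots> = (\<Sum>y\<in>Poly_Mapping.keys p. if y = x then Poly_Mapping.lookup p y else 0)"
    unfolding lin_ext_def by (rule sum.cong) (auto simp: lookup_single when_def)
  also have "\<dots> = Poly_Mapping.lookup p x"
    by (simp add: in_keys_iff)
  finally show "Poly_Mapping.lookup (lin_ext fscale gen p) x = Poly_Mapping.lookup p x" .
qed

text \<open>
Functionals separate the points of a vector space. A vector outside the span of the relations extends
a basis of that span to a larger independent set, so some functional kills the relations but not
the vector.
\<close>

lemma cls_eqI:
  fixes R :: "('x \<Rightarrow>\<^sub>0 'f::field) set"
  assumes eq: "\<And>\<phi>. kills \<phi> R \<Longrightarrow> fval \<phi> p = fval \<phi> q"
  shows "cls R p = cls R q"
proof (rule ccontr)
  assume "cls R p \<noteq> cls R q"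
  then have notin: "p - q \<notin> free.span R" by (simp add: cls_eq_iff)
  obtain B where B: "B \<subseteq> R" "free.independent B" "R \<subseteq> free.span B"
    using free.maximal_independent_subset[of R] by metis
  have "free.span B \<subseteq> free.span R"
    using B(1) by (rule free.span_mono)
  then have ind: "free.independent (insert (p - q) B)"
    using notin by (intro free.independent_insertI[OF _ B(2)]) blast
  interpret vp: vector_space_pair "fscale :: 'f \<Rightarrow> ('x \<Rightarrow>\<^sub>0 'f) \<Rightarrow> _" "(*) :: 'f \<Rightarrow> 'f \<Rightarrow> 'f"
    by (intro vector_space_pair.intro vector_space_fscale vector_space_field)
  obtain f where f: "Vector_Spaces.linear fscale (*) f"
    and fB: "\<forall>x\<in>insert (p - q) B. f x = (if x = p - q then 1 else 0)"
    using vp.linear_independent_extend[OF ind, of "\<lambda>x. if x = p - q then 1 else 0"] by blast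
  interpret f: Vector_Spaces.linear fscale "(*)" f by (rule f)
  have fv: "f r = fval (\<lambda>x. f (gen x)) r" for r
    using is_lin_lin_ext[OF vector_space_fscale, of f gen r] f
    by (simp add: lin_ext_fscale_gen is_linear_iff_is_lin[OF vector_space_fscale])
  have "p - q \<notin> B"
    using notin B(1) free.span_base by blast
  then have "f b = 0" if "b \<in> B" for b using fB that by auto
  then have "f r = 0" if "r \<in> R" for r
    using f.eq_0_on_span[of B r] B(3) that by blast
  then have "kills (\<lambda>x. f (gen x)) R" by (simp add: kills_def fv[symmetric])
  then have "fval (\<lambda>x. f (gen x)) (p - q) = 0" using eq by simp
  then show False using fB by (simp add: fv[symmetric])
qed

lemma cls_fsweedler_eqI:
  assumes "\<And>\<phi>. kills \<phi> R \<Longrightarrow> sval (\<lambda>x. fval \<phi> (g x)) t = fval \<phi> q"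
  shows "cls R (fsweedler g t) = cls R q"
  by (rule cls_eqI) (simp add: fval_fsweedler assms)

subsection \<open>The carrier of a presented space\<close>

lemma carrier_presentedE:
  assumes "t \<in> carrier (presented X R)"
  obtains p where "t = cls R p" "Poly_Mapping.keys p \<subseteq> X"
  using assms by (auto simp: presented_def)

lemma cls_in_presented: "Poly_Mapping.keys p \<subseteq> X \<Longrightarrow> cls R p \<in> carrier (presented X R)"
  by (auto simp: presented_def)

lemma keys_fscale: "Poly_Mapping.keys (fscale a p) \<subseteq> Poly_Mapping.keys p"
  by (auto simp: in_keys_iff)

lemma subspace_keys: "free.subspace {p :: 'a \<Rightarrow>\<^sub>0 'b::field. Poly_Mapping.keys p \<subseteq> X}"
proof (rule free.subspaceI)
  fix p q :: "'a \<Rightarrow>\<^sub>0 'b"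
  assume "p \<in> {p. Poly_Mapping.keys p \<subseteq> X}" "q \<in> {p. Poly_Mapping.keys p \<subseteq> X}"
  then show "p + q \<in> {p. Poly_Mapping.keys p \<subseteq> X}"
    using Poly_Mapping.keys_add[of p q] by simp (meson Un_least order_trans)
next
  fix p :: "'a \<Rightarrow>\<^sub>0 'b" and a :: 'b
  assume "p \<in> {p. Poly_Mapping.keys p \<subseteq> X}"
  then show "fscale a p \<in> {p. Poly_Mapping.keys p \<subseteq> X}"
    using keys_fscale[of a p] by simp
qed simp

lemma keys_span:
  assumes "\<And>r. r \<in> R \<Longrightarrow> Poly_Mapping.keys r \<subseteq> X" and "p \<in> free.span R"
  shows "Poly_Mapping.keys p \<subseteq> X"
  using free.span_minimal[OF _ subspace_keys, of R X] assms by blast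

lemma keys_diff_subset:
  "Poly_Mapping.keys p \<subseteq> X \<Longrightarrow> Poly_Mapping.keys q \<subseteq> X \<Longrightarrow>
    Poly_Mapping.keys (p - q :: _ \<Rightarrow>\<^sub>0 'f::field) \<subseteq> X"
  using free.subspace_diff[OF subspace_keys, of p X q] by simp

lemma keys_add_subset:
  "Poly_Mapping.keys p \<subseteq> X \<Longrightarrow> Poly_Mapping.keys q \<subseteq> X \<Longrightarrow>
    Poly_Mapping.keys (p + q :: _ \<Rightarrow>\<^sub>0 'f::field) \<subseteq> X"
  using free.subspace_add[OF subspace_keys, of p X q] by simp

lemma keys_fscale_subset:
  "Poly_Mapping.keys p \<subseteq> X \<Longrightarrow> Poly_Mapping.keys (fscale a p) \<subseteq> X"
  using free.subspace_scale[OF subspace_keys, of p X a] by simp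

lemmas keys_subset_intros = keys_diff_subset keys_add_subset keys_fscale_subset

lemma keys_lin_ext:
  assumes "\<And>x. x \<in> Poly_Mapping.keys p \<Longrightarrow> Poly_Mapping.keys (g x) \<subseteq> X"
  shows "Poly_Mapping.keys (lin_ext fscale g p) \<subseteq> X"
proof -
  have "lin_ext fscale g p \<in> {q. Poly_Mapping.keys q \<subseteq> X}"
    unfolding lin_ext_def using assms
    by (intro free.subspace_sum[OF subspace_keys] free.subspace_scale[OF subspace_keys]) simp
  then show ?thesis by simp
qed

lemma keys_fsweedler:
  assumes "\<And>x. x \<in> Poly_Mapping.keys (rep t) \<Longrightarrow> Poly_Mapping.keys (g x) \<subseteq> X"
  shows "Poly_Mapping.keys (fsweedler g t) \<subseteq> X"
  unfolding sweedler_def by (rule keys_lin_ext) (rule assms)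

text \<open>
Formal sums may involve generators outside \<open>X\<close>, on which nothing is known. If all relations stay
within \<open>X\<close>, then so does every representative of an element of the presented space, and functionals
matter on \<open>X\<close> only (lemmas \<open>keys_rep\<close> and \<open>sval_cong\<close>).
\<close>

definition rels_within :: "'x set \<Rightarrow> ('x \<Rightarrow>\<^sub>0 'f::field) set \<Rightarrow> bool" where
  "rels_within X R \<longleftrightarrow> (\<forall>r\<in>R. Poly_Mapping.keys r \<subseteq> X)"

lemma keys_rep:
  assumes R: "rels_within X R" and t: "t \<in> carrier (presented X R)"
  shows "Poly_Mapping.keys (rep t) \<subseteq> X"
proof -
  obtain p where p: "t = cls R p" "Poly_Mapping.keys p \<subseteq> X"
    using t by (rule carrier_presentedE)
  have "Poly_Mapping.keys (rep t - p) \<subseteq> X"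
    unfolding p using R by (intro keys_span[OF _ rep_cls]) (simp add: rels_within_def)
  then show ?thesis using keys_add_subset[of "rep t - p" X p] p by simp
qed

lemma cls_rep:
  assumes t: "t \<in> carrier (presented X R)"
  shows "cls R (rep t) = t"
proof -
  obtain p where "t = cls R p" using t by (rule carrier_presentedE)
  then show ?thesis using rep_cls[of R p] by (simp add: cls_eq_iff)
qed

lemma sval_cong:
  assumes "rels_within X R" "t \<in> carrier (presented X R)" "\<And>x. x \<in> X \<Longrightarrow> f x = g x"
  shows "sval f t = sval g t"
  unfolding sweedler_def using keys_rep[OF assms(1,2)] assms(3)
  by (intro lin_ext_cong) auto

lemma vadd_presented_closed:
  assumes "t \<in> carrier (presented X R)" "u \<in> carrier (presented X R)"
  shows "vadd (presented X R) t u \<in> carrier (presented X R)"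
proof -
  obtain p q where "t = cls R p" "Poly_Mapping.keys p \<subseteq> X" "u = cls R q" "Poly_Mapping.keys q \<subseteq> X"
    using assms by (auto elim!: carrier_presentedE)
  then show ?thesis
    by (simp add: vadd_presented cls_in_presented keys_add_subset)
qed

lemma smul_presented_closed:
  assumes "t \<in> carrier (presented X R)"
  shows "smul (presented X R) a t \<in> carrier (presented X R)"
proof -
  obtain p where "t = cls R p" "Poly_Mapping.keys p \<subseteq> X"
    using assms by (auto elim!: carrier_presentedE)
  then show ?thesis
    by (simp add: smul_presented cls_in_presented keys_fscale_subset)
qed

lemma sval_vadd:
  assumes "kills \<phi> R" "t \<in> carrier (presented X R)" "u \<in> carrier (presented X R)"
  shows "sval \<phi> (vadd (presented X R) t u) = sval \<phi> t + sval \<phi> u"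
  using assms by (auto elim!: carrier_presentedE simp: vadd_presented sval_cls)

lemma sval_smul:
  assumes "kills \<phi> R" "t \<in> carrier (presented X R)"
  shows "sval \<phi> (smul (presented X R) a t) = a * sval \<phi> t"
  using assms by (auto elim!: carrier_presentedE simp: smul_presented sval_cls)

definition functional_on :: "('f::field, 'v) vspace \<Rightarrow> ('v \<Rightarrow> 'f) \<Rightarrow> bool" where
  "functional_on V f \<longleftrightarrow>
    (\<forall>x\<in>carrier V. \<forall>y\<in>carrier V. f (vadd V x y) = f x + f y) \<and>
    (\<forall>a. \<forall>x\<in>carrier V. f (smul V a x) = a * f x)"

lemma functional_onI:
  "(\<And>x y. x \<in> carrier V \<Longrightarrow> y \<in> carrier V \<Longrightarrow> f (vadd V x y) = f x + f y) \<Longrightarrow>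
   (\<And>a x. x \<in> carrier V \<Longrightarrow> f (smul V a x) = a * f x) \<Longrightarrow> functional_on V f"
  by (simp add: functional_on_def)

lemma functional_on_sval: "kills \<phi> R \<Longrightarrow> functional_on (presented X R) (sval \<phi>)"
  by (simp add: functional_on_def sval_vadd sval_smul)

lemma functional_on_full: "functional_on (full_space s) f \<longleftrightarrow> is_lin s f"
  by (simp add: functional_on_def full_space_def is_lin_def)

lemma functional_on_cls:
  assumes g: "functional_on (presented X R) g" and p: "Poly_Mapping.keys p \<subseteq> X"
  shows "g (cls R p) = fval (\<lambda>x. g (cls R (gen x))) p"
proof -
  have zero: "g (cls R 0) = 0"
  proof -
    have c: "cls R 0 \<in> carrier (presented X R)" by (rule cls_in_presented) simp
    have "cls R 0 = smul (presented X R) 0 (cls R 0)" by (simp add: smul_presented)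
    then have "g (cls R 0) = 0 * g (cls R 0)"
      using g c unfolding functional_on_def by metis
    then show ?thesis by simp
  qed
  have *: "g (cls R (\<Sum>x\<in>A. fscale (c x) (gen x))) = (\<Sum>x\<in>A. c x * g (cls R (gen x)))"
    if "finite A" "A \<subseteq> X" for A c
    using that
  proof (induction A rule: finite_induct)
    case empty
    then show ?case by (simp add: zero)
  next
    case (insert x A)
    let ?q = "\<Sum>x\<in>A. fscale (c x) (gen x)"
    have q: "Poly_Mapping.keys ?q \<subseteq> X"
      using free.subspace_sum[OF subspace_keys, of A "\<lambda>x. fscale (c x) (gen x)" X]
        keys_fscale_subset[of "gen _" X] insert.prems by auto
    have x: "cls R (gen x) \<in> carrier (presented X R)"
      using insert.prems by (intro cls_in_presented) simp
    have "cls R (\<Sum>x\<in>insert x A. fscale (c x) (gen x)) =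
        vadd (presented X R) (smul (presented X R) (c x) (cls R (gen x))) (cls R ?q)"
      using insert.hyps by (simp add: vadd_presented smul_presented)
    then show ?case
      using g insert x smul_presented_closed[OF x, of "c x"] cls_in_presented[OF q, of R]
      by (simp add: functional_on_def)
  qed
  have "p = (\<Sum>x\<in>Poly_Mapping.keys p. fscale (Poly_Mapping.lookup p x) (gen x))"
    using lin_ext_fscale_gen[of p] by (simp add: lin_ext_def)
  then show ?thesis
    using *[OF finite_keys p, of "Poly_Mapping.lookup p"] by (simp add: lin_ext_def)
qed

text \<open>
Every linear functional on a presented space comes from a function on the generators that
vanishes on the relations (see also \<open>functional_on_kills\<close>).
\<close>

lemma functional_on_sval_eq:
  assumes g: "functional_on (presented X R) g" and t: "t \<in> carrier (presented X R)"
    and R: "rels_within X R"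
  shows "sval (\<lambda>x. g (cls R (gen x))) t = g t"
  using functional_on_cls[OF g keys_rep[OF R t]] by (simp add: sweedler_def cls_rep[OF t])

lemma functional_on_kills:
  assumes g: "functional_on (presented X R) g" and R: "rels_within X R"
  shows "kills (\<lambda>x. g (cls R (gen x))) R"
  unfolding kills_def
proof
  fix r assume r: "r \<in> R"
  then have "fval (\<lambda>x. g (cls R (gen x))) r = g (cls R r)"
    using functional_on_cls[OF g] R by (simp add: rels_within_def)
  also have "cls R r = cls R 0"
    using r by (simp add: cls_eq_iff free.span_base)
  also have "g (cls R 0) = 0"
    using functional_on_cls[OF g, of 0] by simp
  finally show "fval (\<lambda>x. g (cls R (gen x))) r = 0" .
qed

subsection \<open>Relations of tensor products\<close>

definition vclosed :: "('f, 'v) vspace \<Rightarrow> bool" where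
  "vclosed V \<longleftrightarrow> (\<forall>x\<in>carrier V. \<forall>y\<in>carrier V. vadd V x y \<in> carrier V) \<and>
    (\<forall>a. \<forall>x\<in>carrier V. smul V a x \<in> carrier V)"

lemma vclosed_full [simp]: "vclosed (full_space s)"
  by (simp add: vclosed_def full_space_def)

lemma vclosed_presented: "vclosed (presented X R)"
  by (simp add: vclosed_def vadd_presented_closed smul_presented_closed)

lemma full_space_simps [simp]:
  "carrier (full_space s) = UNIV" "vadd (full_space s) = (+)" "smul (full_space s) = s"
  by (simp_all add: full_space_def)

lemma kills_Un: "kills \<phi> (R \<union> R') \<longleftrightarrow> kills \<phi> R \<and> kills \<phi> R'"
  by (auto simp: kills_def)

lemma kills_Collect3:
  "kills \<phi> {F a b c |a b c. P a b c} \<longleftrightarrow> (\<forall>a b c. P a b c \<longrightarrow> fval \<phi> (F a b c) = 0)"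
  unfolding kills_def by blast

lemma kills_Collect4:
  "kills \<phi> {F a b c d |a b c d. P a b c d} \<longleftrightarrow> (\<forall>a b c d. P a b c d \<longrightarrow> fval \<phi> (F a b c d) = 0)"
  unfolding kills_def by blast

lemma kills_tensor_rels:
  "kills \<phi> (tensor_rels V W) \<longleftrightarrow>
    (\<forall>w\<in>carrier W. functional_on V (\<lambda>v. \<phi> (v, w))) \<and>
    (\<forall>v\<in>carrier V. functional_on W (\<lambda>w. \<phi> (v, w)))"
  unfolding tensor_rels_def kills_Un kills_Collect3 functional_on_def
  by (simp add: diff_diff_eq) blast

lemma kills_bal_tensor_rels:
  "kills \<phi> (bal_tensor_rels V W K ra la) \<longleftrightarrow> kills \<phi> (tensor_rels V W) \<and>
    (\<forall>v\<in>carrier V. \<forall>k\<in>K. \<forall>w\<in>carrier W. \<phi> (ra v k, w) = \<phi> (v, la k w))"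
  unfolding bal_tensor_rels_def kills_Un kills_Collect3 by simp blast

lemma kills_tpow_rels:
  "kills \<phi> (tpow_rels V n) \<longleftrightarrow>
    (\<forall>us ws. length us + length ws + 1 = n \<and> set us \<union> set ws \<subseteq> carrier V \<longrightarrow>
      functional_on V (\<lambda>v. \<phi> (us @ v # ws)))"
  unfolding tpow_rels_def kills_Un kills_Collect4 functional_on_def
  by (simp add: diff_diff_eq) blast

lemma kills_tensor_full:
  "kills (\<lambda>(a, b). B a b) (tensor_rels (full_space s) (full_space s')) \<longleftrightarrow> bilin s s' B"
  by (simp add: kills_tensor_rels functional_on_full bilin_def)

lemma rels_within_Un: "rels_within X (R \<union> R') \<longleftrightarrow> rels_within X R \<and> rels_within X R'"
  by (auto simp: rels_within_def)

lemma rels_within_Collect3: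
  "rels_within X {F a b c |a b c. P a b c} \<longleftrightarrow>
    (\<forall>a b c. P a b c \<longrightarrow> Poly_Mapping.keys (F a b c) \<subseteq> X)"
  unfolding rels_within_def by blast

lemma rels_within_Collect4:
  "rels_within X {F a b c d |a b c d. P a b c d} \<longleftrightarrow>
    (\<forall>a b c d. P a b c d \<longrightarrow> Poly_Mapping.keys (F a b c d) \<subseteq> X)"
  unfolding rels_within_def by blast

lemma rels_within_tensor:
  "vclosed V \<Longrightarrow> vclosed W \<Longrightarrow> rels_within (carrier V \<times> carrier W) (tensor_rels V W)"
  unfolding tensor_rels_def rels_within_Un rels_within_Collect3
  by (intro conjI allI impI keys_subset_intros) (simp_all add: vclosed_def)

lemma rels_within_bal_tensor:
  assumes "vclosed V" "vclosed W"
    "\<And>v k. v \<in> carrier V \<Longrightarrow> k \<in> K \<Longrightarrow> ra v k \<in> carrier V"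
    "\<And>w k. w \<in> carrier W \<Longrightarrow> k \<in> K \<Longrightarrow> la k w \<in> carrier W"
  shows "rels_within (carrier V \<times> carrier W) (bal_tensor_rels V W K ra la)"
  using rels_within_tensor[OF assms(1,2)] assms(3,4)
  unfolding bal_tensor_rels_def rels_within_Un rels_within_Collect3
  by (intro conjI allI impI keys_subset_intros) simp_all

lemma rels_within_tpow:
  "vclosed V \<Longrightarrow> rels_within {vs. length vs = n \<and> set vs \<subseteq> carrier V} (tpow_rels V n)"
  unfolding tpow_rels_def rels_within_Un rels_within_Collect4
  by (intro conjI allI impI keys_subset_intros) (simp_all add: vclosed_def)


text \<open>
A linear map into a presented space lifts to a linear map into the free space: representatives are
chosen on a basis only.
\<close>

lemma linear_lift:
  fixes s :: "'f::field \<Rightarrow> 'v::ab_group_add \<Rightarrow> 'v"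
  assumes s: "vector_space s" and c: "linear_on (full_space s) (presented X R) c"
  shows "\<exists>P. Vector_Spaces.linear s fscale P \<and> (\<forall>x. cls R (P x) = c x)"
proof -
  interpret s: vector_space s by (rule s)
  interpret vp: vector_space_pair s "fscale :: 'f \<Rightarrow> ('b \<Rightarrow>\<^sub>0 'f) \<Rightarrow> _"
    by (intro vector_space_pair.intro s vector_space_fscale)
  obtain B where B: "s.independent B" "UNIV \<subseteq> s.span B"
    using s.maximal_independent_subset[of UNIV] by blast
  define P where "P = vp.construct B (\<lambda>b. rep (c b))"
  have P: "Vector_Spaces.linear s fscale P"
    unfolding P_def by (rule vp.linear_construct[OF B(1)])
  interpret P: Vector_Spaces.linear s fscale P by (rule P)
  have c_closed: "c x \<in> carrier (presented X R)"
    and c_add: "c (x + y) = vadd (presented X R) (c x) (c y)"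
    and c_scale: "c (s a x) = smul (presented X R) a (c x)" for x y a
    using c by (auto simp: linear_on_def)
  have "cls R (P x) = c x" for x
  proof (rule s.span_induct[of x B "\<lambda>x. cls R (P x) = c x"])
    show "x \<in> s.span B" using B by blast
    show "s.subspace {x. cls R (P x) = c x}"
    proof (rule s.subspaceI)
      obtain p where "c 0 = cls R p" using c_closed by (rule carrier_presentedE)
      then have "c (s 0 0) = cls R 0" by (simp only: c_scale smul_presented free.scale_zero_left)
      then show "0 \<in> {x. cls R (P x) = c x}" by (simp add: P.zero)
      show "x + y \<in> {x. cls R (P x) = c x}"
        if "x \<in> {x. cls R (P x) = c x}" "y \<in> {x. cls R (P x) = c x}" for x y
        using that by (simp add: P.add c_add vadd_presented flip: vadd_presented[of X R "P x" "P y"])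
      show "s a x \<in> {x. cls R (P x) = c x}" if "x \<in> {x. cls R (P x) = c x}" for a x
        using that by (simp add: P.scale c_scale flip: smul_presented[of X R a "P x"])
    qed
    show "cls R (P b) = c b" if "b \<in> B" for b
      using that B(1) by (simp add: P_def vp.construct_basis cls_rep[OF c_closed])
  qed
  then show ?thesis using P by blast
qed

lemma fval_eqI: "kills \<phi> R \<Longrightarrow> cls R p = cls R q \<Longrightarrow> fval \<phi> p = fval \<phi> q"
  by (metis sval_cls)

lemma cls_eq_if_mem: "p \<in> cls R q \<Longrightarrow> cls R q = cls R p"
  unfolding cls_eq_iff by (metis cls_def free.span_neg mem_Collect_eq minus_diff_eq)

section \<open>Sweedler sums\<close>

definition trilin where
  "trilin s s' s'' T \<longleftrightarrow> (\<forall>b c. is_lin s (\<lambda>a. T a b c)) \<and> (\<forall>a c. is_lin s' (\<lambda>b. T a b c)) \<and>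
    (\<forall>a b. is_lin s'' (\<lambda>c. T a b c))"

context hopf_algebra
begin

abbreviation lin :: "('h \<Rightarrow> 'f) \<Rightarrow> bool" where
  "lin \<equiv> is_lin (hscale H)"

text \<open>
The representatives of the coproduct are chosen linearly. As a consequence \<open>comult_sum x B\<close> is linear in
\<open>x\<close> for every function \<open>B\<close>, which keeps linearity arguments about nested sums mechanical. For bilinear
\<open>B\<close> it agrees with the sum over any representative of \<open>comult H x\<close>. The same device is used for the
coaction.
\<close>

definition comult_lift :: "'h \<Rightarrow> ('h \<times> 'h \<Rightarrow>\<^sub>0 'f)" where
  "comult_lift = (SOME P. Vector_Spaces.linear (hscale H) fscale P \<and>
    (\<forall>x. cls (tensor_rels (hspace H) (hspace H)) (P x) = comult H x))"

definition comult_sum :: "'h \<Rightarrow> ('h \<Rightarrow> 'h \<Rightarrow> 'f) \<Rightarrow> 'f" where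
  "comult_sum x B = fval (\<lambda>(a, b). B a b) (comult_lift x)"

lemma comult_lift:
  "Vector_Spaces.linear (hscale H) fscale comult_lift"
  "cls (tensor_rels (hspace H) (hspace H)) (comult_lift x) = comult H x"
  using someI_ex[OF linear_lift[OF vector_space comult_linear[unfolded tensor_def]]]
  unfolding comult_lift_def by blast+

lemma sval_comult:
  assumes "bilin (hscale H) (hscale H) B"
  shows "sval (\<lambda>(a, b). B a b) (comult H x) = comult_sum x B"
  unfolding comult_sum_def comult_lift(2)[symmetric]
  by (rule sval_cls) (simp add: kills_tensor_full assms)

lemma comult_sum_add: "comult_sum (x + y) B = comult_sum x B + comult_sum y B"
proof -
  interpret l: Vector_Spaces.linear "hscale H" fscale comult_lift by (rule comult_lift)
  show ?thesis by (simp add: comult_sum_def l.add)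
qed

lemma comult_sum_scale: "comult_sum (hscale H c x) B = c * comult_sum x B"
proof -
  interpret l: Vector_Spaces.linear "hscale H" fscale comult_lift by (rule comult_lift)
  show ?thesis by (simp add: comult_sum_def l.scale)
qed

lemma comult_sum_fun_add:
  "comult_sum x (\<lambda>a b. B a b + C a b) = comult_sum x B + comult_sum x C"
  by (simp add: comult_sum_def case_prod_unfold fval_fun_add)

lemma comult_sum_fun_mult: "comult_sum x (\<lambda>a b. c * B a b) = c * comult_sum x B"
  by (simp add: comult_sum_def case_prod_unfold fval_fun_mult)

lemma comult_sum_fun_mult_right: "comult_sum x (\<lambda>a b. B a b * c) = comult_sum x B * c"
  using comult_sum_fun_mult[of x c B] by (simp add: mult.commute)

lemma comult_sum_fun_mult_middle:
  "comult_sum x (\<lambda>a b. B a b * (c * C a b)) = c * comult_sum x (\<lambda>a b. B a b * C a b)"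
  using comult_sum_fun_mult[of x c "\<lambda>a b. B a b * C a b"] by (simp add: mult.left_commute)

lemma comult_sum_fun_zero [simp]: "comult_sum x (\<lambda>a b. 0) = 0"
  using comult_sum_fun_mult[of x 0 "\<lambda>a b. 0"] by simp

lemma comult_sum_swap:
  "comult_sum x (\<lambda>a b. comult_sum y (\<lambda>c d. B a b c d)) =
   comult_sum y (\<lambda>c d. comult_sum x (\<lambda>a b. B a b c d))"
  unfolding comult_sum_def case_prod_unfold by (rule fval_swap)

lemma counit_add: "counit H (x + y) = counit H x + counit H y"
  and counit_scale: "counit H (hscale H c x) = c * counit H x"
  using counit_linear vector_space vector_space_field by (auto simp: Vector_Spaces.linear_iff)

lemma antipode_add: "antipode H (x + y) = antipode H x + antipode H y"
  and antipode_scale: "antipode H (hscale H c x) = hscale H c (antipode H x)"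
  using antipode_linear vector_space by (auto simp: Vector_Spaces.linear_iff)

lemmas linear_simps =
  comult_sum_add comult_sum_scale comult_sum_fun_add comult_sum_fun_mult
  comult_sum_fun_mult_right comult_sum_fun_mult_middle
  counit_add counit_scale antipode_add antipode_scale scale_mult_left scale_mult_right
  distrib_left distrib_right mult.assoc

lemma linD: "lin f \<Longrightarrow> f (x + y) = f x + f y" "lin f \<Longrightarrow> f (hscale H c x) = c * f x"
  by (simp_all add: is_lin_def)

lemma comult_sum_counit_left:
  assumes f: "lin f"
  shows "comult_sum x (\<lambda>a b. counit H a * f b) = f x"
proof -
  have "f x = sval (\<lambda>p. f (case p of (a, b) \<Rightarrow> hscale H (counit H a) b)) (comult H x)"
    using is_lin_sweedler[OF vector_space f] counit_left[of x] by metis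
  also have "\<dots> = sval (\<lambda>(a, b). counit H a * f b) (comult H x)"
    by (simp add: case_prod_unfold linD[OF f])
  also have "\<dots> = comult_sum x (\<lambda>a b. counit H a * f b)"
    by (rule sval_comult) (simp add: bilin_def is_lin_def linear_simps linD[OF f] mult.left_commute)
  finally show ?thesis ..
qed

lemma comult_sum_counit_right:
  assumes f: "lin f"
  shows "comult_sum x (\<lambda>a b. counit H b * f a) = f x"
proof -
  have "f x = sval (\<lambda>p. f (case p of (a, b) \<Rightarrow> hscale H (counit H b) a)) (comult H x)"
    using is_lin_sweedler[OF vector_space f] counit_right[of x] by metis
  also have "\<dots> = sval (\<lambda>(a, b). counit H b * f a) (comult H x)"
    by (simp add: case_prod_unfold linD[OF f])
  also have "\<dots> = comult_sum x (\<lambda>a b. counit H b * f a)"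
    by (rule sval_comult) (simp add: bilin_def is_lin_def linear_simps linD[OF f] mult.left_commute)
  finally show ?thesis ..
qed

lemma comult_sum_antipode_left:
  assumes f: "lin f"
  shows "comult_sum x (\<lambda>a b. f (antipode H a * b)) = counit H x * f 1"
proof -
  have "counit H x * f 1 = f (hscale H (counit H x) 1)" by (simp add: linD[OF f])
  also have "\<dots> = sval (\<lambda>p. f (case p of (a, b) \<Rightarrow> antipode H a * b)) (comult H x)"
    using is_lin_sweedler[OF vector_space f] antipode_left[of x] by metis
  also have "\<dots> = sval (\<lambda>(a, b). f (antipode H a * b)) (comult H x)"
    by (simp add: case_prod_unfold)
  also have "\<dots> = comult_sum x (\<lambda>a b. f (antipode H a * b))"
    by (rule sval_comult) (simp add: bilin_def is_lin_def linear_simps linD[OF f])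
  finally show ?thesis ..
qed

lemma comult_sum_antipode_right:
  assumes f: "lin f"
  shows "comult_sum x (\<lambda>a b. f (a * antipode H b)) = counit H x * f 1"
proof -
  have "counit H x * f 1 = f (hscale H (counit H x) 1)" by (simp add: linD[OF f])
  also have "\<dots> = sval (\<lambda>p. f (case p of (a, b) \<Rightarrow> a * antipode H b)) (comult H x)"
    using is_lin_sweedler[OF vector_space f] antipode_right[of x] by metis
  also have "\<dots> = sval (\<lambda>(a, b). f (a * antipode H b)) (comult H x)"
    by (simp add: case_prod_unfold)
  also have "\<dots> = comult_sum x (\<lambda>a b. f (a * antipode H b))"
    by (rule sval_comult) (simp add: bilin_def is_lin_def linear_simps linD[OF f])
  finally show ?thesis ..
qed

text \<open>
Trilinear functions are functionals on \<open>V \<otimes> (H \<otimes> W)\<close>, the space in which coassociativity is stated.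
\<close>

lemma kills_nested_tensor:
  assumes T: "trilin s (hscale H) s' T" 
  shows "kills (\<lambda>(a, t). sval (\<lambda>(b, c). T a b c) t)
    (tensor_rels (full_space s) (tensor (hspace H) (full_space s')))"
proof -
  have "functional_on (tensor (hspace H) (full_space s')) (sval (\<lambda>(b, c). T a b c))" for a
    unfolding tensor_def using T
    by (intro functional_on_sval) (simp add: kills_tensor_full trilin_def bilin_def)
  moreover have "is_lin s (\<lambda>a. sval (\<lambda>(b, c). T a b c) t)" for t
    using T by (simp add: trilin_def is_lin_def case_prod_unfold sval_fun_add sval_fun_mult)
  ultimately show ?thesis
    by (simp add: kills_tensor_rels functional_on_full)
qed

lemma sval_cls_tensor:
  assumes "bilin (hscale H) s B"
  shows "sval (\<lambda>(a, b). B a b) (cls (tensor_rels (hspace H) (full_space s)) p) = fval (\<lambda>(a, b). B a b) p"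
  by (rule sval_cls) (simp add: kills_tensor_full assms)

lemma comult_sum_coassoc:
  assumes T: "trilin (hscale H) (hscale H) (hscale H) T"
  shows "comult_sum x (\<lambda>a b. comult_sum b (\<lambda>b1 b2. T a b1 b2)) =
    comult_sum x (\<lambda>a b. comult_sum a (\<lambda>a1 a2. T a1 a2 b))"
proof -
  have T_lin: "bilin (hscale H) (hscale H) (T a)" "bilin (hscale H) (hscale H) (\<lambda>a b. T a b c)" for a c
    using T by (simp_all add: trilin_def bilin_def)
  note T' = T[unfolded trilin_def is_lin_def]
  have T_fun: "T (x + y) = (\<lambda>b c. T x b c + T y b c)" "T (hscale H k x) = (\<lambda>b c. k * T x b c)" for x y k
    using T' by (intro ext; simp)+
  let ?\<phi> = "\<lambda>(a, t). sval (\<lambda>(b, c). T a b c) t"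
  have "fval ?\<phi> (fsweedler (\<lambda>(a, b). gen (a, comult H b)) (comult H x)) =
      sval (\<lambda>(a, b). comult_sum b (T a)) (comult H x)"
    by (simp add: fval_fsweedler case_prod_unfold sval_comult[OF T_lin(1), unfolded case_prod_unfold])
  also have "\<dots> = comult_sum x (\<lambda>a b. comult_sum b (T a))"
    by (rule sval_comult) (simp add: bilin_def is_lin_def linear_simps T_fun)
  finally have L: "fval ?\<phi> (fsweedler (\<lambda>(a, b). gen (a, comult H b)) (comult H x)) =
      comult_sum x (\<lambda>a b. comult_sum b (T a))" .
  have "fval ?\<phi> (fsweedler (\<lambda>(a, b).
            fsweedler (\<lambda>(a1, a2). gen (a1, cls (tensor_rels (hspace H) (hspace H)) (gen (a2, b))))
              (comult H a)) (comult H x)) =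
      sval (\<lambda>(a, b). comult_sum a (\<lambda>a1 a2. T a1 a2 b)) (comult H x)"
    by (simp add: fval_fsweedler case_prod_unfold sval_cls_tensor[OF T_lin(1), unfolded case_prod_unfold]
      sval_comult[OF T_lin(2), unfolded case_prod_unfold])
  also have "\<dots> = comult_sum x (\<lambda>a b. comult_sum a (\<lambda>a1 a2. T a1 a2 b))"
    by (rule sval_comult) (use T' in \<open>simp add: bilin_def is_lin_def linear_simps\<close>)
  finally show ?thesis
    using L fval_eqI[OF kills_nested_tensor[OF T] coassoc] by metis
qed

lemma comult_sum_mult:
  assumes B: "bilin (hscale H) (hscale H) B"
  shows "comult_sum (x * y) B =
    comult_sum x (\<lambda>x1 x2. comult_sum y (\<lambda>y1 y2. B (x1 * y1) (x2 * y2)))"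
proof -
  note B' = B[unfolded bilin_def is_lin_def]
  have *: "bilin (hscale H) (hscale H) (\<lambda>y1 y2. B (x1 * y1) (x2 * y2))" for x1 x2
    using B' by (simp add: bilin_def is_lin_def linear_simps)
  have "comult_sum (x * y) B = sval (\<lambda>(a, b). B a b) (comult H (x * y))"
    by (simp add: sval_comult[OF B])
  also have "\<dots> = sval (\<lambda>(x1, x2). sval (\<lambda>(y1, y2). B (x1 * y1) (x2 * y2)) (comult H y)) (comult H x)"
    unfolding comult_mult sval_cls_tensor[OF B] by (simp add: fval_fsweedler case_prod_unfold)
  also have "\<dots> = sval (\<lambda>(x1, x2). comult_sum y (\<lambda>y1 y2. B (x1 * y1) (x2 * y2))) (comult H x)"
    by (simp add: case_prod_unfold sval_comult[OF *, unfolded case_prod_unfold])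
  also have "\<dots> = comult_sum x (\<lambda>x1 x2. comult_sum y (\<lambda>y1 y2. B (x1 * y1) (x2 * y2)))"
    by (rule sval_comult) (use B' in \<open>simp add: bilin_def is_lin_def linear_simps\<close>)
  finally show ?thesis .
qed

lemma comult_sum_one:
  assumes B: "bilin (hscale H) (hscale H) B"
  shows "comult_sum 1 B = B 1 1"
  using sval_comult[OF B, of 1] by (simp add: comult_one sval_cls_tensor[OF B])

lemma antipode_one:
  assumes f: "lin f"
  shows "f (antipode H 1) = f 1"
proof -
  have "bilin (hscale H) (hscale H) (\<lambda>a b. f (antipode H a * b))"
    by (simp add: bilin_def is_lin_def linear_simps linD[OF f])
  then show ?thesis
    using comult_sum_antipode_left[OF f, of 1] by (simp add: comult_sum_one counit_one)
qed

text \<open>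
The antipode reverses products because both \<open>S(xy)\<close> and \<open>S(y)S(x)\<close> are convolution inverses of
multiplication.
\<close>

lemma antipode_mult:
  assumes f: "lin f"
  shows "f (antipode H (x * y)) = f (antipode H y * antipode H x)"
proof -
  note simps = linear_simps linD[OF f]
  let ?S = "antipode H"
  have inner: "comult_sum u (\<lambda>u1 u2. comult_sum v (\<lambda>v1 v2. g (?S (u1 * v1) * (u2 * v2)))) =
      counit H u * counit H v * g 1" if "lin g" for g u v
  proof -
    have "comult_sum u (\<lambda>u1 u2. comult_sum v (\<lambda>v1 v2. g (?S (u1 * v1) * (u2 * v2)))) =
        comult_sum (u * v) (\<lambda>a b. g (?S a * b))"
      by (rule comult_sum_mult[symmetric]) (simp add: bilin_def is_lin_def linear_simps linD[OF that])
    then show ?thesis by (simp add: comult_sum_antipode_left[OF that] counit_mult)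
  qed
  \<comment> \<open>the sum over \<open>S(x\<^sub>1 y\<^sub>1) x\<^sub>2 y\<^sub>2 S(y\<^sub>3) S(x\<^sub>3)\<close>, collapsed from the left and from the right\<close>
  have "f (?S y * ?S x) =
      comult_sum x (\<lambda>a b. comult_sum y (\<lambda>c d. counit H a * (counit H c * f (?S d * ?S b))))"
    by (simp add: comult_sum_fun_mult comult_sum_counit_left[OF is_linI] simps)
  also have "\<dots> = comult_sum x (\<lambda>a b. comult_sum y (\<lambda>c d.
      comult_sum a (\<lambda>a1 a2. comult_sum c (\<lambda>c1 c2. f (?S (a1 * c1) * (a2 * c2) * (?S d * ?S b))))))"
    by (subst inner[where g = "\<lambda>z. f (z * (?S _ * ?S _))"]) (simp_all add: is_lin_def simps)
  also have "\<dots> = comult_sum x (\<lambda>a b. comult_sum a (\<lambda>a1 a2. comult_sum y (\<lambda>c d.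
      comult_sum c (\<lambda>c1 c2. f (?S (a1 * c1) * (a2 * c2) * (?S d * ?S b))))))"
    by (subst comult_sum_swap) (rule refl)
  also have "\<dots> = comult_sum x (\<lambda>a b. comult_sum b (\<lambda>b1 b2. comult_sum y (\<lambda>c d.
      comult_sum d (\<lambda>d1 d2. f (?S (a * c) * (b1 * d1) * (?S d2 * ?S b2))))))"
    by (subst comult_sum_coassoc[symmetric, of _ x], simp add: trilin_def is_lin_def simps)
      (subst comult_sum_coassoc[symmetric, of _ y], simp_all add: trilin_def is_lin_def simps)
  also have "\<dots> = comult_sum x (\<lambda>a b. comult_sum b (\<lambda>b1 b2. comult_sum y (\<lambda>c d.
      counit H d * f (?S (a * c) * (b1 * ?S b2)))))"
  proof -
    have "comult_sum d (\<lambda>d1 d2. f (?S (a * c) * (b1 * d1) * (?S d2 * ?S b2))) =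
        counit H d * f (?S (a * c) * (b1 * ?S b2))" for a b1 b2 c d
      using comult_sum_antipode_right[of "\<lambda>z. f (?S (a * c) * (b1 * (z * ?S b2)))" d]
      by (simp add: is_lin_def simps)
    then show ?thesis by simp
  qed
  also have "\<dots> = comult_sum x (\<lambda>a b. comult_sum b (\<lambda>b1 b2. f (?S (a * y) * (b1 * ?S b2))))"
    by (subst comult_sum_counit_right) (simp_all add: is_lin_def simps)
  also have "\<dots> = comult_sum x (\<lambda>a b. counit H b * f (?S (a * y)))"
    by (subst comult_sum_antipode_right[where f = "\<lambda>z. f (?S (_ * y) * z)"])
      (simp_all add: is_lin_def simps)
  also have "\<dots> = f (?S (x * y))"
    by (subst comult_sum_counit_right) (simp_all add: is_lin_def simps)
  finally show ?thesis ..
qed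

subsection \<open>Sums over the diagonal action\<close>

text \<open>
No condition on the length of the lists is imposed. The functions used below vanish on all lists but
those of one length, and for them this is ordinary multilinearity.
\<close>

definition multilin :: "('h list \<Rightarrow> 'f) \<Rightarrow> bool" where
  "multilin L \<longleftrightarrow> (\<forall>us ws. lin (\<lambda>x. L (us @ x # ws)))"

text \<open>
The sum of \<open>L [x\<^sub>(\<^sub>1\<^sub>) h\<^sub>1, \<dots>, x\<^sub>(\<^sub>n\<^sub>) h\<^sub>n]\<close>, that is, the transpose of the diagonal action on tensors.
\<close>

primrec diag_sum :: "'h \<Rightarrow> 'h list \<Rightarrow> ('h list \<Rightarrow> 'f) \<Rightarrow> 'f" where
  "diag_sum x [] L = counit H x * L []"
| "diag_sum x (h # hs) L = comult_sum x (\<lambda>a b. diag_sum b hs (\<lambda>ls. L (a * h # ls)))"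

lemma multilinD:
  assumes "multilin L"
  shows "L (us @ (x + y) # ws) = L (us @ x # ws) + L (us @ y # ws)"
    and "L (us @ hscale H c x # ws) = c * L (us @ x # ws)"
    and "L ((x + y) # ws) = L (x # ws) + L (y # ws)"
    and "L (hscale H c x # ws) = c * L (x # ws)"
    and "L (h # (x + y) # ws) = L (h # x # ws) + L (h # y # ws)"
    and "L (h # hscale H c x # ws) = c * L (h # x # ws)"
    and "L (h # us @ (x + y) # ws) = L (h # us @ x # ws) + L (h # us @ y # ws)"
    and "L (h # us @ hscale H c x # ws) = c * L (h # us @ x # ws)"
    and "L (us @ h # (x + y) # ws) = L (us @ h # x # ws) + L (us @ h # y # ws)"
    and "L (us @ h # hscale H c x # ws) = c * L (us @ h # x # ws)"
proof -
  note L = assms[unfolded multilin_def is_lin_def]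
  note Ls = L[rule_format, THEN conjunct1, rule_format] L[rule_format, THEN conjunct2, rule_format]
  show
    "L (us @ (x + y) # ws) = L (us @ x # ws) + L (us @ y # ws)"
    "L (us @ hscale H c x # ws) = c * L (us @ x # ws)"
    by (simp_all add: Ls)
  show
    "L ((x + y) # ws) = L (x # ws) + L (y # ws)"
    "L (hscale H c x # ws) = c * L (x # ws)"
    using Ls[of "[]"] by simp_all
  show "L (h # (x + y) # ws) = L (h # x # ws) + L (h # y # ws)"
    "L (h # hscale H c x # ws) = c * L (h # x # ws)"
    using Ls[of "[h]"] by simp_all
  show "L (h # us @ (x + y) # ws) = L (h # us @ x # ws) + L (h # us @ y # ws)"
    "L (h # us @ hscale H c x # ws) = c * L (h # us @ x # ws)"
    using Ls[of "h # us"] by simp_all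
  show "L (us @ h # (x + y) # ws) = L (us @ h # x # ws) + L (us @ h # y # ws)"
    "L (us @ h # hscale H c x # ws) = c * L (us @ h # x # ws)"
    using Ls[of "us @ [h]"] by simp_all
qed

lemma multilinI:
  assumes "\<And>us x y ws. L (us @ (x + y) # ws) = L (us @ x # ws) + L (us @ y # ws)"
    and "\<And>us c x ws. L (us @ hscale H c x # ws) = c * L (us @ x # ws)"
  shows "multilin L"
  using assms by (simp add: multilin_def is_lin_def)

lemma multilin_Cons: "multilin L \<Longrightarrow> multilin (\<lambda>ls. L (a # ls))"
  by (rule multilinI) (simp_all add: multilinD)

lemma diag_sum_add: "diag_sum (x + y) hs L = diag_sum x hs L + diag_sum y hs L"
  by (cases hs) (simp_all add: linear_simps)

lemma diag_sum_scale: "diag_sum (hscale H c x) hs L = c * diag_sum x hs L"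
  by (cases hs) (simp_all add: linear_simps)

lemma diag_sum_fun_add: "diag_sum x hs (\<lambda>ls. L ls + L' ls) = diag_sum x hs L + diag_sum x hs L'"
  by (induction hs arbitrary: x L L') (simp_all add: linear_simps)

lemma diag_sum_fun_mult: "diag_sum x hs (\<lambda>ls. c * L ls) = c * diag_sum x hs L"
  by (induction hs arbitrary: x L) (simp_all add: linear_simps)

lemma diag_sum_fun_zero [simp]: "diag_sum x hs (\<lambda>ls. 0) = 0"
  using diag_sum_fun_mult[of x hs 0 "\<lambda>ls. 0"] by simp

lemmas diag_linear_simps =
  linear_simps diag_sum_add diag_sum_scale diag_sum_fun_add diag_sum_fun_mult

lemma diag_sum_cong:
  "(\<And>ls. length ls = length hs \<Longrightarrow> L ls = L' ls) \<Longrightarrow> diag_sum x hs L = diag_sum x hs L'"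
proof (induction hs arbitrary: x L L')
  case (Cons h hs)
  have "diag_sum b hs (\<lambda>ls. L (a * h # ls)) = diag_sum b hs (\<lambda>ls. L' (a * h # ls))" for a b
    by (rule Cons.IH) (simp add: Cons.prems)
  then show ?case by simp
qed simp

lemma diag_sum_comult_swap:
  "diag_sum y hs (\<lambda>ls. comult_sum x (\<lambda>a b. G a b ls)) = comult_sum x (\<lambda>a b. diag_sum y hs (G a b))"
proof (induction hs arbitrary: y G)
  case (Cons h hs)
  show ?case by (simp add: Cons.IH) (rule comult_sum_swap)
qed (simp add: linear_simps)

lemma multilin_diag_sum:
  assumes "multilin L"
  shows "multilin (\<lambda>hs. diag_sum x hs L)"
proof (rule multilinI)
  show "diag_sum x (us @ (y + z) # ws) L = diag_sum x (us @ y # ws) L + diag_sum x (us @ z # ws) L"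
    for us y z ws
    using assms
    by (induction us arbitrary: x L) (simp_all add: diag_linear_simps multilinD multilin_Cons)
  show "diag_sum x (us @ hscale H c y # ws) L = c * diag_sum x (us @ y # ws) L"
    for us y c ws
    using assms
    by (induction us arbitrary: x L) (simp_all add: diag_linear_simps multilinD multilin_Cons)
qed

lemma diag_sum_append:
  assumes "multilin L"
  shows "diag_sum x (us @ ws) L =
    comult_sum x (\<lambda>a b. diag_sum a us (\<lambda>us'. diag_sum b ws (\<lambda>ws'. L (us' @ ws'))))"
  using assms
proof (induction us arbitrary: x L)
  case Nil
  show ?case by (simp add: comult_sum_counit_left[OF is_linI] diag_linear_simps)
next
  case (Cons u us)
  note L = multilinD[OF Cons.prems]
  have "diag_sum x ((u # us) @ ws) L =
      comult_sum x (\<lambda>a b. comult_sum b (\<lambda>b1 b2. diag_sum b1 us (\<lambda>us'. diag_sum b2 ws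
        (\<lambda>ws'. L (a * u # us' @ ws')))))"
    by (simp add: Cons.IH[OF multilin_Cons[OF Cons.prems]])
  also have "\<dots> = comult_sum x (\<lambda>a b. comult_sum a (\<lambda>a1 a2. diag_sum a2 us (\<lambda>us'. diag_sum b ws
        (\<lambda>ws'. L (a1 * u # us' @ ws')))))"
    by (rule comult_sum_coassoc) (simp add: trilin_def is_lin_def diag_linear_simps L)
  finally show ?case by simp
qed

lemma diag_sum_mult:
  assumes "multilin L"
  shows "diag_sum (x * y) hs L = diag_sum y hs (\<lambda>ls. diag_sum x ls L)"
  using assms
proof (induction hs arbitrary: x y L)
  case Nil
  show ?case by (simp add: counit_mult mult.left_commute)
next
  case (Cons h hs)
  note L = multilinD[OF Cons.prems]
  have "diag_sum (x * y) (h # hs) L =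
      comult_sum x (\<lambda>x1 x2. comult_sum y (\<lambda>y1 y2. diag_sum (x2 * y2) hs (\<lambda>ls. L (x1 * y1 * h # ls))))"
    by (simp add: comult_sum_mult bilin_def is_lin_def diag_linear_simps L)
  also have "\<dots> = comult_sum y (\<lambda>y1 y2. comult_sum x (\<lambda>x1 x2. diag_sum y2 hs (\<lambda>ls. diag_sum x2 ls
      (\<lambda>ls. L (x1 * (y1 * h) # ls)))))"
    by (subst comult_sum_swap) (simp add: Cons.IH[OF multilin_Cons[OF Cons.prems]] mult.assoc)
  also have "\<dots> = diag_sum y (h # hs) (\<lambda>ls. diag_sum x ls L)"
    by (simp add: diag_sum_comult_swap)
  finally show ?case .
qed

lemma diag_sum_one: "multilin L \<Longrightarrow> diag_sum 1 hs L = L hs"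
proof (induction hs arbitrary: L)
  case (Cons h hs)
  note L = multilinD[OF Cons.prems]
  have "diag_sum 1 (h # hs) L = diag_sum 1 hs (\<lambda>ls. L (1 * h # ls))"
    by (simp only: diag_sum.simps, rule comult_sum_one)
      (simp add: bilin_def is_lin_def diag_linear_simps L)
  then show ?case by (simp add: Cons.IH[OF multilin_Cons[OF Cons.prems]])
qed (simp add: counit_one)

lemma diag_sum_snoc:
  assumes L: "multilin L"
  shows "diag_sum x (hs @ [z]) L = comult_sum x (\<lambda>a b. diag_sum a hs (\<lambda>ls. L (ls @ [b * z])))"
proof -
  have "comult_sum b (\<lambda>c d. counit H d * L (ls @ [c * z])) = L (ls @ [b * z])" for b ls
    by (rule comult_sum_counit_right) (simp add: is_lin_def linear_simps multilinD[OF L])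
  then show ?thesis by (simp add: diag_sum_append[OF L])
qed

lemma lin_diag_sum: "lin (\<lambda>x. diag_sum x hs L)"
  by (simp add: is_lin_def diag_linear_simps)

text \<open>
The counit is a map of left \<open>H\<close>-modules, and \<open>\<epsilon>(x\<^sub>(\<^sub>i\<^sub>))\<close> drops out of the iterated coproduct of \<open>x\<close>.
\<close>

lemma diag_sum_remove:
  assumes "\<And>us' h' ws'. length us' = length us \<Longrightarrow> L' (us' @ h' # ws') = counit H h' * L (us' @ ws')"
  shows "diag_sum x (us @ h # ws) L' = counit H h * diag_sum x (us @ ws) L"
  using assms
proof (induction us arbitrary: x L L')
  case Nil
  have "L' (h' # ws') = counit H h' * L ws'" for h' ws'
    using Nil[of "[]"] by simp
  then have "diag_sum x ([] @ h # ws) L' =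
      comult_sum x (\<lambda>a b. counit H a * (counit H h * diag_sum b ws L))"
    by (simp add: diag_linear_simps counit_mult)
  also have "\<dots> = counit H h * diag_sum x ws L"
    by (rule comult_sum_counit_left) (simp add: is_lin_def diag_linear_simps mult.left_commute)
  finally show ?case by simp
next
  case (Cons u us)
  have "diag_sum b (us @ h # ws) (\<lambda>ls. L' (a * u # ls)) =
      counit H h * diag_sum b (us @ ws) (\<lambda>ls. L (a * u # ls))" for a b
    by (rule Cons.IH) (use Cons.prems[of "a * u # _"] in simp)
  then show ?case by (simp add: linear_simps)
qed

text \<open>
The coproduct of \<open>H\<close> is a map of left \<open>H\<close>-modules for the diagonal action.
\<close>

lemma diag_sum_comult:
  assumes "multilin L"
    and "\<And>us' h' ws'. length us' = length us \<Longrightarrow>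
      L' (us' @ h' # ws') = comult_sum h' (\<lambda>a b. L (us' @ a # b # ws'))"
  shows "diag_sum x (us @ h # ws) L' =
    comult_sum h (\<lambda>h1 h2. diag_sum x (us @ h1 # h2 # ws) L)"
  using assms
proof (induction us arbitrary: x L L')
  case Nil
  note L = multilinD[OF Nil(1)]
  have *: "comult_sum (a * h) (\<lambda>c d. L (c # d # ls)) =
      comult_sum a (\<lambda>a1 a2. comult_sum h (\<lambda>h1 h2. L (a1 * h1 # a2 * h2 # ls)))" for a ls
    by (rule comult_sum_mult) (simp add: bilin_def is_lin_def L)
  have "L' (h' # ws') = comult_sum h' (\<lambda>a b. L (a # b # ws'))" for h' ws'
    using Nil(2)[of "[]"] by simp
  then have "diag_sum x ([] @ h # ws) L' = comult_sum x (\<lambda>a b. comult_sum a (\<lambda>a1 a2.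
      diag_sum b ws (\<lambda>ls. comult_sum h (\<lambda>h1 h2. L (a1 * h1 # a2 * h2 # ls)))))"
    by (simp add: * diag_sum_comult_swap)
  also have "\<dots> = comult_sum x (\<lambda>a b. comult_sum b (\<lambda>b1 b2.
      diag_sum b2 ws (\<lambda>ls. comult_sum h (\<lambda>h1 h2. L (a * h1 # b1 * h2 # ls)))))"
    by (rule comult_sum_coassoc[symmetric]) (simp add: trilin_def is_lin_def diag_linear_simps L)
  also have "\<dots> = comult_sum h (\<lambda>h1 h2. comult_sum x (\<lambda>a b. comult_sum b (\<lambda>b1 b2.
      diag_sum b2 ws (\<lambda>ls. L (a * h1 # b1 * h2 # ls)))))"
    by (simp add: diag_sum_comult_swap comult_sum_swap[of _ h])
  finally show ?case by simp
next
  case (Cons u us)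
  have "diag_sum b (us @ h # ws) (\<lambda>ls. L' (a * u # ls)) =
      comult_sum h (\<lambda>h1 h2. diag_sum b (us @ h1 # h2 # ws) (\<lambda>ls. L (a * u # ls)))" for a b
    by (rule Cons.IH) (use Cons.prems(2)[of "a * u # _"] multilin_Cons[OF Cons.prems(1)] in simp_all)
  then show ?case by simp (rule comult_sum_swap)
qed

lemma kills_tpow_map2:
  assumes L: "multilin L" and len: "length hs = n"
  shows "kills (\<lambda>ys. L (map2 (*) ys hs)) (tpow_rels (hspace H) n)"
  unfolding kills_tpow_rels functional_on_full
proof (intro allI impI)
  fix us ws :: "'h list"
  assume "length us + length ws + 1 = n \<and> set us \<union> set ws \<subseteq> carrier (hspace H)"
  then have "length us < length hs" using len by simp
  then obtain hs1 h hs2 where "hs = hs1 @ h # hs2" "length hs1 = length us"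
    by (metis id_take_nth_drop length_take min.absorb4)
  then show "lin (\<lambda>v. L (map2 (*) (us @ v # ws) hs))"
    by (simp add: is_lin_def linear_simps multilinD[OF L])
qed

lemma sval_iter_comult:
  assumes "multilin L"
  shows "sval (\<lambda>ys. L (map2 (*) ys hs)) (iter_comult H (length hs) x) = diag_sum x hs L"
  using assms
proof (induction hs arbitrary: x L)
  case Nil
  have "kills (\<lambda>ys. L (map2 (*) ys [])) (tpow_rels (hspace H) 0)"
    by (rule kills_tpow_map2[OF Nil]) simp
  then show ?case by (simp add: sval_cls)
next
  case (Cons h hs)
  note L = multilinD[OF Cons.prems]
  have "kills (\<lambda>ys. L (map2 (*) ys (h # hs))) (tpow_rels (hspace H) (Suc (length hs)))"
    by (rule kills_tpow_map2[OF Cons.prems]) simp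
  then have "sval (\<lambda>ys. L (map2 (*) ys (h # hs))) (iter_comult H (length (h # hs)) x) =
      sval (\<lambda>(a, b). sval (\<lambda>bs. L (a * h # map2 (*) bs hs)) (iter_comult H (length hs) b)) (comult H x)"
    by (simp add: sval_cls fval_fsweedler case_prod_unfold del: zip_Cons_Cons) (simp add: case_prod_unfold)
  also have "\<dots> = sval (\<lambda>(a, b). diag_sum b hs (\<lambda>ls. L (a * h # ls))) (comult H x)"
    by (simp add: Cons.IH[OF multilin_Cons[OF Cons.prems]])
  also have "\<dots> = diag_sum x (h # hs) L"
    by (simp, rule sval_comult) (simp add: bilin_def is_lin_def diag_linear_simps L)
  finally show ?case .
qed

end

subsection \<open>Sums over the coaction\<close>

context right_module_left_comodule
begin

abbreviation mlin :: "('m \<Rightarrow> 'f) \<Rightarrow> bool" where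
  "mlin \<equiv> is_lin (mscale M)"

definition coact_lift :: "'m \<Rightarrow> ('h \<times> 'm \<Rightarrow>\<^sub>0 'f)" where
  "coact_lift = (SOME P. Vector_Spaces.linear (mscale M) fscale P \<and>
    (\<forall>m. cls (tensor_rels (hspace H) (mspace M)) (P m) = coact M m))"

definition coact_sum :: "'m \<Rightarrow> ('h \<Rightarrow> 'm \<Rightarrow> 'f) \<Rightarrow> 'f" where
  "coact_sum m B = fval (\<lambda>(a, m0). B a m0) (coact_lift m)"

lemma coact_lift:
  "Vector_Spaces.linear (mscale M) fscale coact_lift"
  "cls (tensor_rels (hspace H) (mspace M)) (coact_lift m) = coact M m"
  using someI_ex[OF linear_lift[OF m_vector_space coact_linear[unfolded tensor_def]]]
  unfolding coact_lift_def by blast+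

lemma sval_coact:
  assumes "bilin (hscale H) (mscale M) B"
  shows "sval (\<lambda>(a, m0). B a m0) (coact M m) = coact_sum m B"
  unfolding coact_sum_def coact_lift(2)[symmetric]
  by (rule sval_cls) (simp add: kills_tensor_full assms)

lemma coact_sum_add: "coact_sum (m + m') B = coact_sum m B + coact_sum m' B"
proof -
  interpret l: Vector_Spaces.linear "mscale M" fscale coact_lift by (rule coact_lift)
  show ?thesis by (simp add: coact_sum_def l.add)
qed

lemma coact_sum_scale: "coact_sum (mscale M c m) B = c * coact_sum m B"
proof -
  interpret l: Vector_Spaces.linear "mscale M" fscale coact_lift by (rule coact_lift)
  show ?thesis by (simp add: coact_sum_def l.scale)
qed

lemma coact_sum_fun_add: "coact_sum m (\<lambda>a m0. B a m0 + C a m0) = coact_sum m B + coact_sum m C"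
  by (simp add: coact_sum_def case_prod_unfold fval_fun_add)

lemma coact_sum_fun_mult: "coact_sum m (\<lambda>a m0. c * B a m0) = c * coact_sum m B"
  by (simp add: coact_sum_def case_prod_unfold fval_fun_mult)

lemma coact_sum_fun_zero [simp]: "coact_sum m (\<lambda>a m0. 0) = 0"
  using coact_sum_fun_mult[of m 0 "\<lambda>a b. 0"] by simp

lemma comult_coact_swap:
  "comult_sum x (\<lambda>a b. coact_sum m (\<lambda>c m0. G a b c m0)) =
   coact_sum m (\<lambda>c m0. comult_sum x (\<lambda>a b. G a b c m0))"
  unfolding comult_sum_def coact_sum_def case_prod_unfold by (rule fval_swap)

lemma diag_coact_swap:
  "diag_sum y hs (\<lambda>ls. coact_sum m (\<lambda>a m0. G a m0 ls)) = coact_sum m (\<lambda>a m0. diag_sum y hs (G a m0))"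
proof (induction hs arbitrary: y G)
  case (Cons h hs)
  show ?case by (simp add: Cons.IH) (rule comult_coact_swap)
qed (simp add: coact_sum_fun_mult)

lemmas coact_linear_simps =
  diag_linear_simps coact_sum_add coact_sum_scale coact_sum_fun_add coact_sum_fun_mult
  mact_add_left mact_add_right mact_scale_left mact_scale_right

lemma mlinD: "mlin f \<Longrightarrow> f (m + m') = f m + f m'" "mlin f \<Longrightarrow> f (mscale M c m) = c * f m"
  by (simp_all add: is_lin_def)

lemma coact_sum_counit:
  assumes f: "mlin f"
  shows "coact_sum m (\<lambda>a m0. counit H a * f m0) = f m"
proof -
  have "f m = sval (\<lambda>p. f (case p of (a, m0) \<Rightarrow> mscale M (counit H a) m0)) (coact M m)"
    using is_lin_sweedler[OF m_vector_space f] coact_counit[of m] by metis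
  also have "\<dots> = sval (\<lambda>(a, m0). counit H a * f m0) (coact M m)"
    by (simp add: case_prod_unfold mlinD[OF f])
  also have "\<dots> = coact_sum m (\<lambda>a m0. counit H a * f m0)"
    by (rule sval_coact) (simp add: bilin_def is_lin_def linear_simps mlinD[OF f] mult.left_commute)
  finally show ?thesis ..
qed

lemma sval_cls_coact_tensor:
  assumes "bilin (hscale H) (mscale M) B"
  shows "sval (\<lambda>(a, b). B a b) (cls (tensor_rels (hspace H) (mspace M)) p) = fval (\<lambda>(a, b). B a b) p"
  by (rule sval_cls) (simp add: kills_tensor_full assms)

lemma coact_sum_coassoc:
  assumes T: "trilin (hscale H) (hscale H) (mscale M) T"
  shows "coact_sum m (\<lambda>a m0. coact_sum m0 (\<lambda>b m00. T a b m00)) =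
    coact_sum m (\<lambda>a m0. comult_sum a (\<lambda>a1 a2. T a1 a2 m0))"
proof -
  have T_lin: "bilin (hscale H) (mscale M) (T a)" "bilin (hscale H) (hscale H) (\<lambda>a b. T a b m0)" for a m0
    using T by (simp_all add: trilin_def bilin_def)
  note T' = T[unfolded trilin_def is_lin_def]
  have T_fun: "T (x + y) = (\<lambda>b c. T x b c + T y b c)" "T (hscale H k x) = (\<lambda>b c. k * T x b c)" for x y k
    using T' by (intro ext; simp)+
  let ?\<phi> = "\<lambda>(a, t). sval (\<lambda>(b, c). T a b c) t"
  have "fval ?\<phi> (fsweedler (\<lambda>(a, m0). gen (a, coact M m0)) (coact M m)) =
      sval (\<lambda>(a, m0). coact_sum m0 (T a)) (coact M m)"
    by (simp add: fval_fsweedler case_prod_unfold sval_coact[OF T_lin(1), unfolded case_prod_unfold])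
  also have "\<dots> = coact_sum m (\<lambda>a m0. coact_sum m0 (T a))"
    by (rule sval_coact) (simp add: bilin_def is_lin_def coact_linear_simps T_fun)
  finally have L: "fval ?\<phi> (fsweedler (\<lambda>(a, m0). gen (a, coact M m0)) (coact M m)) =
      coact_sum m (\<lambda>a m0. coact_sum m0 (T a))" .
  have "fval ?\<phi> (fsweedler (\<lambda>(a, m0).
            fsweedler (\<lambda>(a1, a2). gen (a1, cls (tensor_rels (hspace H) (mspace M)) (gen (a2, m0))))
              (comult H a)) (coact M m)) =
      sval (\<lambda>(a, m0). comult_sum a (\<lambda>a1 a2. T a1 a2 m0)) (coact M m)"
    by (simp add: fval_fsweedler case_prod_unfold
      sval_cls_coact_tensor[OF T_lin(1), unfolded case_prod_unfold]
      sval_comult[OF T_lin(2), unfolded case_prod_unfold])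
  also have "\<dots> = coact_sum m (\<lambda>a m0. comult_sum a (\<lambda>a1 a2. T a1 a2 m0))"
    by (rule sval_coact) (use T' in \<open>simp add: bilin_def is_lin_def coact_linear_simps\<close>)
  finally show ?thesis
    using L fval_eqI[OF kills_nested_tensor[OF T] coact_coassoc] by metis
qed

end

context sayd_module
begin

lemma coact_sum_stable:
  assumes f: "mlin f"
  shows "coact_sum m (\<lambda>a m0. f (mact M m0 a)) = f m"
proof -
  have "f m = sval (\<lambda>p. f (case p of (a, m0) \<Rightarrow> mact M m0 a)) (coact M m)"
    using is_lin_sweedler[OF m_vector_space f] stable[of m] by metis
  also have "\<dots> = sval (\<lambda>(a, m0). f (mact M m0 a)) (coact M m)"
    by (simp add: case_prod_unfold)
  also have "\<dots> = coact_sum m (\<lambda>a m0. f (mact M m0 a))"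
    by (rule sval_coact) (simp add: bilin_def is_lin_def coact_linear_simps mlinD[OF f])
  finally show ?thesis ..
qed

lemma coact_sum_mact:
  assumes B: "bilin (hscale H) (mscale M) B"
  shows "coact_sum (mact M m x) B = coact_sum m (\<lambda>a m0. comult_sum x (\<lambda>x1 x'.
    comult_sum x' (\<lambda>x2 x3. B (antipode H x3 * a * x1) (mact M m0 x2))))"
proof -
  note B' = B[unfolded bilin_def is_lin_def]
  have 1: "bilin (hscale H) (hscale H) (\<lambda>x2 x3. B (antipode H x3 * a * x1) (mact M m0 x2))" for a x1 m0
    using B' by (simp add: bilin_def is_lin_def coact_linear_simps)
  have 2: "bilin (hscale H) (hscale H) (\<lambda>x1 x'.
    comult_sum x' (\<lambda>x2 x3. B (antipode H x3 * a * x1) (mact M m0 x2)))" for a m0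
    using B' by (simp add: bilin_def is_lin_def coact_linear_simps)
  have 3: "bilin (hscale H) (mscale M) (\<lambda>a m0. comult_sum x (\<lambda>x1 x'.
    comult_sum x' (\<lambda>x2 x3. B (antipode H x3 * a * x1) (mact M m0 x2))))"
    using B' by (simp add: bilin_def is_lin_def coact_linear_simps)
  have "coact_sum (mact M m x) B = sval (\<lambda>(a, b). B a b) (coact M (mact M m x))"
    by (simp add: sval_coact[OF B])
  also have "\<dots> = sval (\<lambda>(a, m0). comult_sum x (\<lambda>x1 x'.
      comult_sum x' (\<lambda>x2 x3. B (antipode H x3 * a * x1) (mact M m0 x2)))) (coact M m)"
    unfolding anti_yetter_drinfeld sval_cls_coact_tensor[OF B]
    by (simp add: fval_fsweedler case_prod_unfold sval_comult[OF 1, unfolded case_prod_unfold]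
      sval_comult[OF 2, unfolded case_prod_unfold])
  also have "\<dots> = coact_sum m (\<lambda>a m0. comult_sum x (\<lambda>x1 x'.
      comult_sum x' (\<lambda>x2 x3. B (antipode H x3 * a * x1) (mact M m0 x2))))"
    by (rule sval_coact[OF 3])
  finally show ?thesis .
qed

end

subsection \<open>Sums over elements of the Hopf subalgebra\<close>

context hopf_subalgebra
begin

text \<open>
For \<open>k \<in> K\<close> the coproduct has a representative in \<open>K \<otimes> K\<close>, so only the values of \<open>B\<close> on \<open>K \<times> K\<close> count.
\<close>

lemma comult_sum_subalgebra_cong:
  assumes k: "k \<in> K" and B: "bilin (hscale H) (hscale H) B" "bilin (hscale H) (hscale H) B'"
    and eq: "\<And>a b. a \<in> K \<Longrightarrow> b \<in> K \<Longrightarrow> B a b = B' a b"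
  shows "comult_sum k B = comult_sum k B'"
proof -
  obtain p where p: "p \<in> comult H k" "Poly_Mapping.keys p \<subseteq> K \<times> K"
    using comult_closed[OF k] by blast
  have "comult H k = cls (tensor_rels (hspace H) (hspace H)) p"
    using p(1) by (metis cls_eq_if_mem comult_lift(2))
  then have "comult_sum k C = fval (\<lambda>(a, b). C a b) p" if "bilin (hscale H) (hscale H) C" for C
    using sval_comult[OF that, of k] by (simp add: sval_cls_tensor[OF that])
  moreover have "fval (\<lambda>(a, b). B a b) p = fval (\<lambda>(a, b). B' a b) p"
    by (rule lin_ext_cong) (use p(2) eq in auto)
  ultimately show ?thesis using B by simp
qed

definition Kinvariant_slots :: "('h list \<Rightarrow> 'f) \<Rightarrow> bool" where
  "Kinvariant_slots L \<longleftrightarrow> (\<forall>us x ws. \<forall>k\<in>K. L (us @ (x * k) # ws) = counit H k * L (us @ x # ws))"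

lemma Kinvariant_slotsD:
  assumes "Kinvariant_slots L" "k \<in> K"
  shows "L (us @ (x * k) # ws) = counit H k * L (us @ x # ws)"
    and "L ((x * k) # ws) = counit H k * L (x # ws)"
    and "L (h # us @ (x * k) # ws) = counit H k * L (h # us @ x # ws)"
proof -
  note L = assms(1)[unfolded Kinvariant_slots_def, rule_format, OF assms(2)]
  show "L (us @ (x * k) # ws) = counit H k * L (us @ x # ws)" by (rule L)
  show "L ((x * k) # ws) = counit H k * L (x # ws)" using L[of "[]"] by simp
  show "L (h # us @ (x * k) # ws) = counit H k * L (h # us @ x # ws)" using L[of "h # us"] by simp
qed

lemma Kinvariant_slots_Cons: "Kinvariant_slots L \<Longrightarrow> Kinvariant_slots (\<lambda>ls. L (a # ls))"
  by (auto simp: Kinvariant_slots_def Kinvariant_slotsD)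

lemma Kinvariant_slots_diag_sum: "Kinvariant_slots L \<Longrightarrow> Kinvariant_slots (\<lambda>hs. diag_sum x hs L)"
  unfolding Kinvariant_slots_def[of "\<lambda>hs. diag_sum x hs L"]
proof (intro allI ballI)
  fix us y ws k assume k: "k \<in> K" and "Kinvariant_slots L"
  then show "diag_sum x (us @ (y * k) # ws) L = counit H k * diag_sum x (us @ y # ws) L"
    by (induction us arbitrary: x L)
      (simp_all add: diag_linear_simps Kinvariant_slotsD Kinvariant_slots_Cons flip: mult.assoc)
qed

end

section \<open>Invariant forms\<close>

locale hopf_pair_sayd = hopf_subalgebra H K + sayd_module H M
  for H :: "('f::field, 'h::ring_1) hopf" and K :: "'h set"
    and M :: "('f, 'h, 'm::ab_group_add) hmodule"
begin

text \<open>
These are the functionals on \<open>C = H \<otimes>\<^sub>K F\<close>, pulled back along \<open>dot\<close> (see \<open>sval_dot\<close> and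
\<open>functional_on_Kinvariant\<close>).
\<close>

definition Kinvariant :: "('h \<Rightarrow> 'f) \<Rightarrow> bool" where
  "Kinvariant f \<longleftrightarrow> lin f \<and> (\<forall>x. \<forall>k\<in>K. f (x * k) = counit H k * f x)"

lemma multilin_Kinvariant_slots_iff:
  "multilin L \<and> Kinvariant_slots L \<longleftrightarrow> (\<forall>us ws. Kinvariant (\<lambda>x. L (us @ x # ws)))"
  by (auto simp: multilin_def Kinvariant_slots_def Kinvariant_def)

lemma Kinvariant_comult_sum:
  assumes F: "\<And>a b. Kinvariant (\<lambda>x. F x a b)"
  shows "Kinvariant (\<lambda>x. comult_sum y (\<lambda>a b. F x a b))"
proof -
  have "F (x + z) = (\<lambda>a b. F x a b + F z a b)" "F (hscale H c x) = (\<lambda>a b. c * F x a b)"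
    "k \<in> K \<Longrightarrow> F (x * k) = (\<lambda>a b. counit H k * F x a b)" for x z c k
    using F by (auto simp: Kinvariant_def is_lin_def intro!: ext)
  then show ?thesis by (simp add: Kinvariant_def is_lin_def linear_simps)
qed

lemma Kinvariant_coact_sum:
  assumes F: "\<And>a b. Kinvariant (\<lambda>x. F x a b)"
  shows "Kinvariant (\<lambda>x. coact_sum m (\<lambda>a b. F x a b))"
proof -
  have "F (x + z) = (\<lambda>a b. F x a b + F z a b)" "F (hscale H c x) = (\<lambda>a b. c * F x a b)"
    "k \<in> K \<Longrightarrow> F (x * k) = (\<lambda>a b. counit H k * F x a b)" for x z c k
    using F by (auto simp: Kinvariant_def is_lin_def intro!: ext)
  then show ?thesis by (simp add: Kinvariant_def is_lin_def coact_linear_simps)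
qed

lemma Kinvariant_mult: "Kinvariant f \<Longrightarrow> Kinvariant (\<lambda>x. c * f x)"
  by (simp add: Kinvariant_def is_lin_def distrib_left mult.left_commute)

lemma Kinvariant_mult_right: "Kinvariant f \<Longrightarrow> Kinvariant (\<lambda>x. f x * c)"
  using Kinvariant_mult[of f c] by (simp add: mult.commute)

lemma Kinvariant_left: "Kinvariant f \<Longrightarrow> Kinvariant (\<lambda>x. f (a * x))"
  by (simp add: Kinvariant_def is_lin_def distrib_left scale_mult_right flip: mult.assoc)

lemma Kinvariant_zero: "Kinvariant (\<lambda>x. 0)"
  by (simp add: Kinvariant_def is_lin_def)

lemma Kinvariant_counit: "Kinvariant (counit H)"
  by (simp add: Kinvariant_def is_lin_def counit_add counit_scale counit_mult mult.commute)

text \<open>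
The coproduct descends from \<open>H\<close> to \<open>C\<close>, since \<open>\<epsilon>(k\<^sub>(\<^sub>1\<^sub>)) \<epsilon>(k\<^sub>(\<^sub>2\<^sub>)) = \<epsilon>(k)\<close> for \<open>k \<in> K\<close> with both factors in \<open>K\<close>.
\<close>

lemma Kinvariant_comult:
  assumes B: "\<And>b. Kinvariant (\<lambda>a. B a b)" "\<And>a. Kinvariant (B a)"
  shows "Kinvariant (\<lambda>x. comult_sum x B)"
proof -
  note B' = B[unfolded Kinvariant_def is_lin_def]
  have bl: "bilin (hscale H) (hscale H) B"
    using B by (simp add: bilin_def Kinvariant_def)
  have "comult_sum (x * k) B = counit H k * comult_sum x B" if k: "k \<in> K" for x k
  proof -
    have "comult_sum k (\<lambda>k1 k2. B (x1 * k1) (x2 * k2)) = counit H k * B x1 x2" for x1 x2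
    proof -
      have "comult_sum k (\<lambda>k1 k2. B (x1 * k1) (x2 * k2)) =
          comult_sum k (\<lambda>k1 k2. counit H k1 * (counit H k2 * B x1 x2))"
        by (rule comult_sum_subalgebra_cong[OF k])
          (use B' in \<open>simp_all add: bilin_def is_lin_def linear_simps mult.left_commute\<close>)
      also have "\<dots> = counit H k * B x1 x2"
        by (rule comult_sum_counit_left) (simp add: is_lin_def linear_simps)
      finally show ?thesis .
    qed
    then show ?thesis by (simp add: comult_sum_mult[OF bl] comult_sum_fun_mult)
  qed
  then show ?thesis by (simp add: Kinvariant_def is_lin_def linear_simps)
qed

text \<open>
The linear functionals on \<open>M \<otimes>\<^sub>H C\<^sup>\<otimes>\<^sup>n\<^sup>+\<^sup>1\<close>, pulled back to functions of \<open>m\<close> and of a list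
\<open>[h\<^sub>0, \<dots>, h\<^sub>n]\<close> in \<open>H\<close>. Being zero on lists of any other length makes relations between
operators plain equations of functions.
\<close>

definition forms :: "nat \<Rightarrow> ('m \<Rightarrow> 'h list \<Rightarrow> 'f) set" where
  "forms n = {\<Psi>. (\<forall>hs. mlin (\<lambda>m. \<Psi> m hs)) \<and> (\<forall>m us ws. Kinvariant (\<lambda>x. \<Psi> m (us @ x # ws))) \<and>
    (\<forall>m x hs. \<Psi> (mact M m x) hs = diag_sum x hs (\<Psi> m)) \<and>
    (\<forall>m hs. length hs \<noteq> Suc n \<longrightarrow> \<Psi> m hs = 0)}"

lemma formsI:
  assumes "\<And>hs. mlin (\<lambda>m. \<Psi> m hs)" "\<And>m us ws. Kinvariant (\<lambda>x. \<Psi> m (us @ x # ws))"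
    "\<And>m x hs. \<Psi> (mact M m x) hs = diag_sum x hs (\<Psi> m)"
    "\<And>m hs. length hs \<noteq> Suc n \<Longrightarrow> \<Psi> m hs = 0"
  shows "\<Psi> \<in> forms n"
  using assms by (simp add: forms_def)

lemma
  assumes "\<Psi> \<in> forms n"
  shows forms_add: "\<Psi> (m + m') hs = \<Psi> m hs + \<Psi> m' hs"
    and forms_scale: "\<Psi> (mscale M c m) hs = c * \<Psi> m hs"
    and forms_mact: "\<Psi> (mact M m x) hs = diag_sum x hs (\<Psi> m)"
    and forms_Kinvariant: "Kinvariant (\<lambda>x. \<Psi> m (us @ x # ws))"
    and forms_multilin: "multilin (\<Psi> m)"
    and forms_Kinvariant_slots: "Kinvariant_slots (\<Psi> m)"
    and forms_support: "length hs \<noteq> Suc n \<Longrightarrow> \<Psi> m hs = 0"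
  using assms multilin_Kinvariant_slots_iff[of "\<Psi> m"] by (auto simp: forms_def is_lin_def)

lemma forms_eqI:
  assumes "\<Phi> \<in> forms n" "\<Psi> \<in> forms n" "\<And>m hs. length hs = Suc n \<Longrightarrow> \<Phi> m hs = \<Psi> m hs"
  shows "\<Phi> = \<Psi>"
proof (intro ext)
  fix m hs show "\<Phi> m hs = \<Psi> m hs"
    using assms(3)[of hs m] forms_support[OF assms(1), of hs m] forms_support[OF assms(2), of hs m]
    by (cases "length hs = Suc n") auto
qed

text \<open>
The transposes on \<open>M \<otimes>\<^sub>H C\<^sup>\<otimes>\<^sup>n\<^sup>+\<^sup>1\<close> of the cyclic operator, of the coproduct in slot \<open>i\<close> and of the counit in
slot \<open>i\<close>. Lists that are too short get the value 0, which keeps the support condition of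
\<open>forms\<close> intact.
\<close>

definition rotate_form :: "('m \<Rightarrow> 'h list \<Rightarrow> 'f) \<Rightarrow> 'm \<Rightarrow> 'h list \<Rightarrow> 'f" where
  "rotate_form \<Psi> m hs =
    (case hs of [] \<Rightarrow> 0 | h # hs' \<Rightarrow> coact_sum m (\<lambda>a m0. \<Psi> m0 (hs' @ [a * h])))"

definition double_slot :: "nat \<Rightarrow> ('m \<Rightarrow> 'h list \<Rightarrow> 'f) \<Rightarrow> 'm \<Rightarrow> 'h list \<Rightarrow> 'f" where
  "double_slot i \<Psi> m hs =
    (if i < length hs
     then comult_sum (hs ! i) (\<lambda>a b. \<Psi> m (take i hs @ a # b # drop (Suc i) hs)) else 0)"

definition drop_slot :: "nat \<Rightarrow> ('m \<Rightarrow> 'h list \<Rightarrow> 'f) \<Rightarrow> 'm \<Rightarrow> 'h list \<Rightarrow> 'f" where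
  "drop_slot i \<Psi> m hs =
    (if i < length hs then counit H (hs ! i) * \<Psi> m (take i hs @ drop (Suc i) hs) else 0)"

lemma rotate_form_simps [simp]:
  "rotate_form \<Psi> m [] = 0"
  "rotate_form \<Psi> m (h # hs) = coact_sum m (\<lambda>a m0. \<Psi> m0 (hs @ [a * h]))"
  by (simp_all add: rotate_form_def)

lemma double_slot_append:
  "length us = i \<Longrightarrow> double_slot i \<Psi> m (us @ h # ws) = comult_sum h (\<lambda>a b. \<Psi> m (us @ a # b # ws))"
  by (auto simp: double_slot_def nth_append)

lemma double_slot_beyond: "length hs \<le> i \<Longrightarrow> double_slot i \<Psi> m hs = 0"
  by (simp add: double_slot_def)

lemma double_slot_0 [simp]:
  "double_slot 0 \<Psi> m (h # hs) = comult_sum h (\<lambda>a b. \<Psi> m (a # b # hs))"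
  by (simp add: double_slot_def)

lemma drop_slot_append:
  "length us = i \<Longrightarrow> drop_slot i \<Psi> m (us @ h # ws) = counit H h * \<Psi> m (us @ ws)"
  by (auto simp: drop_slot_def nth_append)

lemma drop_slot_beyond: "length hs \<le> i \<Longrightarrow> drop_slot i \<Psi> m hs = 0"
  by (simp add: drop_slot_def)

lemma split_list_at:
  assumes "i < length hs"
  obtains us h ws where "hs = us @ h # ws" "length us = i"
  using assms that[of "take i hs" "hs ! i" "drop (Suc i) hs"] by (simp add: id_take_nth_drop[symmetric])

lemma split_list_at_two:
  assumes "i < j" "j < length hs"
  obtains us x vs y ws where "hs = us @ x # vs @ y # ws" "length us = i" "length us + length vs + 1 = j"
proof -
  obtain as y ws where as: "hs = as @ y # ws" "length as = j"
    using assms(2) by (rule split_list_at)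
  obtain us x vs where "as = us @ x # vs" "length us = i"
    using assms(1) as(2) split_list_at[of i as] by blast
  then show thesis using that[of us x vs y ws] as by simp
qed

lemma slot_cases:
  fixes us ws :: "'a list"
  obtains (before) us1 u us2 where "us = us1 @ u # us2" "length us1 = i"
    | (at) "length us = i"
    | (after) ws1 w ws2 where "ws = ws1 @ w # ws2" "length us + length ws1 + 1 = i"
    | (beyond) "length us + length ws + 1 \<le> i"
proof -
  consider "i < length us" | "length us = i" | "length us < i" "i < length us + length ws + 1"
    | "length us + length ws + 1 \<le> i" by linarith
  then show thesis
  proof cases
    case 1
    then show ?thesis using before by (meson split_list_at)
  next
    case 3
    then have "i - length us - 1 < length ws" by simp
    then obtain ws1 w ws2 where "ws = ws1 @ w # ws2" "length ws1 = i - length us - 1"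
      by (rule split_list_at)
    then show ?thesis using after 3 by simp
  qed (use at beyond in auto)
qed

text \<open>
Invariance is where the anti-Yetter--Drinfeld condition enters. With \<open>h\<close> in slot 0, it turns
\<open>\<Psi> (m x)\<^sub>(\<^sub>0\<^sub>) [\<dots>, (m x)\<^sub>(\<^sub>-\<^sub>1\<^sub>) h]\<close> into
\<open>\<Psi> (m\<^sub>(\<^sub>0\<^sub>) x\<^sub>(\<^sub>2\<^sub>)) [\<dots>, S(x\<^sub>(\<^sub>3\<^sub>)) m\<^sub>(\<^sub>-\<^sub>1\<^sub>) x\<^sub>(\<^sub>1\<^sub>) h]\<close>. Invariance of \<open>\<Psi>\<close> distributes \<open>x\<^sub>(\<^sub>2\<^sub>)\<close>
over all slots, and its component in the last slot cancels \<open>S(x\<^sub>(\<^sub>3\<^sub>))\<close>.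
\<close>

lemma rotate_form_forms:
  assumes \<Psi>: "\<Psi> \<in> forms n"
  shows "rotate_form \<Psi> \<in> forms n"
proof (rule formsI)
  fix hs
  show "mlin (\<lambda>m. rotate_form \<Psi> m hs)"
    by (cases hs) (simp_all add: is_lin_def coact_linear_simps)
next
  fix m us ws
  show "Kinvariant (\<lambda>x. rotate_form \<Psi> m (us @ x # ws))"
  proof (cases us)
    case Nil
    then show ?thesis
      by (auto intro!: Kinvariant_coact_sum Kinvariant_left[OF forms_Kinvariant[OF \<Psi>]])
  next
    case (Cons u us')
    then show ?thesis
      using forms_Kinvariant[OF \<Psi>] by (auto intro!: Kinvariant_coact_sum)
  qed
next
  fix m x hs
  note L = multilinD[OF forms_multilin[OF \<Psi>]]
  show "rotate_form \<Psi> (mact M m x) hs = diag_sum x hs (rotate_form \<Psi> m)"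
  proof (cases hs)
    case (Cons h hs')
    \<comment> \<open>\<open>x2\<close> is spread over the slots; its last component meets \<open>S x3\<close>\<close>
    have cancel: "comult_sum x' (\<lambda>x2 x3. \<Psi> (mact M m0 x2) (hs' @ [antipode H x3 * a * x1 * h])) =
        diag_sum x' hs' (\<lambda>ls. \<Psi> m0 (ls @ [a * (x1 * h)]))" for a x1 x' m0
    proof -
      have anti: "comult_sum y (\<lambda>d x3. diag_sum c hs' (\<lambda>ls. \<Psi> m0 (ls @ [d * (antipode H x3 * a * x1 * h)]))) =
          counit H y * diag_sum c hs' (\<lambda>ls. \<Psi> m0 (ls @ [a * (x1 * h)]))" for c y
        using comult_sum_antipode_right
          [of "\<lambda>z. diag_sum c hs' (\<lambda>ls. \<Psi> m0 (ls @ [z * (a * (x1 * h))]))" y]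
        by (simp add: is_lin_def diag_linear_simps L)
      have "comult_sum x' (\<lambda>x2 x3. \<Psi> (mact M m0 x2) (hs' @ [antipode H x3 * a * x1 * h])) =
          comult_sum x' (\<lambda>x2 x3. comult_sum x2 (\<lambda>c d. diag_sum c hs'
            (\<lambda>ls. \<Psi> m0 (ls @ [d * (antipode H x3 * a * x1 * h)]))))"
        by (simp add: forms_mact[OF \<Psi>] diag_sum_snoc[OF forms_multilin[OF \<Psi>]])
      also have "\<dots> = comult_sum x' (\<lambda>c y. comult_sum y (\<lambda>d x3. diag_sum c hs'
            (\<lambda>ls. \<Psi> m0 (ls @ [d * (antipode H x3 * a * x1 * h)]))))"
        by (rule comult_sum_coassoc[symmetric]) (simp add: trilin_def is_lin_def diag_linear_simps L)
      also have "\<dots> = diag_sum x' hs' (\<lambda>ls. \<Psi> m0 (ls @ [a * (x1 * h)]))"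
        unfolding anti by (rule comult_sum_counit_right) (rule lin_diag_sum)
      finally show ?thesis .
    qed
    have "rotate_form \<Psi> (mact M m x) hs = coact_sum m (\<lambda>a m0. comult_sum x (\<lambda>x1 x'.
        comult_sum x' (\<lambda>x2 x3. \<Psi> (mact M m0 x2) (hs' @ [antipode H x3 * a * x1 * h]))))"
      unfolding Cons rotate_form_simps
      by (rule coact_sum_mact)
        (simp add: bilin_def is_lin_def linear_simps L forms_add[OF \<Psi>] forms_scale[OF \<Psi>])
    also have "\<dots> = diag_sum x hs (rotate_form \<Psi> m)"
      by (simp add: Cons cancel diag_coact_swap comult_coact_swap)
    finally show ?thesis .
  qed simp
next
  fix m and hs :: "'h list" assume "length hs \<noteq> Suc n"
  then show "rotate_form \<Psi> m hs = 0"
    by (cases hs) (simp_all add: forms_support[OF \<Psi>])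
qed

lemma double_slot_forms:
  assumes \<Psi>: "\<Psi> \<in> forms (Suc n)"
  shows "double_slot i \<Psi> \<in> forms n"
proof (rule formsI)
  fix hs
  show "mlin (\<lambda>m. double_slot i \<Psi> m hs)"
    by (simp add: is_lin_def double_slot_def linear_simps forms_add[OF \<Psi>] forms_scale[OF \<Psi>])
next
  fix m us ws
  note inv = forms_Kinvariant[OF \<Psi>, of m]
  show "Kinvariant (\<lambda>x. double_slot i \<Psi> m (us @ x # ws))"
  proof (cases rule: slot_cases[where us = us and i = i and ws = ws])
    case (before us1 u us2)
    then have "double_slot i \<Psi> m (us @ x # ws) =
        comult_sum u (\<lambda>a b. \<Psi> m ((us1 @ a # b # us2) @ x # ws))" for x
      using double_slot_append[of us1 i \<Psi> m u "us2 @ x # ws"] by simp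
    moreover have "Kinvariant (\<lambda>x. \<Psi> m ((us1 @ a # b # us2) @ x # ws))" for a b by (rule inv)
    ultimately show ?thesis by (simp only: Kinvariant_comult_sum)
  next
    case at
    have "Kinvariant (\<lambda>b. \<Psi> m (us @ a # b # ws))" for a using inv[of "us @ [a]"] by simp
    then show ?thesis using inv by (auto simp: double_slot_append[OF at] intro!: Kinvariant_comult)
  next
    case (after ws1 w ws2)
    then have "double_slot i \<Psi> m (us @ x # ws) =
        comult_sum w (\<lambda>a b. \<Psi> m (us @ x # (ws1 @ a # b # ws2)))" for x
      using double_slot_append[of "us @ x # ws1" i \<Psi> m w ws2] by simp
    then show ?thesis using inv by (auto intro!: Kinvariant_comult_sum)
  next
    case beyond
    then show ?thesis by (simp add: double_slot_beyond Kinvariant_zero)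
  qed
next
  fix m x hs
  show "double_slot i \<Psi> (mact M m x) hs = diag_sum x hs (double_slot i \<Psi> m)"
  proof (cases "i < length hs")
    case True
    then obtain us h ws where hs: "hs = us @ h # ws" "length us = i" by (rule split_list_at)
    have "diag_sum x hs (double_slot i \<Psi> m) =
        comult_sum h (\<lambda>h1 h2. diag_sum x (us @ h1 # h2 # ws) (\<Psi> m))"
      unfolding hs(1) by (rule diag_sum_comult[OF forms_multilin[OF \<Psi>]])
        (simp add: double_slot_append hs)
    then show ?thesis by (simp add: hs double_slot_append forms_mact[OF \<Psi>])
  next
    case False
    then have "diag_sum x hs (double_slot i \<Psi> m) = diag_sum x hs (\<lambda>ls. 0)"
      by (intro diag_sum_cong) (simp add: double_slot_beyond)
    then show ?thesis using False by (simp add: double_slot_beyond)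
  qed
next
  fix m and hs :: "'h list" assume "length hs \<noteq> Suc n"
  then show "double_slot i \<Psi> m hs = 0"
    by (simp add: double_slot_def forms_support[OF \<Psi>])
qed

lemma drop_slot_forms:
  assumes \<Psi>: "\<Psi> \<in> forms n"
  shows "drop_slot i \<Psi> \<in> forms (Suc n)"
proof (rule formsI)
  fix hs
  show "mlin (\<lambda>m. drop_slot i \<Psi> m hs)"
    by (simp add: is_lin_def drop_slot_def distrib_left mult.left_commute
      forms_add[OF \<Psi>] forms_scale[OF \<Psi>])
next
  fix m us ws
  note inv = forms_Kinvariant[OF \<Psi>, of m]
  show "Kinvariant (\<lambda>x. drop_slot i \<Psi> m (us @ x # ws))"
  proof (cases rule: slot_cases[where us = us and i = i and ws = ws])
    case (before us1 u us2)
    then have "drop_slot i \<Psi> m (us @ x # ws) = counit H u * \<Psi> m ((us1 @ us2) @ x # ws)" for x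
      using drop_slot_append[of us1 i \<Psi> m u "us2 @ x # ws"] by simp
    moreover have "Kinvariant (\<lambda>x. \<Psi> m ((us1 @ us2) @ x # ws))" by (rule inv)
    ultimately show ?thesis by (simp only: Kinvariant_mult)
  next
    case at
    then show ?thesis by (auto simp: drop_slot_append intro!: Kinvariant_mult_right Kinvariant_counit)
  next
    case (after ws1 w ws2)
    then have "drop_slot i \<Psi> m (us @ x # ws) = counit H w * \<Psi> m (us @ x # (ws1 @ ws2))" for x
      using drop_slot_append[of "us @ x # ws1" i \<Psi> m w ws2] by simp
    then show ?thesis using inv by (auto intro!: Kinvariant_mult)
  next
    case beyond
    then show ?thesis by (simp add: drop_slot_beyond Kinvariant_zero)
  qed
next
  fix m x hs
  show "drop_slot i \<Psi> (mact M m x) hs = diag_sum x hs (drop_slot i \<Psi> m)"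
  proof (cases "i < length hs")
    case True
    then obtain us h ws where hs: "hs = us @ h # ws" "length us = i" by (rule split_list_at)
    have "diag_sum x hs (drop_slot i \<Psi> m) = counit H h * diag_sum x (us @ ws) (\<Psi> m)"
      unfolding hs(1) by (rule diag_sum_remove) (simp add: drop_slot_append hs)
    then show ?thesis by (simp add: hs drop_slot_append forms_mact[OF \<Psi>])
  next
    case False
    then have "diag_sum x hs (drop_slot i \<Psi> m) = diag_sum x hs (\<lambda>ls. 0)"
      by (intro diag_sum_cong) (simp add: drop_slot_beyond)
    then show ?thesis using False by (simp add: drop_slot_beyond)
  qed
next
  fix m and hs :: "'h list" assume "length hs \<noteq> Suc (Suc n)"
  then show "drop_slot i \<Psi> m hs = 0"
    by (simp add: drop_slot_def forms_support[OF \<Psi>])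
qed


subsection \<open>Relations between the transposed operators\<close>

lemma double_slot_double_slot:
  assumes \<Psi>: "\<Psi> \<in> forms n" and "i \<le> j"
  shows "double_slot i (double_slot (Suc j) \<Psi>) = double_slot j (double_slot i \<Psi>)"
proof (intro ext)
  fix m and hs :: "'h list"
  note L = multilinD[OF forms_multilin[OF \<Psi>]]
  consider "length hs \<le> j" | "j < length hs" "i = j" | "j < length hs" "i < j"
    using assms(2) by linarith
  then show "double_slot i (double_slot (Suc j) \<Psi>) m hs = double_slot j (double_slot i \<Psi>) m hs"
  proof cases
    case 1
    then have "double_slot i (double_slot (Suc j) \<Psi>) m hs = 0"
      by (simp add: double_slot_def[of i] double_slot_beyond)
    then show ?thesis using 1 by (simp add: double_slot_beyond)
  next
    case 2
    then obtain us h ws where hs: "hs = us @ h # ws" "length us = j"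
      using split_list_at by blast
    have "double_slot (Suc j) \<Psi> m (us @ a # b # ws) =
        comult_sum b (\<lambda>b1 b2. \<Psi> m (us @ a # b1 # b2 # ws))" for a b
      using double_slot_append[of "us @ [a]" "Suc j" \<Psi> m b ws] hs by simp
    moreover have "comult_sum h (\<lambda>a b. comult_sum b (\<lambda>b1 b2. \<Psi> m (us @ a # b1 # b2 # ws))) =
        comult_sum h (\<lambda>a b. comult_sum a (\<lambda>a1 a2. \<Psi> m (us @ a1 # a2 # b # ws)))"
      by (rule comult_sum_coassoc)
        (use L(1)[of m "us @ [_, _]"] L(2)[of m "us @ [_, _]"] in \<open>simp add: trilin_def is_lin_def L\<close>)
    ultimately show ?thesis using 2 hs by (simp add: double_slot_append)
  next
    case 3
    then obtain us x vs y ws where hs: "hs = us @ x # vs @ y # ws" "length us = i"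
      "length us + length vs + 1 = j"
      using split_list_at_two by blast
    have "double_slot (Suc j) \<Psi> m (us @ a # b # vs @ y # ws) =
        comult_sum y (\<lambda>c d. \<Psi> m (us @ a # b # vs @ c # d # ws))" for a b
      using double_slot_append[of "us @ a # b # vs" "Suc j" \<Psi> m y ws] hs by simp
    moreover have "double_slot j (double_slot i \<Psi>) m hs =
        comult_sum y (\<lambda>c d. double_slot i \<Psi> m (us @ x # vs @ c # d # ws))"
      using double_slot_append[of "us @ x # vs" j "double_slot i \<Psi>" m y ws] hs by simp
    ultimately show ?thesis using hs by (simp add: double_slot_append) (rule comult_sum_swap)
  qed
qed

lemma drop_slot_drop_slot:
  assumes "i \<le> j"
  shows "drop_slot i (drop_slot j \<Psi>) = drop_slot (Suc j) (drop_slot i \<Psi>)"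
proof (intro ext)
  fix m and hs :: "'h list"
  show "drop_slot i (drop_slot j \<Psi>) m hs = drop_slot (Suc j) (drop_slot i \<Psi>) m hs"
  proof (cases "Suc j < length hs")
    case False
    then have "drop_slot i (drop_slot j \<Psi>) m hs = 0"
      by (simp add: drop_slot_def[of i] drop_slot_beyond)
    then show ?thesis using False by (simp add: drop_slot_beyond)
  next
    case True
    have "i < Suc j" using assms by simp
    then obtain us x vs y ws where hs: "hs = us @ x # vs @ y # ws" "length us = i"
      "length us + length vs + 1 = Suc j"
      using True by (rule split_list_at_two)
    then show ?thesis
      using drop_slot_append[of "us @ vs" j \<Psi> m y ws]
        drop_slot_append[of "us @ x # vs" "Suc j" "drop_slot i \<Psi>" m y ws]
      by (simp add: drop_slot_append)
  qed
qed

lemma double_slot_drop_slot_lt: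
  assumes "i < j"
  shows "double_slot i (drop_slot (Suc j) \<Psi>) = drop_slot j (double_slot i \<Psi>)"
proof (intro ext)
  fix m and hs :: "'h list"
  show "double_slot i (drop_slot (Suc j) \<Psi>) m hs = drop_slot j (double_slot i \<Psi>) m hs"
  proof (cases "j < length hs")
    case False
    then have "double_slot i (drop_slot (Suc j) \<Psi>) m hs = 0"
      by (simp add: double_slot_def[of i] drop_slot_beyond)
    then show ?thesis using False by (simp add: drop_slot_beyond)
  next
    case True
    with assms obtain us x vs y ws where hs: "hs = us @ x # vs @ y # ws" "length us = i"
      "length us + length vs + 1 = j"
      by (rule split_list_at_two)
    have "drop_slot (Suc j) \<Psi> m (us @ a # b # vs @ y # ws) =
        counit H y * \<Psi> m (us @ a # b # vs @ ws)" for a b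
      using drop_slot_append[of "us @ a # b # vs" "Suc j" \<Psi> m y ws] hs by simp
    moreover have "drop_slot j (double_slot i \<Psi>) m hs =
        counit H y * double_slot i \<Psi> m (us @ x # vs @ ws)"
      using drop_slot_append[of "us @ x # vs" j "double_slot i \<Psi>" m y ws] hs by simp
    ultimately show ?thesis using hs by (simp add: double_slot_append comult_sum_fun_mult)
  qed
qed

lemma double_slot_drop_slot_gt:
  assumes "j < i"
  shows "double_slot i (drop_slot j \<Psi>) = drop_slot j (double_slot (i - 1) \<Psi>)"
proof (intro ext)
  fix m and hs :: "'h list"
  show "double_slot i (drop_slot j \<Psi>) m hs = drop_slot j (double_slot (i - 1) \<Psi>) m hs"
  proof (cases "i < length hs")
    case False
    then have "drop_slot j (double_slot (i - 1) \<Psi>) m hs = 0"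
      by (simp add: drop_slot_def[of j] double_slot_beyond)
    then show ?thesis using False by (simp add: double_slot_beyond)
  next
    case True
    with assms obtain us x vs y ws where hs: "hs = us @ x # vs @ y # ws" "length us = j"
      "length us + length vs + 1 = i"
      by (rule split_list_at_two)
    have "double_slot i (drop_slot j \<Psi>) m hs =
        comult_sum y (\<lambda>a b. drop_slot j \<Psi> m (us @ x # vs @ a # b # ws))"
      using double_slot_append[of "us @ x # vs" i "drop_slot j \<Psi>" m y ws] hs by simp
    moreover have "double_slot (i - 1) \<Psi> m (us @ vs @ y # ws) =
        comult_sum y (\<lambda>a b. \<Psi> m (us @ vs @ a # b # ws))"
      using double_slot_append[of "us @ vs" "i - 1" \<Psi> m y ws] hs by simp
    ultimately show ?thesis using hs by (simp add: drop_slot_append comult_sum_fun_mult)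
  qed
qed

lemma double_slot_drop_slot_left:
  assumes \<Psi>: "\<Psi> \<in> forms n" and i: "i \<le> n"
  shows "double_slot i (drop_slot i \<Psi>) = \<Psi>"
proof (rule forms_eqI[OF double_slot_forms[OF drop_slot_forms[OF \<Psi>]] \<Psi>])
  fix m and hs :: "'h list" assume "length hs = Suc n"
  then obtain us h ws where hs: "hs = us @ h # ws" "length us = i"
    using i split_list_at[of i hs] by auto
  have "comult_sum h (\<lambda>a b. counit H a * \<Psi> m (us @ b # ws)) = \<Psi> m (us @ h # ws)"
    by (rule comult_sum_counit_left)
      (simp add: is_lin_def multilinD[OF forms_multilin[OF \<Psi>]])
  then show "double_slot i (drop_slot i \<Psi>) m hs = \<Psi> m hs"
    using hs by (simp add: double_slot_append drop_slot_append)
qed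

lemma double_slot_drop_slot_right:
  assumes \<Psi>: "\<Psi> \<in> forms n" and i: "i \<le> n"
  shows "double_slot i (drop_slot (Suc i) \<Psi>) = \<Psi>"
proof (rule forms_eqI[OF double_slot_forms[OF drop_slot_forms[OF \<Psi>]] \<Psi>])
  fix m and hs :: "'h list" assume "length hs = Suc n"
  then obtain us h ws where hs: "hs = us @ h # ws" "length us = i"
    using i split_list_at[of i hs] by auto
  have "drop_slot (Suc i) \<Psi> m (us @ a # b # ws) = counit H b * \<Psi> m (us @ a # ws)" for a b
    using drop_slot_append[of "us @ [a]" "Suc i" \<Psi> m b ws] hs by simp
  moreover have "comult_sum h (\<lambda>a b. counit H b * \<Psi> m (us @ a # ws)) = \<Psi> m (us @ h # ws)"
    by (rule comult_sum_counit_right)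
      (simp add: is_lin_def multilinD[OF forms_multilin[OF \<Psi>]])
  ultimately show "double_slot i (drop_slot (Suc i) \<Psi>) m hs = \<Psi> m hs"
    using hs by (simp add: double_slot_append)
qed

lemma double_slot_rotate_drop_last:
  assumes \<Psi>: "\<Psi> \<in> forms n"
  shows "double_slot 0 (rotate_form (drop_slot (Suc n) \<Psi>)) = \<Psi>"
proof (rule forms_eqI[OF double_slot_forms[OF rotate_form_forms[OF drop_slot_forms[OF \<Psi>]]] \<Psi>])
  fix m and hs :: "'h list" assume len: "length hs = Suc n"
  then obtain h ws where hs: "hs = h # ws" "length ws = n" by (cases hs) auto
  note lin = forms_add[OF \<Psi>] forms_scale[OF \<Psi>] multilinD[OF forms_multilin[OF \<Psi>]]
  have "drop_slot (Suc n) \<Psi> m0 (b # ws @ [c * a]) = counit H c * (counit H a * \<Psi> m0 (b # ws))"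
    for m0 a b c
    using drop_slot_append[of "b # ws" "Suc n" \<Psi> m0 "c * a" "[]"] hs by (simp add: counit_mult)
  moreover have "coact_sum m (\<lambda>c m0. counit H c * (counit H a * \<Psi> m0 (b # ws))) =
      counit H a * \<Psi> m (b # ws)" for a b
    by (rule coact_sum_counit) (simp add: is_lin_def lin distrib_left mult.left_commute)
  moreover have "comult_sum h (\<lambda>a b. counit H a * \<Psi> m (b # ws)) = \<Psi> m (h # ws)"
    by (rule comult_sum_counit_left) (simp add: is_lin_def lin)
  ultimately show "double_slot 0 (rotate_form (drop_slot (Suc n) \<Psi>)) m hs = \<Psi> m hs"
    using hs by simp
qed

lemma double_slot_rotate:
  assumes \<Psi>: "\<Psi> \<in> forms (Suc n)" and i: "i < n"
  shows "double_slot (Suc i) (rotate_form \<Psi>) = rotate_form (double_slot i \<Psi>)"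
proof (rule forms_eqI[OF double_slot_forms[OF rotate_form_forms[OF \<Psi>]]
      rotate_form_forms[OF double_slot_forms[OF \<Psi>]]])
  fix m and hs :: "'h list" assume len: "length hs = Suc n"
  then obtain h hs' where "hs = h # hs'" by (cases hs) auto
  moreover from this len i obtain us x ws where "hs' = us @ x # ws" "length us = i"
    using split_list_at[of i hs'] by auto
  ultimately have hs: "hs = h # us @ x # ws" and us: "length us = i" by auto
  have "double_slot (Suc i) (rotate_form \<Psi>) m hs =
      comult_sum x (\<lambda>a b. coact_sum m (\<lambda>c m0. \<Psi> m0 (us @ a # b # ws @ [c * h])))"
    using double_slot_append[of "h # us" "Suc i" "rotate_form \<Psi>" m x ws] hs us by simp
  also have "\<dots> = rotate_form (double_slot i \<Psi>) m hs"
    using us by (simp add: hs double_slot_append comult_coact_swap)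
  finally show "double_slot (Suc i) (rotate_form \<Psi>) m hs = rotate_form (double_slot i \<Psi>) m hs" .
qed

text \<open>
The case of the rule \<open>\<tau> \<delta>\<^sub>n = \<delta>\<^sub>n\<^sub>-\<^sub>1 \<tau>\<close> for the last coface \<open>\<delta>\<^sub>n = \<tau> \<delta>\<^sub>0\<close>. Doubling the last slot
\<open>m\<^sub>(\<^sub>-\<^sub>1\<^sub>) h\<close> splits \<open>m\<^sub>(\<^sub>-\<^sub>1\<^sub>)\<close>, and by coassociativity of the coaction this amounts to coacting twice.
\<close>

lemma double_slot_rotate_rotate:
  assumes \<Psi>: "\<Psi> \<in> forms (Suc n)"
  shows "double_slot 0 (rotate_form (rotate_form \<Psi>)) = rotate_form (double_slot n \<Psi>)"
proof (rule forms_eqI[OF double_slot_forms[OF rotate_form_forms[OF rotate_form_forms[OF \<Psi>]]]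
      rotate_form_forms[OF double_slot_forms[OF \<Psi>]]])
  fix m and hs :: "'h list" assume len: "length hs = Suc n"
  then obtain h ws where hs: "hs = h # ws" "length ws = n" by (cases hs) auto
  note lin = forms_add[OF \<Psi>] forms_scale[OF \<Psi>] multilinD[OF forms_multilin[OF \<Psi>]]
  have "comult_sum (c * h) (\<lambda>a b. \<Psi> m0 (ws @ [a, b])) =
      comult_sum c (\<lambda>c1 c2. comult_sum h (\<lambda>h1 h2. \<Psi> m0 (ws @ [c1 * h1, c2 * h2])))" for c m0
    by (rule comult_sum_mult) (simp add: bilin_def is_lin_def lin)
  then have "rotate_form (double_slot n \<Psi>) m hs =
      coact_sum m (\<lambda>c m0. comult_sum c (\<lambda>c1 c2. comult_sum h (\<lambda>h1 h2.
        \<Psi> m0 (ws @ [c1 * h1, c2 * h2]))))"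
    using hs by (simp add: double_slot_append)
  also have "\<dots> = coact_sum m (\<lambda>a m0. coact_sum m0 (\<lambda>b m00. comult_sum h (\<lambda>h1 h2.
        \<Psi> m00 (ws @ [a * h1, b * h2]))))"
    by (rule coact_sum_coassoc[symmetric]) (simp add: trilin_def is_lin_def linear_simps lin)
  also have "\<dots> = double_slot 0 (rotate_form (rotate_form \<Psi>)) m hs"
    by (simp add: hs comult_coact_swap)
  finally show "double_slot 0 (rotate_form (rotate_form \<Psi>)) m hs =
      rotate_form (double_slot n \<Psi>) m hs" by simp
qed

lemma drop_slot_rotate:
  assumes \<Psi>: "\<Psi> \<in> forms n" and i: "i \<le> n"
  shows "drop_slot (Suc i) (rotate_form \<Psi>) = rotate_form (drop_slot i \<Psi>)"
proof (rule forms_eqI[OF drop_slot_forms[OF rotate_form_forms[OF \<Psi>]]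
      rotate_form_forms[OF drop_slot_forms[OF \<Psi>]]])
  fix m and hs :: "'h list" assume len: "length hs = Suc (Suc n)"
  then obtain h hs' where "hs = h # hs'" by (cases hs) auto
  moreover from this len i obtain us x ws where "hs' = us @ x # ws" "length us = i"
    using split_list_at[of i hs'] by auto
  ultimately have hs: "hs = h # us @ x # ws" and us: "length us = i" by auto
  have "drop_slot (Suc i) (rotate_form \<Psi>) m hs =
      counit H x * coact_sum m (\<lambda>c m0. \<Psi> m0 (us @ ws @ [c * h]))"
    using drop_slot_append[of "h # us" "Suc i" "rotate_form \<Psi>" m x ws] hs us by simp
  also have "\<dots> = rotate_form (drop_slot i \<Psi>) m hs"
    using us by (simp add: hs drop_slot_append coact_sum_fun_mult)
  finally show "drop_slot (Suc i) (rotate_form \<Psi>) m hs = rotate_form (drop_slot i \<Psi>) m hs" .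
qed

lemma drop_slot_rotate_rotate:
  assumes \<Psi>: "\<Psi> \<in> forms n"
  shows "rotate_form (rotate_form (drop_slot (Suc n) \<Psi>)) = drop_slot 1 (rotate_form \<Psi>)"
proof (rule forms_eqI[OF rotate_form_forms[OF rotate_form_forms[OF drop_slot_forms[OF \<Psi>]]]
      drop_slot_forms[OF rotate_form_forms[OF \<Psi>]]])
  fix m and hs :: "'h list" assume len: "length hs = Suc (Suc n)"
  then obtain h0 h1 ws where hs: "hs = h0 # h1 # ws" "length ws = n"
    by (cases hs; cases "tl hs") auto
  note lin = forms_add[OF \<Psi>] forms_scale[OF \<Psi>]
  have "drop_slot (Suc n) \<Psi> m0 (ws @ [u, v * h1]) = counit H v * (counit H h1 * \<Psi> m0 (ws @ [u]))"
    for m0 u v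
    using drop_slot_append[of "ws @ [u]" "Suc n" \<Psi> m0 "v * h1" "[]"] hs by (simp add: counit_mult)
  moreover have "coact_sum m0 (\<lambda>v m00. counit H v * (counit H h1 * \<Psi> m00 (ws @ [u]))) =
      counit H h1 * \<Psi> m0 (ws @ [u])" for m0 u
    by (rule coact_sum_counit) (simp add: is_lin_def lin distrib_left mult.left_commute)
  ultimately show "rotate_form (rotate_form (drop_slot (Suc n) \<Psi>)) m hs =
      drop_slot 1 (rotate_form \<Psi>) m hs"
    using drop_slot_append[of "[h0]" 1 "rotate_form \<Psi>" m h1 ws] hs
    by (simp add: coact_sum_fun_mult)
qed

text \<open>
After as many rotations as there are entries in \<open>us\<close>, the list \<open>us\<close> has moved behind \<open>ws\<close>, and by
coassociativity of the coaction the successive factors are the components of a single \<open>m\<^sub>(\<^sub>-\<^sub>1\<^sub>)\<close>.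
\<close>

lemma rotate_form_power:
  assumes \<Psi>: "\<Psi> \<in> forms n"
  shows "(rotate_form ^^ length us) \<Psi> m (us @ ws) =
    coact_sum m (\<lambda>a m0. diag_sum a us (\<lambda>ls. \<Psi> m0 (ws @ ls)))"
proof (induction us arbitrary: m ws)
  case Nil
  show ?case by (simp add: coact_sum_counit is_lin_def forms_add[OF \<Psi>] forms_scale[OF \<Psi>])
next
  case (Cons u us)
  note lin = forms_add[OF \<Psi>] forms_scale[OF \<Psi>] multilinD[OF forms_multilin[OF \<Psi>]]
  have "(rotate_form ^^ length (u # us)) \<Psi> m ((u # us) @ ws) =
      coact_sum m (\<lambda>a m0. coact_sum m0 (\<lambda>b m00. diag_sum b us (\<lambda>ls. \<Psi> m00 (ws @ a * u # ls))))"
    by (simp add: Cons.IH)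
  also have "\<dots> = coact_sum m (\<lambda>a m0. comult_sum a (\<lambda>a1 a2. diag_sum a2 us (\<lambda>ls. \<Psi> m0 (ws @ a1 * u # ls))))"
    by (rule coact_sum_coassoc) (simp add: trilin_def is_lin_def diag_linear_simps lin)
  finally show ?case by simp
qed

lemma rotate_form_cyclic:
  assumes \<Psi>: "\<Psi> \<in> forms n"
  shows "(rotate_form ^^ Suc n) \<Psi> = \<Psi>"
proof (rule forms_eqI[OF _ \<Psi>])
  have "(rotate_form ^^ k) \<Psi> \<in> forms n" for k
    by (induction k) (simp_all add: \<Psi> rotate_form_forms)
  then show "(rotate_form ^^ Suc n) \<Psi> \<in> forms n" .
next
  fix m and hs :: "'h list" assume "length hs = Suc n"
  then have "(rotate_form ^^ Suc n) \<Psi> m hs = coact_sum m (\<lambda>a m0. diag_sum a hs (\<Psi> m0))"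
    using rotate_form_power[OF \<Psi>, of hs m "[]"] by simp
  also have "\<dots> = coact_sum m (\<lambda>a m0. \<Psi> (mact M m0 a) hs)"
    by (simp add: forms_mact[OF \<Psi>])
  also have "\<dots> = \<Psi> m hs"
    by (rule coact_sum_stable) (simp add: is_lin_def forms_add[OF \<Psi>] forms_scale[OF \<Psi>])
  finally show "(rotate_form ^^ Suc n) \<Psi> m hs = \<Psi> m hs" .
qed

text \<open>
The transpose of \<open>\<delta>\<^sub>i\<close> with values in degree \<open>n\<close>. The last coface is \<open>\<tau>\<^sub>n \<delta>\<^sub>0\<close>, and transposition reverses
the order.
\<close>

definition coface_form :: "nat \<Rightarrow> nat \<Rightarrow> ('m \<Rightarrow> 'h list \<Rightarrow> 'f) \<Rightarrow> 'm \<Rightarrow> 'h list \<Rightarrow> 'f" where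
  "coface_form n i \<Psi> = double_slot (if i < n then i else 0) (if i < n then \<Psi> else rotate_form \<Psi>)"

lemma coface_form_forms: "\<Psi> \<in> forms (Suc n) \<Longrightarrow> coface_form (Suc n) i \<Psi> \<in> forms n"
  by (simp add: coface_form_def double_slot_forms rotate_form_forms)

text \<open>
The relations that involve the last coface follow from those between the inner cofaces by commuting
them with the rotation.
\<close>

lemma coface_form_coface_form:
  assumes \<Psi>: "\<Psi> \<in> forms (Suc (Suc n))" and ij: "i \<le> j" "j \<le> Suc n"
  shows "coface_form (Suc n) i (coface_form (Suc (Suc n)) (Suc j) \<Psi>) =
    coface_form (Suc n) j (coface_form (Suc (Suc n)) i \<Psi>)"
proof -
  note T\<Psi> = rotate_form_forms[OF \<Psi>]
  consider "j < Suc n" | "j = Suc n" "i < Suc n" | "j = Suc n" "i = Suc n"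
    using ij by linarith
  then show ?thesis
  proof cases
    case 1
    then show ?thesis
      using ij by (simp add: coface_form_def double_slot_double_slot[OF \<Psi>])
  next
    case 2
    have "double_slot i (double_slot 0 (rotate_form \<Psi>)) =
        double_slot 0 (double_slot (Suc i) (rotate_form \<Psi>))"
      by (rule double_slot_double_slot[OF T\<Psi>, symmetric]) simp
    also have "\<dots> = double_slot 0 (rotate_form (double_slot i \<Psi>))"
      using 2 by (simp add: double_slot_rotate[OF \<Psi>])
    finally show ?thesis using 2 by (simp add: coface_form_def)
  next
    case 3
    have "double_slot 0 (rotate_form (double_slot 0 (rotate_form \<Psi>))) =
        double_slot 0 (double_slot 1 (rotate_form (rotate_form \<Psi>)))"
      using double_slot_rotate[OF T\<Psi>, of 0] by simp
    also have "\<dots> = double_slot 0 (double_slot 0 (rotate_form (rotate_form \<Psi>)))"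
      using double_slot_double_slot[OF rotate_form_forms[OF T\<Psi>], of 0 0] by simp
    also have "\<dots> = double_slot 0 (rotate_form (double_slot (Suc n) \<Psi>))"
      by (simp add: double_slot_rotate_rotate[OF \<Psi>])
    finally show ?thesis using 3 by (simp add: coface_form_def)
  qed
qed

lemma coface_form_drop_slot_gt:
  assumes \<Psi>: "\<Psi> \<in> forms n" and ij: "Suc j < i" "i \<le> Suc n"
  shows "coface_form (Suc n) i (drop_slot (Suc j) \<Psi>) =
    drop_slot (Suc j) (coface_form n (i - 1) \<Psi>)"
proof (cases "i = Suc n")
  case False
  then have "i < Suc n" "i - 1 < n" using ij by auto
  then show ?thesis
    using ij by (simp add: coface_form_def double_slot_drop_slot_gt)
next
  case True
  then have "double_slot 0 (rotate_form (drop_slot (Suc j) \<Psi>)) =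
      double_slot 0 (drop_slot (Suc (Suc j)) (rotate_form \<Psi>))"
    using ij by (simp add: drop_slot_rotate[OF \<Psi>])
  also have "\<dots> = drop_slot (Suc j) (double_slot 0 (rotate_form \<Psi>))"
    by (rule double_slot_drop_slot_lt) simp
  finally show ?thesis using True by (simp add: coface_form_def)
qed

lemma coface_form_rotate:
  assumes \<Psi>: "\<Psi> \<in> forms (Suc n)" and i: "i \<le> n"
  shows "coface_form (Suc n) (Suc i) (rotate_form \<Psi>) = rotate_form (coface_form (Suc n) i \<Psi>)"
  using i double_slot_rotate[OF \<Psi>, of i] double_slot_rotate_rotate[OF \<Psi>]
  by (auto simp: coface_form_def not_less)

end

section \<open>Functionals on the coalgebra and its tensor powers\<close>

context hopf_pair_sayd
begin

abbreviation C :: "('f, ('f, 'h) celem) vspace" where "C \<equiv> C_space H K"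
abbreviation d :: "'h \<Rightarrow> ('f, 'h) celem" where "d \<equiv> dot H K"

lemma C_eq: "C = presented UNIV (C_rels H K)"
  by (simp add: C_space_def bal_tensor_def C_rels_def)

lemma kills_C_rels:
  "kills \<phi> (C_rels H K) \<longleftrightarrow> (\<forall>a. lin (\<lambda>x. \<phi> (x, a))) \<and> (\<forall>x. is_lin (*) (\<lambda>a. \<phi> (x, a))) \<and>
    (\<forall>x. \<forall>k\<in>K. \<forall>a. \<phi> (x * k, a) = \<phi> (x, counit H k * a))"
  by (simp add: C_rels_def kills_bal_tensor_rels kills_tensor_rels functional_on_full)

text \<open>
Since \<open>x \<otimes>\<^sub>K a = a (x \<otimes>\<^sub>K 1)\<close>, a functional on \<open>C\<close> is determined by its values on the elements \<open>dot x\<close>.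
\<close>

lemma kills_C_rels_iff_Kinvariant:
  "kills \<phi> (C_rels H K) \<longleftrightarrow> (\<exists>f. Kinvariant f \<and> \<phi> = (\<lambda>(x, a). a * f x))"
proof
  assume *: "kills \<phi> (C_rels H K)"
  then have scale: "\<phi> (x, a) = a * \<phi> (x, 1)" for x a
    unfolding kills_C_rels is_lin_def by (metis mult.right_neutral)
  moreover have "Kinvariant (\<lambda>x. \<phi> (x, 1))"
    using * scale[of _ "counit H _"] unfolding kills_C_rels Kinvariant_def by simp
  ultimately show "\<exists>f. Kinvariant f \<and> \<phi> = (\<lambda>(x, a). a * f x)" by fast
next
  assume "\<exists>f. Kinvariant f \<and> \<phi> = (\<lambda>(x, a). a * f x)"
  then show "kills \<phi> (C_rels H K)"
    by (auto simp: kills_C_rels Kinvariant_def is_lin_def algebra_simps)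
qed

lemma sval_dot: "Kinvariant f \<Longrightarrow> sval (\<lambda>(x, a). a * f x) (d h) = f h"
  unfolding dot_def by (subst sval_cls) (auto simp: kills_C_rels_iff_Kinvariant)

lemma cls_C_eqI:
  assumes "\<And>f. Kinvariant f \<Longrightarrow> fval (\<lambda>(x, a). a * f x) p = fval (\<lambda>(x, a). a * f x) q"
  shows "cls (C_rels H K) p = cls (C_rels H K) q"
proof (rule cls_eqI)
  fix \<phi> assume "kills \<phi> (C_rels H K)"
  then obtain f where "Kinvariant f" "\<phi> = (\<lambda>(x, a). a * f x)" by (auto simp: kills_C_rels_iff_Kinvariant)
  then show "fval \<phi> p = fval \<phi> q" using assms by simp
qed

lemma dot_in_C [simp]: "d h \<in> carrier C"
  unfolding C_eq dot_def by (rule cls_in_presented) simp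

lemma KinvariantD:
  assumes "Kinvariant f"
  shows "f (x + y) = f x + f y" "f (hscale H c x) = c * f x" "k \<in> K \<Longrightarrow> f (x * k) = counit H k * f x"
  using assms by (simp_all add: Kinvariant_def is_lin_def)

lemma dot_add: "d (x + y) = vadd C (d x) (d y)"
  unfolding C_eq dot_def vadd_presented by (rule cls_C_eqI) (simp add: KinvariantD)

lemma dot_scale: "d (hscale H c x) = smul C c (d x)"
  unfolding C_eq dot_def smul_presented by (rule cls_C_eqI) (simp add: KinvariantD)

lemma dot_mult_subalgebra: "k \<in> K \<Longrightarrow> d (x * k) = smul C (counit H k) (d x)"
  unfolding C_eq dot_def smul_presented by (rule cls_C_eqI) (simp add: KinvariantD)

lemma C_element_is_dot:
  assumes "c \<in> carrier C"
  shows "\<exists>h. d h = c"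
proof -
  obtain p where p: "c = cls (C_rels H K) p"
    using assms unfolding C_eq by (rule carrier_presentedE)
  have "d (lin_ext (hscale H) (\<lambda>(x, a). hscale H a x) p) = c"
    unfolding p dot_def
  proof (rule cls_C_eqI)
    fix f assume f: "Kinvariant f"
    then have "lin f" by (simp add: Kinvariant_def)
    then show "fval (\<lambda>(x, a). a * f x) (gen (lin_ext (hscale H) (\<lambda>(x, a). hscale H a x) p, 1)) =
        fval (\<lambda>(x, a). a * f x) p"
      by (simp add: is_lin_lin_ext[OF vector_space] case_prod_unfold KinvariantD[OF f])
  qed
  then show ?thesis by blast
qed

text \<open>
An arbitrary section of \<open>dot\<close>. Functionals on \<open>C\<close> do not see the choice (lemma \<open>Kinvariant_cong\<close>).
\<close>

definition undot :: "('f, 'h) celem \<Rightarrow> 'h" where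
  "undot c = (SOME h. d h = c)"

lemma dot_undot: "c \<in> carrier C \<Longrightarrow> d (undot c) = c"
  unfolding undot_def by (rule someI_ex) (rule C_element_is_dot)

lemma map_dot_undot: "set cs \<subseteq> carrier C \<Longrightarrow> map d (map undot cs) = cs"
  by (induction cs) (simp_all add: dot_undot)

lemma Kinvariant_cong: "Kinvariant f \<Longrightarrow> d x = d y \<Longrightarrow> f x = f y"
  using sval_dot by metis

lemma functional_on_Kinvariant:
  assumes "functional_on C g"
  shows "Kinvariant (\<lambda>x. g (d x))"
  using assms by (simp add: Kinvariant_def is_lin_def functional_on_def dot_add dot_scale dot_mult_subalgebra)

lemma vclosed_C: "vclosed C"
  unfolding C_eq by (rule vclosed_presented)

lemma Kinvariant_functional_on:
  assumes f: "Kinvariant f"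
  shows "functional_on C (\<lambda>c. f (undot c))"
proof (rule functional_onI)
  fix c c' assume c: "c \<in> carrier C" "c' \<in> carrier C"
  have "d (undot (vadd C c c')) = d (undot c + undot c')"
    using c vclosed_C by (simp add: dot_undot dot_add vclosed_def)
  then show "f (undot (vadd C c c')) = f (undot c) + f (undot c')"
    using Kinvariant_cong[OF f] KinvariantD[OF f] by metis
next
  fix a c assume c: "c \<in> carrier C"
  have "d (undot (smul C a c)) = d (hscale H a (undot c))"
    using c vclosed_C by (simp add: dot_undot dot_scale vclosed_def)
  then show "f (undot (smul C a c)) = a * f (undot c)"
    using Kinvariant_cong[OF f] KinvariantD[OF f] by metis
qed

lemma C_act_dot: "C_act H K y (d h) = d (y * h)"
  unfolding C_act_def dot_def[of _ _ "y * h"]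
proof (rule cls_fsweedler_eqI)
  fix \<phi> assume "kills \<phi> (C_rels H K)"
  then obtain f where f: "Kinvariant f" "\<phi> = (\<lambda>(x, a). a * f x)" by (auto simp: kills_C_rels_iff_Kinvariant)
  then show "sval (\<lambda>x. fval \<phi> (case x of (x, a) \<Rightarrow> gen (y * x, a))) (d h) = fval \<phi> (gen (y * h, 1))"
    using sval_dot[OF Kinvariant_left[OF f(1), of y], of h] by (simp add: case_prod_unfold)
qed

lemma C_counit_dot: "C_counit H K (d h) = counit H h"
  unfolding C_counit_def by (rule sval_dot) (rule Kinvariant_counit)

lemma C_comult_closed: "C_comult H K c \<in> carrier (tensor C C)"
  unfolding C_comult_def tensor_def
  by (intro cls_in_presented keys_fsweedler)
    (auto intro!: keys_fscale_subset keys_fsweedler)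

lemma sval_C_comult:
  assumes \<xi>: "kills \<xi> (tensor_rels C C)"
  shows "sval \<xi> (C_comult H K (d h)) = comult_sum h (\<lambda>a b. \<xi> (d a, d b))"
proof -
  have inv: "Kinvariant (\<lambda>a. \<xi> (d a, d b))" "Kinvariant (\<lambda>b. \<xi> (d a, d b))" for a b
    using \<xi> functional_on_Kinvariant[of "\<lambda>c. \<xi> (c, d b)"] functional_on_Kinvariant[of "\<lambda>c. \<xi> (d a, c)"]
    by (simp_all add: kills_tensor_rels)
  have "bilin (hscale H) (hscale H) (\<lambda>a b. \<xi> (d a, d b))"
    using inv by (simp add: bilin_def Kinvariant_def)
  then have "sval (\<lambda>(a, b). \<xi> (d a, d b)) (comult H x) = comult_sum x (\<lambda>a b. \<xi> (d a, d b))" for x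
    by (rule sval_comult)
  then have "sval \<xi> (C_comult H K (d h)) =
      sval (\<lambda>(x, a). a * comult_sum x (\<lambda>a b. \<xi> (d a, d b))) (d h)"
    unfolding C_comult_def sval_cls[OF \<xi>] by (simp add: fval_fsweedler case_prod_unfold)
  also have "\<dots> = comult_sum h (\<lambda>a b. \<xi> (d a, d b))"
    by (rule sval_dot) (rule Kinvariant_comult, rule inv, rule inv)
  finally show ?thesis .
qed

text \<open>
The multilinear functions on \<open>C\<close>, pulled back to \<open>H\<close>.
\<close>

definition Kmultilin :: "('h list \<Rightarrow> 'f) \<Rightarrow> bool" where
  "Kmultilin L \<longleftrightarrow> (\<forall>us ws. Kinvariant (\<lambda>x. L (us @ x # ws)))"

lemma Kmultilin_iff: "Kmultilin L \<longleftrightarrow> multilin L \<and> Kinvariant_slots L"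
  by (simp add: Kmultilin_def multilin_Kinvariant_slots_iff)

lemma Kmultilin_Cons:
  assumes "Kmultilin L"
  shows "Kmultilin (\<lambda>ls. L (a # ls))"
  unfolding Kmultilin_def
proof (intro allI)
  fix us ws show "Kinvariant (\<lambda>x. L (a # us @ x # ws))"
    using assms[unfolded Kmultilin_def, rule_format, of "a # us" ws] by simp
qed

lemma Kmultilin_diag_sum: "Kmultilin L \<Longrightarrow> Kmultilin (\<lambda>hs. diag_sum x hs L)"
  by (simp add: Kmultilin_iff multilin_diag_sum Kinvariant_slots_diag_sum)

lemma Kmultilin_cong:
  "Kmultilin L \<Longrightarrow> map d hs = map d hs' \<Longrightarrow> L hs = L hs'"
proof (induction hs arbitrary: hs' L)
  case (Cons h hs)
  then obtain h' hs'' where hs': "hs' = h' # hs''" by auto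
  have "Kinvariant (\<lambda>x. L ([] @ x # hs))"
    using Cons.prems(1) unfolding Kmultilin_def by blast
  then have "L (h # hs) = L (h' # hs)"
    using Cons.prems(2) hs' by (auto dest: Kinvariant_cong)
  also have "\<dots> = L (h' # hs'')"
    using Cons.IH[OF Kmultilin_Cons[OF Cons.prems(1)]] Cons.prems(2) hs' by simp
  finally show ?case by (simp add: hs')
qed simp

definition descend :: "('h list \<Rightarrow> 'f) \<Rightarrow> ('f, 'h) celem list \<Rightarrow> 'f" where
  "descend L cs = L (map undot cs)"

lemma descend_dot: "Kmultilin L \<Longrightarrow> descend L (map d hs) = L hs"
  unfolding descend_def by (rule Kmultilin_cong) (auto simp: dot_undot)

lemma kills_descend:
  assumes "Kmultilin L"
  shows "kills (descend L) (tpow_rels C n)"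
proof -
  have "functional_on C (\<lambda>c. L (map undot us @ undot c # map undot ws))" for us ws
    using assms unfolding Kmultilin_def by (intro Kinvariant_functional_on) blast
  then show ?thesis by (simp add: kills_tpow_rels descend_def)
qed

abbreviation tensors :: "nat \<Rightarrow> ('f, 'h) celem list set" where
  "tensors n \<equiv> {cs. length cs = n \<and> set cs \<subseteq> carrier C}"

lemma tpow_eq: "tpow C n = presented (tensors n) (tpow_rels C n)"
  by (simp add: tpow_def)

lemma rels_within_C: "rels_within (tensors n) (tpow_rels C n)"
  by (rule rels_within_tpow) (rule vclosed_C)

lemma C_tens_closed: "cs \<in> tensors n \<Longrightarrow> C_tens H K cs \<in> carrier (tpow C n)"
  unfolding tpow_eq C_tens_def by (auto intro!: cls_in_presented)

lemma sval_C_tens: "Kmultilin L \<Longrightarrow> sval (descend L) (C_tens H K (map d hs)) = L hs"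
  unfolding C_tens_def by (subst sval_cls) (simp_all add: kills_descend descend_dot)

text \<open>
The length matters because \<open>map2\<close> would silently cut longer lists of tensors.
\<close>

lemma keys_iter_comult:
  assumes "ys \<in> Poly_Mapping.keys (rep (iter_comult H n x))"
  shows "length ys = n"
proof -
  have "iter_comult H n x \<in> carrier (tpow (hspace H) n)" for x
    unfolding tpow_def
  proof (induction n arbitrary: x)
    case 0
    show ?case by (auto intro!: cls_in_presented keys_fscale_subset)
  next
    case (Suc n)
    have "length bs = n" if "bs \<in> Poly_Mapping.keys (rep (iter_comult H n b))" for b bs
      using keys_rep[OF rels_within_tpow Suc.IH] that by auto
    then show ?case
      by (auto intro!: cls_in_presented keys_fsweedler)
  qed
  then have "iter_comult H n x \<in> carrier (presented {vs. length vs = n \<and> set vs \<subseteq> carrier (hspace H)}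
      (tpow_rels (hspace H) n))"
    by (simp add: tpow_def)
  from keys_rep[OF rels_within_tpow this] show ?thesis
    using assms by auto
qed

lemma map2_C_act:
  "set cs \<subseteq> carrier C \<Longrightarrow> map2 (C_act H K) ys cs = map d (map2 (*) ys (map undot cs))"
proof (induction cs arbitrary: ys)
  case (Cons c cs)
  then have "C_act H K y c = d (y * undot c)" for y
    using C_act_dot[of y "undot c"] by (simp add: dot_undot)
  then show ?case using Cons by (cases ys) auto
qed simp

lemma diag_act_closed:
  assumes T: "T \<in> carrier (tpow C n)"
  shows "diag_act H K n y T \<in> carrier (tpow C n)"
  unfolding diag_act_def tpow_eq
proof (intro cls_in_presented keys_fsweedler)
  fix cs ys
  assume "cs \<in> Poly_Mapping.keys (rep T)" and ys: "ys \<in> Poly_Mapping.keys (rep (iter_comult H n y))"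
  then have "cs \<in> tensors n"
    using keys_rep[OF rels_within_C T[unfolded tpow_eq]] by blast
  then show "Poly_Mapping.keys (gen (map2 (C_act H K) ys cs) :: _ \<Rightarrow>\<^sub>0 'f) \<subseteq> tensors n"
    using keys_iter_comult[OF ys] by (auto simp: map2_C_act)
qed

lemma sval_diag_act:
  assumes L: "Kmultilin L" and T: "T \<in> carrier (tpow C n)"
  shows "sval (descend L) (diag_act H K n y T) = sval (descend (\<lambda>hs. diag_sum y hs L)) T"
proof -
  have "sval (descend L) (diag_act H K n y T) =
      sval (\<lambda>cs. sval (\<lambda>ys. descend L (map2 (C_act H K) ys cs)) (iter_comult H n y)) T"
    unfolding diag_act_def by (simp add: sval_cls kills_descend[OF L] fval_fsweedler)
  also have "\<dots> = sval (descend (\<lambda>hs. diag_sum y hs L)) T"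
  proof (rule sval_cong[OF rels_within_C T[unfolded tpow_eq]])
    fix cs assume cs: "cs \<in> tensors n"
    then have "descend L (map2 (C_act H K) ys cs) = L (map2 (*) ys (map undot cs))" for ys
      using descend_dot[OF L] by (simp add: map2_C_act del: map_map)
    then show "sval (\<lambda>ys. descend L (map2 (C_act H K) ys cs)) (iter_comult H n y) =
        descend (\<lambda>hs. diag_sum y hs L) cs"
      using sval_iter_comult[of L "map undot cs" y] L cs by (simp add: descend_def Kmultilin_iff)
  qed
  finally show ?thesis .
qed

section \<open>The pairing of invariant forms with cochains\<close>

text \<open>
The pullback of a form along \<open>m \<otimes>\<^sub>K c \<mapsto> m \<otimes>\<^sub>H dot 1 \<otimes> c\<close>.
\<close>

definition pairing :: "('m \<Rightarrow> 'h list \<Rightarrow> 'f) \<Rightarrow> 'm \<times> (('f, 'h) celem list \<Rightarrow>\<^sub>0 'f) set \<Rightarrow> 'f" where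
  "pairing \<Psi> = (\<lambda>(m, T). sval (descend (\<lambda>hs. \<Psi> m (1 # hs))) T)"

abbreviation form_value :: "('m \<Rightarrow> 'h list \<Rightarrow> 'f) \<Rightarrow> ('f, 'h, 'm) cochain_elem \<Rightarrow> 'f" where
  "form_value \<Psi> \<equiv> sval (pairing \<Psi>)"

lemma forms_Kmultilin: "\<Psi> \<in> forms n \<Longrightarrow> Kmultilin (\<Psi> m)"
  by (simp add: Kmultilin_def forms_Kinvariant)

lemma forms_Kmultilin_Cons: "\<Psi> \<in> forms n \<Longrightarrow> Kmultilin (\<lambda>hs. \<Psi> m (h # hs))"
  by (rule Kmultilin_Cons) (rule forms_Kmultilin)

text \<open>
Acting by \<open>k \<in> K\<close> on all slots leaves \<open>1\<close> in slot 0 up to the counit, so \<open>H\<close>-invariance restricts to the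
\<open>K\<close>-balancing of cochains.
\<close>

lemma forms_balanced:
  assumes \<Psi>: "\<Psi> \<in> forms n" and k: "k \<in> K"
  shows "\<Psi> (mact M m k) (1 # hs) = diag_sum k hs (\<lambda>hs. \<Psi> m (1 # hs))"
proof -
  note L = multilinD[OF forms_multilin[OF \<Psi>]]
  have "a \<in> K \<Longrightarrow> \<Psi> m (a # ls) = counit H a * \<Psi> m (1 # ls)" for a ls
    using Kinvariant_slotsD(2)[OF forms_Kinvariant_slots[OF \<Psi>], of a m 1 ls] by simp
  then have "\<Psi> (mact M m k) (1 # hs) =
      comult_sum k (\<lambda>a b. counit H a * diag_sum b hs (\<lambda>ls. \<Psi> m (1 # ls)))"
    unfolding forms_mact[OF \<Psi>] diag_sum.simps
    by (intro comult_sum_subalgebra_cong[OF k])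
      (simp_all add: bilin_def is_lin_def diag_linear_simps L mult.left_commute)
  also have "\<dots> = diag_sum k hs (\<lambda>hs. \<Psi> m (1 # hs))"
    by (rule comult_sum_counit_left) (rule lin_diag_sum)
  finally show ?thesis .
qed

lemma kills_pairing:
  assumes \<Psi>: "\<Psi> \<in> forms n'"
  shows "kills (pairing \<Psi>) (cochain_rels H K M n)"
  unfolding cochain_rels_def kills_bal_tensor_rels kills_tensor_rels
proof (intro conjI ballI)
  fix T
  show "functional_on (mspace M) (\<lambda>m. pairing \<Psi> (m, T))"
    unfolding functional_on_full is_lin_def pairing_def
    by (simp add: descend_def[abs_def] forms_add[OF \<Psi>] forms_scale[OF \<Psi>] sval_fun_add sval_fun_mult)
next
  fix m
  show "functional_on (tpow C n) (\<lambda>T. pairing \<Psi> (m, T))"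
    unfolding tpow_eq pairing_def
    by (simp, rule functional_on_sval, rule kills_descend, rule forms_Kmultilin_Cons[OF \<Psi>])
next
  fix m k T assume k: "k \<in> K" and T: "T \<in> carrier (tpow C n)"
  show "pairing \<Psi> (mact M m k, T) = pairing \<Psi> (m, diag_act H K n k T)"
    by (simp add: pairing_def sval_diag_act[OF forms_Kmultilin_Cons[OF \<Psi>] T] forms_balanced[OF \<Psi> k])
qed

abbreviation cochain_gens :: "nat \<Rightarrow> ('m \<times> (('f, 'h) celem list \<Rightarrow>\<^sub>0 'f) set) set" where
  "cochain_gens n \<equiv> UNIV \<times> carrier (tpow C n)"

lemma cochain_eq: "cochain H K M n = presented (cochain_gens n) (cochain_rels H K M n)"
  by (simp add: cochain_def cochain_rels_def bal_tensor_def)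

lemma rels_within_cochain: "rels_within (cochain_gens n) (cochain_rels H K M n)"
  using rels_within_bal_tensor[of "mspace M" "tpow C n" K "mact M" "diag_act H K n"]
    vclosed_presented[of "tensors n" "tpow_rels C n"] diag_act_closed
  by (simp add: cochain_rels_def tpow_eq)

lemma pairing_C_tens:
  "\<Psi> \<in> forms n' \<Longrightarrow> pairing \<Psi> (m, C_tens H K (map d hs)) = \<Psi> m (1 # hs)"
  unfolding pairing_def by (simp add: sval_C_tens forms_Kmultilin_Cons)

lemma form_value_cls:
  "\<Psi> \<in> forms n' \<Longrightarrow> form_value \<Psi> (cls (cochain_rels H K M n) p) = fval (pairing \<Psi>) p"
  by (simp add: sval_cls kills_pairing)

lemma form_value_mtens:
  "\<Psi> \<in> forms n' \<Longrightarrow> form_value \<Psi> (mtens H K M m (map d hs)) = \<Psi> m (1 # hs)"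
  unfolding mtens_def by (simp add: form_value_cls pairing_C_tens)

lemma mtens_closed: "cs \<in> tensors n \<Longrightarrow> mtens H K M m cs \<in> carrier (cochain H K M n)"
  unfolding mtens_def cochain_eq using C_tens_closed[of cs n]
  by (auto intro!: cls_in_presented)

lemma functional_on_form_value:
  "\<Psi> \<in> forms n' \<Longrightarrow> functional_on (cochain H K M n) (form_value \<Psi>)"
  unfolding cochain_eq by (rule functional_on_sval) (rule kills_pairing)

subsection \<open>Invariant forms separate cochains\<close>

text \<open>
The pullback of a functional \<open>\<Phi>\<close> on \<open>M \<otimes>\<^sub>K C\<^sup>\<otimes>\<^sup>n\<close> along
\<open>m \<otimes> dot h \<otimes> c \<mapsto> m h\<^sub>(\<^sub>1\<^sub>) \<otimes> S(h\<^sub>(\<^sub>2\<^sub>)) c\<close>.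
\<close>

definition extend_form :: "('m \<Rightarrow> 'h list \<Rightarrow> 'f) \<Rightarrow> 'm \<Rightarrow> 'h list \<Rightarrow> 'f" where
  "extend_form \<Phi> m hs = (case hs of [] \<Rightarrow> 0 |
    h # hs' \<Rightarrow> comult_sum h (\<lambda>a b. diag_sum (antipode H b) hs' (\<Phi> (mact M m a))))"

lemma extend_form_simps [simp]:
  "extend_form \<Phi> m [] = 0"
  "extend_form \<Phi> m (h # hs) = comult_sum h (\<lambda>a b. diag_sum (antipode H b) hs (\<Phi> (mact M m a)))"
  by (simp_all add: extend_form_def)

text \<open>
\<open>K\<close>-invariance in slot 0 holds because \<open>m h\<^sub>(\<^sub>1\<^sub>) k\<^sub>(\<^sub>1\<^sub>) \<otimes> S(k\<^sub>(\<^sub>2\<^sub>)) S(h\<^sub>(\<^sub>2\<^sub>)) c\<close> can be rebalanced to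
\<open>m h\<^sub>(\<^sub>1\<^sub>) \<otimes> k\<^sub>(\<^sub>1\<^sub>) S(k\<^sub>(\<^sub>2\<^sub>)) S(h\<^sub>(\<^sub>2\<^sub>)) c\<close>. \<open>H\<close>-invariance is the cancellation of \<open>S(x\<^sub>(\<^sub>2\<^sub>)) x\<^sub>(\<^sub>3\<^sub>)\<close> in
\<open>m x\<^sub>(\<^sub>1\<^sub>) h\<^sub>(\<^sub>1\<^sub>) \<otimes> S(h\<^sub>(\<^sub>2\<^sub>)) S(x\<^sub>(\<^sub>2\<^sub>)) x\<^sub>(\<^sub>3\<^sub>) c\<close>.
\<close>

lemma extend_form:
  assumes lin: "\<And>hs. mlin (\<lambda>m. \<Phi> m hs)" and slot: "\<And>m. Kmultilin (\<Phi> m)"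
    and bal: "\<And>m k hs. k \<in> K \<Longrightarrow> \<Phi> (mact M m k) hs = diag_sum k hs (\<Phi> m)"
    and supp: "\<And>m hs. length hs \<noteq> n \<Longrightarrow> \<Phi> m hs = 0"
  shows "extend_form \<Phi> \<in> forms n"
    and "extend_form \<Phi> m (1 # hs) = \<Phi> m hs"
proof -
  let ?S = "antipode H"
  have lin_fun: "\<Phi> (m + m') = (\<lambda>hs. \<Phi> m hs + \<Phi> m' hs)" "\<Phi> (mscale M c m) = (\<lambda>hs. c * \<Phi> m hs)" for m m' c
    using lin by (auto simp: is_lin_def)
  have ml: "multilin (\<Phi> m)" for m using slot by (simp add: Kmultilin_iff)
  have S_mult: "diag_sum (?S (x * y) * z) hs L = diag_sum (?S y * ?S x * z) hs L" for x y z hs L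
    by (rule antipode_mult[where f = "\<lambda>w. diag_sum (w * z) hs L"])
      (simp add: is_lin_def diag_linear_simps)
  have bl: "bilin (hscale H) (hscale H) (\<lambda>a b. diag_sum (?S b) hs (\<Phi> (mact M m a)))" for hs m
    by (simp add: bilin_def is_lin_def coact_linear_simps lin_fun)
  show "extend_form \<Phi> m (1 # hs) = \<Phi> m hs"
    using antipode_one[OF lin_diag_sum]
    by (simp add: comult_sum_one[OF bl] mact_one diag_sum_one[OF ml])
  show "extend_form \<Phi> \<in> forms n"
  proof (rule formsI)
    fix hs show "mlin (\<lambda>m. extend_form \<Phi> m hs)"
      by (cases hs) (simp_all add: is_lin_def coact_linear_simps lin_fun)
  next
    fix m us ws
    show "Kinvariant (\<lambda>x. extend_form \<Phi> m (us @ x # ws))"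
    proof (cases us)
      case Nil
      have "extend_form \<Phi> m ((x * k) # ws) = counit H k * extend_form \<Phi> m (x # ws)" if k: "k \<in> K" for x k
      proof -
        have "comult_sum k (\<lambda>k1 k2. diag_sum (?S (x2 * k2)) ws (\<Phi> (mact M m (x1 * k1)))) =
            counit H k * diag_sum (?S x2) ws (\<Phi> (mact M m x1))" for x1 x2
        proof -
          have "diag_sum (?S (x2 * k2)) ws (\<Phi> (mact M m (x1 * k1))) =
              diag_sum (k1 * ?S k2 * ?S x2) ws (\<Phi> (mact M m x1))" if "k1 \<in> K" for k1 k2
          proof -
            have "\<Phi> (mact M (mact M m x1) k1) = (\<lambda>ls. diag_sum k1 ls (\<Phi> (mact M m x1)))"
              using bal[OF that] by blast
            then show ?thesis
              using S_mult[of x2 k2 1 ws] by (simp add: mact_mult diag_sum_mult ml multilin_diag_sum)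
          qed
          then have "comult_sum k (\<lambda>k1 k2. diag_sum (?S (x2 * k2)) ws (\<Phi> (mact M m (x1 * k1)))) =
              comult_sum k (\<lambda>k1 k2. diag_sum (k1 * ?S k2 * ?S x2) ws (\<Phi> (mact M m x1)))"
            by (intro comult_sum_subalgebra_cong[OF k])
              (simp_all add: bilin_def is_lin_def coact_linear_simps lin_fun)
          also have "\<dots> = counit H k * diag_sum (1 * ?S x2) ws (\<Phi> (mact M m x1))"
            by (rule comult_sum_antipode_right[where f = "\<lambda>z. diag_sum (z * ?S x2) ws (\<Phi> (mact M m x1))"])
              (simp add: is_lin_def diag_linear_simps)
          finally show ?thesis by simp
        qed
        then show ?thesis by (simp add: comult_sum_mult[OF bl] comult_sum_fun_mult)
      qed
      then show ?thesis by (simp add: Nil Kinvariant_def is_lin_def linear_simps)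
    next
      case (Cons u us')
      have "Kinvariant (\<lambda>x. diag_sum (?S b) (us' @ x # ws) (\<Phi> (mact M m a)))" for a b
        using Kmultilin_diag_sum[OF slot] unfolding Kmultilin_def by blast
      then show ?thesis by (simp add: Cons Kinvariant_comult_sum)
    qed
  next
    fix m x hs
    show "extend_form \<Phi> (mact M m x) hs = diag_sum x hs (extend_form \<Phi> m)"
    proof (cases hs)
      case (Cons h hs')
      have "diag_sum x hs (extend_form \<Phi> m) = comult_sum x (\<lambda>y x3. comult_sum y (\<lambda>x1 x2.
          comult_sum h (\<lambda>a b. diag_sum (?S (x2 * b) * x3) hs' (\<Phi> (mact M m (x1 * a))))))"
        by (simp add: Cons comult_sum_mult[OF bl] diag_sum_comult_swap diag_sum_mult[OF ml])
      also have "\<dots> = comult_sum x (\<lambda>x1 y. comult_sum y (\<lambda>x2 x3.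
          comult_sum h (\<lambda>a b. diag_sum (?S (x2 * b) * x3) hs' (\<Phi> (mact M m (x1 * a))))))"
        by (rule comult_sum_coassoc[symmetric])
          (simp add: trilin_def is_lin_def coact_linear_simps lin_fun)
      also have "\<dots> = comult_sum x (\<lambda>x1 y. comult_sum h (\<lambda>a b. comult_sum y (\<lambda>x2 x3.
          diag_sum (?S b * (?S x2 * x3)) hs' (\<Phi> (mact M m (x1 * a))))))"
        by (subst comult_sum_swap) (simp add: S_mult mult.assoc)
      also have "\<dots> = comult_sum x (\<lambda>x1 y. counit H y *
          comult_sum h (\<lambda>a b. diag_sum (?S b) hs' (\<Phi> (mact M m (x1 * a)))))"
      proof -
        have "comult_sum y (\<lambda>x2 x3. diag_sum (?S b * (?S x2 * x3)) hs' L) =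
            counit H y * diag_sum (?S b * 1) hs' L" for y b L
          by (rule comult_sum_antipode_left[where f = "\<lambda>z. diag_sum (?S b * z) hs' L"])
            (simp add: is_lin_def diag_linear_simps)
        then show ?thesis by (simp add: comult_sum_fun_mult)
      qed
      also have "\<dots> = comult_sum h (\<lambda>a b. diag_sum (?S b) hs' (\<Phi> (mact M m (x * a))))"
        by (rule comult_sum_counit_right) (simp add: is_lin_def coact_linear_simps lin_fun)
      also have "\<dots> = extend_form \<Phi> (mact M m x) hs"
        by (simp add: Cons mact_mult)
      finally show ?thesis ..
    qed simp
  next
    fix m and hs :: "'h list" assume len: "length hs \<noteq> Suc n"
    show "extend_form \<Phi> m hs = 0"
    proof (cases hs)
      case (Cons h hs')
      then have "diag_sum x hs' (\<Phi> m') = diag_sum x hs' (\<lambda>ls. 0)" for x m'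
        using len by (intro diag_sum_cong supp) simp
      then show ?thesis using Cons by simp
    qed simp
  qed
qed

text \<open>
Every functional on \<open>M \<otimes>\<^sub>K C\<^sup>\<otimes>\<^sup>n\<close> is the pairing with its extension to an invariant form.
\<close>

lemma forms_separate:
  assumes t: "t \<in> carrier (cochain H K M n)" "t' \<in> carrier (cochain H K M n)"
    and eq: "\<And>\<Psi>. \<Psi> \<in> forms n \<Longrightarrow> form_value \<Psi> t = form_value \<Psi> t'"
  shows "t = t'"
proof -
  let ?R = "cochain_rels H K M n"
  obtain p where p: "t = cls ?R p" "Poly_Mapping.keys p \<subseteq> cochain_gens n"
    using t(1) unfolding cochain_eq by (rule carrier_presentedE)
  obtain q where q: "t' = cls ?R q" "Poly_Mapping.keys q \<subseteq> cochain_gens n"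
    using t(2) unfolding cochain_eq by (rule carrier_presentedE)
  have "cls ?R p = cls ?R q"
  proof (rule cls_eqI)
    fix \<phi> assume \<phi>: "kills \<phi> ?R"
    have lin: "mlin (\<lambda>m. \<phi> (m, T))" if "T \<in> carrier (tpow C n)" for T
      using \<phi> that by (simp add: cochain_rels_def kills_bal_tensor_rels kills_tensor_rels functional_on_full)
    have func: "functional_on (presented (tensors n) (tpow_rels C n)) (\<lambda>T. \<phi> (m, T))" for m
      using \<phi> by (simp add: cochain_rels_def kills_bal_tensor_rels kills_tensor_rels tpow_eq)
    have bal: "\<phi> (mact M m k, T) = \<phi> (m, diag_act H K n k T)"
      if "k \<in> K" "T \<in> carrier (tpow C n)" for m k T
      using \<phi> that by (simp add: cochain_rels_def kills_bal_tensor_rels)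
    \<comment> \<open>outside length \<open>n\<close> the value 0 is forced by the support condition on forms\<close>
    define \<Phi> where "\<Phi> m hs = (if length hs = n then \<phi> (m, C_tens H K (map d hs)) else 0)" for m hs
    have descend_\<Phi>: "sval (descend (\<Phi> m)) T = \<phi> (m, T)" if T: "T \<in> carrier (tpow C n)" for m T
    proof -
      have "sval (descend (\<Phi> m)) T = sval (\<lambda>cs. \<phi> (m, cls (tpow_rels C n) (gen cs))) T"
        by (rule sval_cong[OF rels_within_C T[unfolded tpow_eq]])
          (auto simp: descend_def \<Phi>_def C_tens_def map_dot_undot simp del: map_map)
      also have "\<dots> = \<phi> (m, T)"
        by (rule functional_on_sval_eq[OF func T[unfolded tpow_eq] rels_within_C])
      finally show ?thesis .
    qed
    have tens: "C_tens H K (map d hs) \<in> carrier (tpow C n)" if "length hs = n" for hs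
      using that by (intro C_tens_closed) auto
    have slot: "Kmultilin (\<Phi> m)" for m
      unfolding Kmultilin_def
    proof (intro allI)
      fix us ws
      show "Kinvariant (\<lambda>x. \<Phi> m (us @ x # ws))"
      proof (cases "length us + length ws + 1 = n")
        case True
        have "kills (\<lambda>cs. \<phi> (m, cls (tpow_rels C n) (gen cs))) (tpow_rels C n)"
          by (rule functional_on_kills[OF func rels_within_C])
        then have "functional_on C (\<lambda>c. \<phi> (m, cls (tpow_rels C n) (gen (map d us @ c # map d ws))))"
          using True unfolding kills_tpow_rels
          by (elim allE[of _ "map d us"] allE[of _ "map d ws"]) auto
        from functional_on_Kinvariant[OF this] show ?thesis
          using True by (auto simp: \<Phi>_def C_tens_def)
      next
        case False
        then show ?thesis by (simp add: \<Phi>_def Kinvariant_zero)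
      qed
    qed
    have \<Phi>_lin: "mlin (\<lambda>m. \<Phi> m hs)" for hs
      using lin[OF tens] by (simp add: \<Phi>_def is_lin_def)
    have \<Phi>_supp: "length hs \<noteq> n \<Longrightarrow> \<Phi> m hs = 0" for m hs
      by (simp add: \<Phi>_def)
    have \<Phi>_bal: "\<Phi> (mact M m k) hs = diag_sum k hs (\<Phi> m)" if k: "k \<in> K" for m k hs
    proof (cases "length hs = n")
      case True
      let ?T = "C_tens H K (map d hs)"
      have "\<Phi> (mact M m k) hs = sval (descend (\<Phi> m)) (diag_act H K n k ?T)"
        using True bal[OF k tens[OF True]] descend_\<Phi>[OF diag_act_closed[OF tens[OF True]]]
        by (simp add: \<Phi>_def)
      also have "\<dots> = sval (descend (\<lambda>hs. diag_sum k hs (\<Phi> m))) ?T"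
        by (rule sval_diag_act[OF slot tens[OF True]])
      also have "\<dots> = diag_sum k hs (\<Phi> m)"
        by (rule sval_C_tens[OF Kmultilin_diag_sum[OF slot]])
      finally show ?thesis .
    next
      case False
      then have "diag_sum k hs (\<Phi> m) = diag_sum k hs (\<lambda>ls. 0)"
        by (intro diag_sum_cong) (simp add: \<Phi>_def)
      then show ?thesis using False by (simp add: \<Phi>_def)
    qed
    note ext = extend_form[OF \<Phi>_lin slot \<Phi>_bal \<Phi>_supp]
    have pair: "pairing (extend_form \<Phi>) x = \<phi> x" if "x \<in> cochain_gens n" for x
      using that descend_\<Phi> by (auto simp: pairing_def ext(2) simp del: extend_form_simps)
    have val: "fval \<phi> r = fval (pairing (extend_form \<Phi>)) r"
      if "Poly_Mapping.keys r \<subseteq> cochain_gens n" for r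
      by (rule lin_ext_cong) (use that pair in auto)
    show "fval \<phi> p = fval \<phi> q"
      using eq[OF ext(1)] val[OF p(2)] val[OF q(2)] by (simp add: p(1) q(1) form_value_cls[OF ext(1)])
  qed
  then show ?thesis by (simp add: p q)
qed

end

section \<open>The operators\<close>

context hopf_pair_sayd
begin

subsection \<open>Linear maps determined by generators\<close>

lemma functional_on_linear_on:
  "functional_on W g \<Longrightarrow> linear_on V W f \<Longrightarrow> functional_on V (\<lambda>x. g (f x))"
  by (auto simp: functional_on_def linear_on_def)

text \<open>
The elements \<open>mtens H K M m cs\<close> span the cochains.
\<close>

lemma functional_on_cochain_eqI:
  assumes g: "functional_on (cochain H K M n) g" "functional_on (cochain H K M n) g'"
    and eq: "\<And>m cs. cs \<in> tensors n \<Longrightarrow> g (mtens H K M m cs) = g' (mtens H K M m cs)"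
    and t: "t \<in> carrier (cochain H K M n)"
  shows "g t = g' t"
proof -
  have expand: "g t = sval (\<lambda>(m, T). sval (\<lambda>cs. g (mtens H K M m cs)) T) t"
    if g: "functional_on (cochain H K M n) g" for g
  proof -
    let ?g = "\<lambda>x. g (cls (cochain_rels H K M n) (gen x))"
    have "kills ?g (cochain_rels H K M n)"
      by (rule functional_on_kills[OF g[unfolded cochain_eq] rels_within_cochain])
    then have func: "functional_on (presented (tensors n) (tpow_rels C n)) (\<lambda>T. ?g (m, T))" for m
      unfolding cochain_rels_def kills_bal_tensor_rels kills_tensor_rels by (simp add: tpow_eq)
    have "g t = sval ?g t"
      by (rule functional_on_sval_eq[OF g[unfolded cochain_eq] t[unfolded cochain_eq]
        rels_within_cochain, symmetric])
    also have "\<dots> = sval (\<lambda>(m, T).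
        sval (\<lambda>cs. g (mtens H K M m cs)) T) t"
    proof (rule sval_cong[OF rels_within_cochain t[unfolded cochain_eq]])
      fix x assume "x \<in> cochain_gens n"
      then obtain m T where x: "x = (m, T)" and T: "T \<in> carrier (tpow C n)" by auto
      have "?g x = sval (\<lambda>cs. ?g (m, cls (tpow_rels C n) (gen cs))) T"
        unfolding x by (rule functional_on_sval_eq[OF func T[unfolded tpow_eq] rels_within_C, symmetric])
      also have "\<dots> = sval (\<lambda>cs. g (mtens H K M m cs)) T"
        by (rule sval_cong[OF rels_within_C T[unfolded tpow_eq]]) (auto simp: mtens_def C_tens_def)
      finally show "?g x = (\<lambda>(m, T).
          sval (\<lambda>cs. g (mtens H K M m cs)) T) x"
        by (simp add: x)
    qed
    finally show ?thesis .
  qed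
  have "sval (\<lambda>(m, T). sval (\<lambda>cs. g (mtens H K M m cs)) T) t =
      sval (\<lambda>(m, T). sval (\<lambda>cs. g' (mtens H K M m cs)) T) t"
  proof (rule sval_cong[OF rels_within_cochain t[unfolded cochain_eq]])
    fix x assume "x \<in> cochain_gens n"
    then obtain m T where x: "x = (m, T)" and T: "T \<in> carrier (tpow C n)" by auto
    have "sval (\<lambda>cs. g (mtens H K M m cs)) T =
        sval (\<lambda>cs. g' (mtens H K M m cs)) T"
      by (rule sval_cong[OF rels_within_C T[unfolded tpow_eq]]) (use eq in auto)
    then show "(\<lambda>(m, T). sval (\<lambda>cs. g (mtens H K M m cs)) T) x =
      (\<lambda>(m, T). sval (\<lambda>cs. g' (mtens H K M m cs)) T) x"
      by (simp add: x)
  qed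
  then show ?thesis by (simp only: expand[OF g(1)] expand[OF g(2)])
qed

lemma linear_on_cochain_eqI:
  assumes f: "linear_on (cochain H K M a) (cochain H K M b) f"
      "linear_on (cochain H K M a) (cochain H K M b) f'"
    and eq: "\<And>m cs. cs \<in> tensors a \<Longrightarrow> f (mtens H K M m cs) = f' (mtens H K M m cs)"
    and t: "t \<in> carrier (cochain H K M a)"
  shows "f t = f' t"
proof (rule forms_separate)
  show "f t \<in> carrier (cochain H K M b)" "f' t \<in> carrier (cochain H K M b)"
    using f t by (auto simp: linear_on_def)
  fix \<Psi> assume \<Psi>: "\<Psi> \<in> forms b"
  show "form_value \<Psi> (f t) = form_value \<Psi> (f' t)"
    by (rule functional_on_cochain_eqI[OF functional_on_linear_on functional_on_linear_on _ t])
      (use functional_on_form_value[OF \<Psi>] f eq in auto)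
qed

text \<open>
The linear extension of a formula \<open>F\<close> on generators, evaluated on chosen representatives. It
does not depend on the representatives if the pairing of \<open>F\<close> with each invariant form
is again given by an invariant form, as assumed in the context that follows.
\<close>

definition realize ::
  "nat \<Rightarrow> ('m \<Rightarrow> ('f, 'h) celem list \<Rightarrow> ('f, 'h, 'm) cochain_elem)
    \<Rightarrow> ('f, 'h, 'm) cochain_elem \<Rightarrow> ('f, 'h, 'm) cochain_elem" where
  "realize n F t = cls (cochain_rels H K M n)
    (fsweedler (\<lambda>(m, T). fsweedler (\<lambda>cs. rep (F m cs)) T) t)"

context
  fixes a b :: nat and F D
  assumes F_closed: "\<And>m cs. cs \<in> tensors a \<Longrightarrow> F m cs \<in> carrier (cochain H K M b)"
    and D_forms: "\<And>\<Psi>. \<Psi> \<in> forms b \<Longrightarrow> D \<Psi> \<in> forms a"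
    and F_dual: "\<And>\<Psi> m hs. \<Psi> \<in> forms b \<Longrightarrow> length hs = a \<Longrightarrow>
      form_value \<Psi> (F m (map d hs)) = D \<Psi> m (1 # hs)"
begin

lemma realize_closed:
  assumes t: "t \<in> carrier (cochain H K M a)"
  shows "realize b F t \<in> carrier (cochain H K M b)"
  unfolding realize_def cochain_eq
proof (intro cls_in_presented keys_fsweedler)
  fix x assume "x \<in> Poly_Mapping.keys (rep t)"
  then obtain m T where x: "x = (m, T)" and T: "T \<in> carrier (tpow C a)"
    using keys_rep[OF rels_within_cochain t[unfolded cochain_eq]] by auto
  have "Poly_Mapping.keys (rep (F m cs)) \<subseteq> cochain_gens b"
    if "cs \<in> Poly_Mapping.keys (rep T)" for cs
    using keys_rep[OF rels_within_C T[unfolded tpow_eq]] that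
      keys_rep[OF rels_within_cochain F_closed[unfolded cochain_eq]] by blast
  then show "Poly_Mapping.keys (case x of (m, T) \<Rightarrow> fsweedler (\<lambda>cs. rep (F m cs)) T) \<subseteq> cochain_gens b"
    unfolding x prod.case by (rule keys_fsweedler)
qed

lemma form_value_realize:
  assumes \<Psi>: "\<Psi> \<in> forms b" and t: "t \<in> carrier (cochain H K M a)"
  shows "form_value \<Psi> (realize b F t) = form_value (D \<Psi>) t"
proof -
  have "form_value \<Psi> (realize b F t) =
      sval (\<lambda>(m, T). sval (\<lambda>cs. form_value \<Psi> (F m cs)) T) t"
    unfolding realize_def form_value_cls[OF \<Psi>]
    by (simp add: fval_fsweedler case_prod_unfold sweedler_def[of "(*)" "pairing \<Psi>"])
  also have "\<dots> = form_value (D \<Psi>) t"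
  proof (rule sval_cong[OF rels_within_cochain t[unfolded cochain_eq]])
    fix x assume "x \<in> cochain_gens a"
    then obtain m T where x: "x = (m, T)" and T: "T \<in> carrier (tpow C a)" by auto
    have "sval (\<lambda>cs. form_value \<Psi> (F m cs)) T = sval (descend (\<lambda>hs. D \<Psi> m (1 # hs))) T"
    proof (rule sval_cong[OF rels_within_C T[unfolded tpow_eq]])
      fix cs assume cs: "cs \<in> tensors a"
      then show "form_value \<Psi> (F m cs) = descend (\<lambda>hs. D \<Psi> m (1 # hs)) cs"
        using F_dual[OF \<Psi>, of "map undot cs" m] by (simp add: map_dot_undot descend_def del: map_map)
    qed
    then show "(\<lambda>(m, T). sval (\<lambda>cs. form_value \<Psi> (F m cs)) T) x = pairing (D \<Psi>) x"
      by (simp add: x pairing_def)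
  qed
  finally show ?thesis .
qed

lemma linear_on_realize: "linear_on (cochain H K M a) (cochain H K M b) (realize b F)"
  unfolding linear_on_def
proof (intro conjI ballI allI)
  fix t assume t: "t \<in> carrier (cochain H K M a)"
  then show "realize b F t \<in> carrier (cochain H K M b)" by (rule realize_closed)
next
  fix t u assume t: "t \<in> carrier (cochain H K M a)" and u: "u \<in> carrier (cochain H K M a)"
  have tu: "vadd (cochain H K M a) t u \<in> carrier (cochain H K M a)"
    using t u unfolding cochain_eq by (rule vadd_presented_closed)
  show "realize b F (vadd (cochain H K M a) t u) =
      vadd (cochain H K M b) (realize b F t) (realize b F u)"
  proof (rule forms_separate)
    show "realize b F (vadd (cochain H K M a) t u) \<in> carrier (cochain H K M b)"
      by (rule realize_closed[OF tu])
    show "vadd (cochain H K M b) (realize b F t) (realize b F u) \<in> carrier (cochain H K M b)"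
      using realize_closed[OF t] realize_closed[OF u] unfolding cochain_eq
      by (rule vadd_presented_closed)
    fix \<Psi> assume \<Psi>: "\<Psi> \<in> forms b"
    then show "form_value \<Psi> (realize b F (vadd (cochain H K M a) t u)) =
        form_value \<Psi> (vadd (cochain H K M b) (realize b F t) (realize b F u))"
      using functional_on_form_value[OF \<Psi>, of b] functional_on_form_value[OF D_forms[OF \<Psi>], of a]
      by (simp add: functional_on_def form_value_realize realize_closed t u tu)
  qed
next
  fix c t assume t: "t \<in> carrier (cochain H K M a)"
  have ct: "smul (cochain H K M a) c t \<in> carrier (cochain H K M a)"
    using t unfolding cochain_eq by (rule smul_presented_closed)
  show "realize b F (smul (cochain H K M a) c t) = smul (cochain H K M b) c (realize b F t)"
  proof (rule forms_separate)
    show "realize b F (smul (cochain H K M a) c t) \<in> carrier (cochain H K M b)"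
      by (rule realize_closed[OF ct])
    show "smul (cochain H K M b) c (realize b F t) \<in> carrier (cochain H K M b)"
      using realize_closed[OF t] unfolding cochain_eq by (rule smul_presented_closed)
    fix \<Psi> assume \<Psi>: "\<Psi> \<in> forms b"
    then show "form_value \<Psi> (realize b F (smul (cochain H K M a) c t)) =
        form_value \<Psi> (smul (cochain H K M b) c (realize b F t))"
      using functional_on_form_value[OF \<Psi>, of b] functional_on_form_value[OF D_forms[OF \<Psi>], of a]
      by (simp add: functional_on_def form_value_realize realize_closed t ct)
  qed
qed

lemma realize_mtens:
  assumes cs: "cs \<in> tensors a"
  shows "realize b F (mtens H K M m cs) = F m cs"
proof (rule forms_separate)
  show "realize b F (mtens H K M m cs) \<in> carrier (cochain H K M b)"
    by (rule realize_closed[OF mtens_closed[OF cs]])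
  show "F m cs \<in> carrier (cochain H K M b)" by (rule F_closed[OF cs])
  fix \<Psi> assume \<Psi>: "\<Psi> \<in> forms b"
  have "map d (map undot cs) = cs" using cs by (intro map_dot_undot) simp
  then show "form_value \<Psi> (realize b F (mtens H K M m cs)) = form_value \<Psi> (F m cs)"
    using form_value_realize[OF \<Psi> mtens_closed[OF cs]] F_dual[OF \<Psi>, of "map undot cs" m]
      form_value_mtens[OF D_forms[OF \<Psi>], of m "map undot cs"] cs
    by (simp del: map_map)
qed

end

subsection \<open>Values on generators\<close>

definition coface_value ::
  "nat \<Rightarrow> nat \<Rightarrow> 'm \<Rightarrow> ('f, 'h) celem list \<Rightarrow> ('f, 'h, 'm) cochain_elem" where
  "coface_value n i m cs =
    (if i = 0 then mtens H K M m (d 1 # cs)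
     else if i < n then cls (cochain_rels H K M n)
       (fsweedler (\<lambda>(c1, c2). gen (m, C_tens H K (take (i - 1) cs @ [c1, c2] @ drop i cs)))
         (C_comult H K (cs ! (i - 1))))
     else cls (cochain_rels H K M n)
       (fsweedler (\<lambda>(a, m0). gen (m0, C_tens H K (cs @ [d a]))) (coact M m)))"

definition codegeneracy_value ::
  "nat \<Rightarrow> nat \<Rightarrow> 'm \<Rightarrow> ('f, 'h) celem list \<Rightarrow> ('f, 'h, 'm) cochain_elem" where
  "codegeneracy_value n i m cs = smul (cochain H K M n) (C_counit H K (cs ! i))
    (mtens H K M m (take i cs @ drop (i + 1) cs))"

text \<open>
The element \<open>h\<close> is an argument of its own, since the formula for \<open>\<tau>\<^sub>n\<close> refers to a representative \<open>h\<close>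
of the first tensor factor \<open>dot h\<close>. That the value depends on \<open>dot h\<close> alone is a consequence of
\<open>form_value_rotation_value\<close>.
\<close>

definition rotation_value ::
  "nat \<Rightarrow> 'm \<Rightarrow> 'h \<Rightarrow> ('f, 'h) celem list \<Rightarrow> ('f, 'h, 'm) cochain_elem" where
  "rotation_value n m h cs = cls (cochain_rels H K M n)
    (fsweedler (\<lambda>(a, m0). fsweedler (\<lambda>(h1, h2).
      gen (mact M m0 h1, diag_act H K n (antipode H h2) (C_tens H K (cs @ [d a]))))
      (comult H h)) (coact M m))"

lemma pairing_C_tens_descend:
  "\<Psi> \<in> forms n' \<Longrightarrow> pairing \<Psi> (m, C_tens H K cs) = descend (\<lambda>hs. \<Psi> m (1 # hs)) cs"
  unfolding pairing_def C_tens_def by (simp add: sval_cls kills_descend forms_Kmultilin_Cons)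

lemma pairing_diag_act:
  assumes \<Psi>: "\<Psi> \<in> forms n'" and "length hs = n"
  shows "pairing \<Psi> (m, diag_act H K n y (C_tens H K (map d hs))) =
    diag_sum y hs (\<lambda>ls. \<Psi> m (1 # ls))"
proof -
  note slot = forms_Kmultilin_Cons[OF \<Psi>, of m 1]
  have "C_tens H K (map d hs) \<in> carrier (tpow C n)"
    by (rule C_tens_closed) (use assms in auto)
  then show ?thesis
    by (simp add: pairing_def sval_diag_act[OF slot] sval_C_tens[OF Kmultilin_diag_sum[OF slot]])
qed

lemma coface_value_closed:
  assumes cs: "cs \<in> tensors n" and i: "i \<le> Suc n"
  shows "coface_value (Suc n) i m cs \<in> carrier (cochain H K M (Suc n))"
proof -
  have first: "mtens H K M m (d 1 # cs) \<in> carrier (cochain H K M (Suc n))"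
    using cs by (intro mtens_closed) auto
  have middle: "cls (cochain_rels H K M (Suc n))
      (fsweedler (\<lambda>(c1, c2). gen (m, C_tens H K (take (i - 1) cs @ [c1, c2] @ drop i cs)))
         (C_comult H K (cs ! (i - 1)))) \<in> carrier (cochain H K M (Suc n))" if i0: "0 < i" "i < Suc n"
    unfolding cochain_eq
  proof (intro cls_in_presented keys_fsweedler)
    fix x assume "x \<in> Poly_Mapping.keys (rep (C_comult H K (cs ! (i - 1))))"
    then have "x \<in> carrier C \<times> carrier C"
      by (rule subsetD[OF keys_rep[OF rels_within_tensor[OF vclosed_C vclosed_C]
        C_comult_closed[unfolded tensor_def]]])
    then obtain c1 c2 where x: "x = (c1, c2)" "c1 \<in> carrier C" "c2 \<in> carrier C"
      by (rule SigmaE)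
    have "take (i - 1) cs @ [c1, c2] @ drop i cs \<in> tensors (Suc n)"
      using cs i0 x by (auto dest: in_set_takeD in_set_dropD)
    then have "C_tens H K (take (i - 1) cs @ [c1, c2] @ drop i cs) \<in> carrier (tpow C (Suc n))"
      by (rule C_tens_closed)
    then show "Poly_Mapping.keys ((case x of (c1, c2) \<Rightarrow>
        gen (m, C_tens H K (take (i - 1) cs @ [c1, c2] @ drop i cs))) :: _ \<Rightarrow>\<^sub>0 'f) \<subseteq> cochain_gens (Suc n)"
      by (simp add: x)
  qed
  have last: "cls (cochain_rels H K M (Suc n))
      (fsweedler (\<lambda>(a, m0). gen (m0, C_tens H K (cs @ [d a]))) (coact M m))
      \<in> carrier (cochain H K M (Suc n))"
    unfolding cochain_eq
  proof (intro cls_in_presented keys_fsweedler)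
    fix x :: "'h \<times> 'm"
    have "C_tens H K (cs @ [d (fst x)]) \<in> carrier (tpow C (Suc n))"
      using cs by (intro C_tens_closed) auto
    then show "Poly_Mapping.keys ((case x of (a, m0) \<Rightarrow>
        gen (m0, C_tens H K (cs @ [d a]))) :: _ \<Rightarrow>\<^sub>0 'f) \<subseteq> cochain_gens (Suc n)"
      by (simp add: case_prod_unfold)
  qed
  show ?thesis using first middle last by (simp add: coface_value_def)
qed

lemma form_value_coface_value:
  assumes \<Psi>: "\<Psi> \<in> forms (Suc n)" and len: "length hs = n" and i: "i \<le> Suc n"
  shows "form_value \<Psi> (coface_value (Suc n) i m (map d hs)) = coface_form (Suc n) i \<Psi> m (1 # hs)"
proof -
  note lin = forms_add[OF \<Psi>] forms_scale[OF \<Psi>] multilinD[OF forms_multilin[OF \<Psi>]]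
  note slot = forms_Kmultilin_Cons[OF \<Psi>]
  consider "i = 0" | "0 < i" "i < Suc n" | "i = Suc n" using i by linarith
  then show ?thesis
  proof cases
    case 1
    have "comult_sum 1 (\<lambda>a b. \<Psi> m (a # b # hs)) = \<Psi> m (1 # 1 # hs)"
      by (rule comult_sum_one) (simp add: bilin_def is_lin_def lin)
    then show ?thesis
      using form_value_mtens[OF \<Psi>, of m "1 # hs"] 1 by (simp add: coface_value_def coface_form_def)
  next
    case 2
    then have "i - 1 < length hs" using len by auto
    then obtain us h ws where hs: "hs = us @ h # ws" "length us = i - 1"
      by (rule split_list_at)
    let ?L = "\<lambda>hs. \<Psi> m (1 # hs)"
    let ?\<xi> = "\<lambda>(c1, c2). descend ?L (map d us @ [c1, c2] @ map d ws)"
    have slots: "take (i - 1) (map d hs) = map d us" "drop i (map d hs) = map d ws"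
      "map d hs ! (i - 1) = d h"
      using hs 2 by (auto simp: nth_append)
    have "Kinvariant (\<lambda>x. ?L (us' @ x # ws'))" for us' ws'
      using slot[of m 1] by (simp add: Kmultilin_def)
    note inv = this[of "map undot (map d us)" "_ # map undot (map d ws)"]
      this[of "map undot (map d us) @ [_]" "map undot (map d ws)"]
    have "kills ?\<xi> (tensor_rels C C)"
      using inv[THEN Kinvariant_functional_on] by (simp add: kills_tensor_rels descend_def)
    then have "sval ?\<xi> (C_comult H K (d h)) = comult_sum h (\<lambda>a b. ?\<xi> (d a, d b))"
      by (rule sval_C_comult)
    also have "\<dots> = comult_sum h (\<lambda>a b. \<Psi> m (1 # us @ a # b # ws))"
      using descend_dot[OF slot, of m 1 "us @ _ # _ # ws"] by simp
    also have "\<dots> = coface_form (Suc n) i \<Psi> m (1 # hs)"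
      using double_slot_append[of "1 # us" i \<Psi> m h ws] hs 2 by (simp add: coface_form_def)
    finally show ?thesis
      using 2 by (simp add: coface_value_def form_value_cls[OF \<Psi>] fval_fsweedler
        slots[unfolded One_nat_def]
        pairing_C_tens_descend[OF \<Psi>] case_prod_unfold)
  next
    case 3
    have "form_value \<Psi> (coface_value (Suc n) i m (map d hs)) =
        sval (\<lambda>(a, m0). \<Psi> m0 (1 # hs @ [a])) (coact M m)"
      using pairing_C_tens[OF \<Psi>, of _ "hs @ [_]"] 3
      by (simp add: coface_value_def form_value_cls[OF \<Psi>] fval_fsweedler case_prod_unfold)
    also have "\<dots> = coact_sum m (\<lambda>a m0. \<Psi> m0 (1 # hs @ [a]))"
      by (rule sval_coact) (simp add: bilin_def is_lin_def lin)
    also have "\<dots> = comult_sum 1 (\<lambda>a b. coact_sum m (\<lambda>c m0. \<Psi> m0 (b # hs @ [c * a])))"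
      by (subst comult_sum_one) (simp_all add: bilin_def is_lin_def coact_linear_simps lin)
    finally show ?thesis using 3 by (simp add: coface_form_def)
  qed
qed

lemma codegeneracy_value_closed:
  assumes "cs \<in> tensors (Suc n)" "i \<le> n"
  shows "codegeneracy_value n i m cs \<in> carrier (cochain H K M n)"
proof -
  have "take i cs @ drop (i + 1) cs \<in> tensors n"
    using assms by (auto dest: in_set_takeD in_set_dropD)
  from mtens_closed[OF this] show ?thesis
    unfolding codegeneracy_value_def cochain_eq by (rule smul_presented_closed)
qed

lemma form_value_codegeneracy_value:
  assumes \<Psi>: "\<Psi> \<in> forms n" and len: "length hs = Suc n" and i: "i \<le> n"
  shows "form_value \<Psi> (codegeneracy_value n i m (map d hs)) = drop_slot (Suc i) \<Psi> m (1 # hs)"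
proof -
  have "mtens H K M m (map d (take i hs @ drop (i + 1) hs)) \<in> carrier (cochain H K M n)"
    by (rule mtens_closed) (use len i in auto)
  then have "form_value \<Psi> (codegeneracy_value n i m (map d hs)) =
      counit H (hs ! i) * form_value \<Psi> (mtens H K M m (map d (take i hs @ drop (i + 1) hs)))"
    using functional_on_form_value[OF \<Psi>, of n] len i
    by (simp add: codegeneracy_value_def functional_on_def take_map drop_map C_counit_dot)
  then show ?thesis
    unfolding form_value_mtens[OF \<Psi>] using len i by (simp add: drop_slot_def)
qed

lemma rotation_value_closed:
  assumes cs: "cs \<in> tensors n"
  shows "rotation_value (Suc n) m h cs \<in> carrier (cochain H K M (Suc n))"
  unfolding rotation_value_def cochain_eq
proof (intro cls_in_presented keys_fsweedler)
  fix x :: "'h \<times> 'm"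
  have "C_tens H K (cs @ [d (fst x)]) \<in> carrier (tpow C (Suc n))"
    using cs by (intro C_tens_closed) auto
  then have "diag_act H K (Suc n) y (C_tens H K (cs @ [d (fst x)])) \<in> carrier (tpow C (Suc n))" for y
    by (rule diag_act_closed)
  then show "Poly_Mapping.keys (case x of (a, m0) \<Rightarrow> fsweedler (\<lambda>(h1, h2).
      gen (mact M m0 h1, diag_act H K (Suc n) (antipode H h2) (C_tens H K (cs @ [d a]))))
      (comult H h)) \<subseteq> cochain_gens (Suc n)"
    unfolding case_prod_unfold by (intro keys_fsweedler) simp
qed

text \<open>
Evaluating \<open>m\<^sub>(\<^sub>0\<^sub>) h\<^sub>(\<^sub>1\<^sub>) \<otimes> S(h\<^sub>(\<^sub>2\<^sub>)) c\<close> at a form and moving \<open>h\<^sub>(\<^sub>1\<^sub>)\<close> across the slots by invariance puts \<open>h\<^sub>(\<^sub>1\<^sub>)\<close>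
into slot 0 and leaves \<open>h\<^sub>(\<^sub>2\<^sub>) S(h\<^sub>(\<^sub>3\<^sub>)) c\<close>, so the antipode disappears.
\<close>

lemma form_value_rotation_value:
  assumes \<Psi>: "\<Psi> \<in> forms (Suc n)" and len: "length hs = n"
  shows "form_value \<Psi> (rotation_value (Suc n) m h (map d hs)) = rotate_form \<Psi> m (1 # h # hs)"
proof -
  let ?S = "antipode H"
  note lin = forms_add[OF \<Psi>] forms_scale[OF \<Psi>] multilinD[OF forms_multilin[OF \<Psi>]]
  have ml: "multilin (\<lambda>ls. \<Psi> m0 (u # ls))" for m0 u
    by (rule multilin_Cons[OF forms_multilin[OF \<Psi>]])
  have collapse: "comult_sum h (\<lambda>h1 h2. diag_sum (?S h2) ls (\<lambda>ls. \<Psi> (mact M m0 h1) (1 # ls))) =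
      \<Psi> m0 (h # ls)" for ls m0
  proof -
    have "comult_sum h (\<lambda>h1 h2. diag_sum (?S h2) ls (\<lambda>ls. \<Psi> (mact M m0 h1) (1 # ls))) =
        comult_sum h (\<lambda>h1 h2. comult_sum h1 (\<lambda>u v. diag_sum (v * ?S h2) ls (\<lambda>ls. \<Psi> m0 (u # ls))))"
      by (simp add: forms_mact[OF \<Psi>] diag_sum_comult_swap diag_sum_mult[OF ml])
    also have "\<dots> = comult_sum h (\<lambda>u y. comult_sum y (\<lambda>v h2.
        diag_sum (v * ?S h2) ls (\<lambda>ls. \<Psi> m0 (u # ls))))"
      by (rule comult_sum_coassoc[symmetric]) (simp add: trilin_def is_lin_def diag_linear_simps lin)
    also have "\<dots> = comult_sum h (\<lambda>u y. counit H y * \<Psi> m0 (u # ls))"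
      by (simp add: comult_sum_antipode_right[OF lin_diag_sum] diag_sum_one[OF ml])
    also have "\<dots> = \<Psi> m0 (h # ls)"
      by (rule comult_sum_counit_right) (simp add: is_lin_def lin)
    finally show ?thesis .
  qed
  have "pairing \<Psi> (m', diag_act H K (Suc n) y (C_tens H K (map d hs @ [d a]))) =
      diag_sum y (hs @ [a]) (\<lambda>ls. \<Psi> m' (1 # ls))" for m' y a
    using pairing_diag_act[OF \<Psi>, of "hs @ [a]" "Suc n" m' y] len by simp
  then have "form_value \<Psi> (rotation_value (Suc n) m h (map d hs)) =
      sval (\<lambda>(a, m0). sval (\<lambda>(h1, h2).
        diag_sum (?S h2) (hs @ [a]) (\<lambda>ls. \<Psi> (mact M m0 h1) (1 # ls))) (comult H h)) (coact M m)"
    by (simp add: rotation_value_def form_value_cls[OF \<Psi>] fval_fsweedler case_prod_unfold)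
  also have "\<dots> = sval (\<lambda>(a, m0). \<Psi> m0 (h # hs @ [a])) (coact M m)"
  proof -
    have "sval (\<lambda>(h1, h2). diag_sum (?S h2) ls (\<lambda>ls. \<Psi> (mact M m0 h1) (1 # ls))) (comult H h) =
        \<Psi> m0 (h # ls)" for ls m0
      unfolding collapse[symmetric]
      by (rule sval_comult) (simp add: bilin_def is_lin_def coact_linear_simps lin)
    then show ?thesis by simp
  qed
  also have "\<dots> = coact_sum m (\<lambda>a m0. \<Psi> m0 (h # hs @ [a]))"
    by (rule sval_coact) (simp add: bilin_def is_lin_def lin)
  finally show ?thesis by simp
qed


subsection \<open>The cocyclic structure\<close>

definition coface :: "nat \<Rightarrow> nat \<Rightarrow> ('f, 'h, 'm) cochain_elem \<Rightarrow> ('f, 'h, 'm) cochain_elem" where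
  "coface n i = realize n (coface_value n i)"

definition codegeneracy :: "nat \<Rightarrow> nat \<Rightarrow> ('f, 'h, 'm) cochain_elem \<Rightarrow> ('f, 'h, 'm) cochain_elem" where
  "codegeneracy n i = realize n (codegeneracy_value n i)"

definition rotation :: "nat \<Rightarrow> ('f, 'h, 'm) cochain_elem \<Rightarrow> ('f, 'h, 'm) cochain_elem" where
  "rotation n = realize n (\<lambda>m cs. if n = 0 then mtens H K M m cs
    else rotation_value n m (undot (hd cs)) (tl cs))"

lemma
  assumes "i \<le> Suc n"
  shows linear_on_coface: "linear_on (cochain H K M n) (cochain H K M (Suc n)) (coface (Suc n) i)"
    and coface_mtens: "cs \<in> tensors n \<Longrightarrow>
      coface (Suc n) i (mtens H K M m cs) = coface_value (Suc n) i m cs"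
    and form_value_coface: "\<Psi> \<in> forms (Suc n) \<Longrightarrow> t \<in> carrier (cochain H K M n) \<Longrightarrow>
      form_value \<Psi> (coface (Suc n) i t) = form_value (coface_form (Suc n) i \<Psi>) t"
proof -
  note data = coface_value_closed[OF _ assms] coface_form_forms[of _ n i]
    form_value_coface_value[OF _ _ assms]
  show "linear_on (cochain H K M n) (cochain H K M (Suc n)) (coface (Suc n) i)"
    unfolding coface_def by (rule linear_on_realize[OF data])
  show "cs \<in> tensors n \<Longrightarrow> coface (Suc n) i (mtens H K M m cs) = coface_value (Suc n) i m cs"
    unfolding coface_def by (rule realize_mtens[OF data])
  show "\<Psi> \<in> forms (Suc n) \<Longrightarrow> t \<in> carrier (cochain H K M n) \<Longrightarrow>
      form_value \<Psi> (coface (Suc n) i t) = form_value (coface_form (Suc n) i \<Psi>) t"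
    unfolding coface_def by (rule form_value_realize[OF data])
qed

lemma
  assumes "i \<le> n"
  shows linear_on_codegeneracy:
      "linear_on (cochain H K M (Suc n)) (cochain H K M n) (codegeneracy n i)"
    and codegeneracy_mtens: "cs \<in> tensors (Suc n) \<Longrightarrow>
      codegeneracy n i (mtens H K M m cs) = codegeneracy_value n i m cs"
    and form_value_codegeneracy: "\<Psi> \<in> forms n \<Longrightarrow> t \<in> carrier (cochain H K M (Suc n)) \<Longrightarrow>
      form_value \<Psi> (codegeneracy n i t) = form_value (drop_slot (Suc i) \<Psi>) t"
proof -
  note data = codegeneracy_value_closed[OF _ assms] drop_slot_forms[of _ n "Suc i"]
    form_value_codegeneracy_value[OF _ _ assms]
  show "linear_on (cochain H K M (Suc n)) (cochain H K M n) (codegeneracy n i)"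
    unfolding codegeneracy_def by (rule linear_on_realize[OF data])
  show "cs \<in> tensors (Suc n) \<Longrightarrow>
      codegeneracy n i (mtens H K M m cs) = codegeneracy_value n i m cs"
    unfolding codegeneracy_def by (rule realize_mtens[OF data])
  show "\<Psi> \<in> forms n \<Longrightarrow> t \<in> carrier (cochain H K M (Suc n)) \<Longrightarrow>
      form_value \<Psi> (codegeneracy n i t) = form_value (drop_slot (Suc i) \<Psi>) t"
    unfolding codegeneracy_def by (rule form_value_realize[OF data])
qed

lemma
  shows linear_on_rotation: "linear_on (cochain H K M n) (cochain H K M n) (rotation n)"
    and form_value_rotation: "\<Psi> \<in> forms n \<Longrightarrow> t \<in> carrier (cochain H K M n) \<Longrightarrow>
      form_value \<Psi> (rotation n t) = form_value (rotate_form \<Psi>) t"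
proof -
  let ?F = "\<lambda>m cs. if n = 0 then mtens H K M m cs else rotation_value n m (undot (hd cs)) (tl cs)"
  have closed: "?F m cs \<in> carrier (cochain H K M n)" if cs: "cs \<in> tensors n" for m cs
  proof (cases n)
    case 0
    then show ?thesis using mtens_closed[OF cs] by simp
  next
    case (Suc k)
    then have "tl cs \<in> tensors k" using cs by (cases cs) auto
    from rotation_value_closed[OF this] show ?thesis by (simp add: Suc)
  qed
  \<comment> \<open>in degree 0 the formula is the identity, which agrees with the transpose by \<open>rotate_form_cyclic\<close>\<close>
  have dual: "form_value \<Psi> (?F m (map d hs)) = rotate_form \<Psi> m (1 # hs)"
    if \<Psi>: "\<Psi> \<in> forms n" and hs: "length hs = n" for \<Psi> m hs
  proof (cases n)
    case 0
    then show ?thesis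
      using form_value_mtens[OF \<Psi>, of m "[]"] rotate_form_cyclic[of \<Psi> 0] \<Psi> hs
      by (simp del: rotate_form_simps)
  next
    case (Suc k)
    then obtain h hs' where hs': "hs = h # hs'" "length hs' = k" using hs by (cases hs) auto
    have "form_value \<Psi> (?F m (map d hs)) = rotate_form \<Psi> m (1 # undot (d h) # hs')"
      using form_value_rotation_value[of \<Psi> k hs' m "undot (d h)"] \<Psi> hs' Suc
      by (simp del: rotate_form_simps)
    also have "\<dots> = rotate_form \<Psi> m (1 # h # hs')"
      by (rule Kmultilin_cong[OF forms_Kmultilin[OF rotate_form_forms[OF \<Psi>]]]) (simp add: dot_undot)
    finally show ?thesis by (simp only: hs')
  qed
  note data = closed rotate_form_forms[of _ n] dual
  show "linear_on (cochain H K M n) (cochain H K M n) (rotation n)"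
    unfolding rotation_def by (rule linear_on_realize[OF data])
  show "\<Psi> \<in> forms n \<Longrightarrow> t \<in> carrier (cochain H K M n) \<Longrightarrow>
      form_value \<Psi> (rotation n t) = form_value (rotate_form \<Psi>) t"
    unfolding rotation_def by (rule form_value_realize[OF data])
qed

lemma coface_closed:
  "i \<le> Suc n \<Longrightarrow> t \<in> carrier (cochain H K M n) \<Longrightarrow>
    coface (Suc n) i t \<in> carrier (cochain H K M (Suc n))"
  using linear_on_coface by (simp add: linear_on_def)

lemma codegeneracy_closed:
  "i \<le> n \<Longrightarrow> t \<in> carrier (cochain H K M (Suc n)) \<Longrightarrow>
    codegeneracy n i t \<in> carrier (cochain H K M n)"
  using linear_on_codegeneracy by (simp add: linear_on_def)

lemma rotation_closed:
  "t \<in> carrier (cochain H K M n) \<Longrightarrow> rotation n t \<in> carrier (cochain H K M n)"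
  using linear_on_rotation by (simp add: linear_on_def)

lemma rotation_mtens:
  assumes cs: "cs \<in> tensors n"
  shows "rotation (Suc n) (mtens H K M m (d h # cs)) = rotation_value (Suc n) m h cs"
proof (rule forms_separate)
  have mem: "mtens H K M m (d h # cs) \<in> carrier (cochain H K M (Suc n))"
    using cs by (intro mtens_closed) auto
  show "rotation (Suc n) (mtens H K M m (d h # cs)) \<in> carrier (cochain H K M (Suc n))"
    by (rule rotation_closed[OF mem])
  show "rotation_value (Suc n) m h cs \<in> carrier (cochain H K M (Suc n))"
    by (rule rotation_value_closed[OF cs])
  fix \<Psi> assume \<Psi>: "\<Psi> \<in> forms (Suc n)"
  have "map d (map undot cs) = cs" using cs by (intro map_dot_undot) simp
  then show "form_value \<Psi> (rotation (Suc n) (mtens H K M m (d h # cs))) =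
      form_value \<Psi> (rotation_value (Suc n) m h cs)"
    using form_value_rotation[OF \<Psi> mem] cs
      form_value_rotation_value[OF \<Psi>, of "map undot cs" m h]
      form_value_mtens[OF rotate_form_forms[OF \<Psi>], of m "h # map undot cs"]
    by (simp del: map_map rotate_form_simps)
qed

text \<open>
In degree 0 the rotation is \<open>m \<mapsto> m\<^sub>(\<^sub>0\<^sub>) m\<^sub>(\<^sub>-\<^sub>1\<^sub>)\<close>, the identity by stability.
\<close>

lemma rotation_0:
  assumes t: "t \<in> carrier (cochain H K M 0)"
  shows "rotation 0 t = t"
proof (rule forms_separate[OF rotation_closed[OF t] t])
  fix \<Psi> assume \<Psi>: "\<Psi> \<in> forms 0"
  then show "form_value \<Psi> (rotation 0 t) = form_value \<Psi> t"
    using form_value_rotation[OF \<Psi> t] rotate_form_cyclic[OF \<Psi>] by simp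
qed

lemma coface_operators_coface: "coface_operators H K M coface"
  unfolding coface_operators_def
proof (intro conjI allI impI)
  fix n i :: nat assume "1 \<le> n" "i \<le> n"
  then obtain k where "n = Suc k" by (cases n) auto
  then show "linear_on (cochain H K M (n - 1)) (cochain H K M n) (coface n i)"
    using \<open>i \<le> n\<close> by (simp add: linear_on_coface)
next
  fix n m cs assume n: "1 \<le> n" and cs: "length cs = n - 1 \<and> set cs \<subseteq> carrier C"
  then obtain k where k: "n = Suc k" by (cases n) auto
  then have cs': "cs \<in> tensors k" using cs by simp
  show "coface n 0 (mtens H K M m cs) = mtens H K M m (d 1 # cs)"
    using coface_mtens[OF _ cs', of 0 m] by (simp add: k coface_value_def)
  show "coface n i (mtens H K M m cs) = cls (cochain_rels H K M n)
      (fsweedler (\<lambda>(c1, c2). gen (m, C_tens H K (take (i - 1) cs @ [c1, c2] @ drop i cs)))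
        (C_comult H K (cs ! (i - 1))))" if "1 \<le> i \<and> i \<le> n - 1" for i
    using that coface_mtens[OF _ cs', of i m] by (simp add: k coface_value_def)
  show "coface n n (mtens H K M m cs) = cls (cochain_rels H K M n)
      (fsweedler (\<lambda>(a, m0). gen (m0, C_tens H K (cs @ [d a]))) (coact M m))"
    using coface_mtens[OF _ cs', of "Suc k" m] by (simp add: k coface_value_def)
qed

lemma codegeneracy_operators_codegeneracy: "codegeneracy_operators H K M codegeneracy"
  unfolding codegeneracy_operators_def
  using linear_on_codegeneracy codegeneracy_mtens by (simp add: codegeneracy_value_def)

lemma cyclic_operators_rotation: "cyclic_operators H K M rotation"
  unfolding cyclic_operators_def
proof (intro conjI allI impI ballI)
  fix n m h cs assume n: "1 \<le> n" and cs: "length cs = n - 1 \<and> set cs \<subseteq> carrier C"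
  then obtain k where "n = Suc k" by (cases n) auto
  then show "rotation n (mtens H K M m (d h # cs)) = cls (cochain_rels H K M n)
      (fsweedler (\<lambda>(a, m0). fsweedler (\<lambda>(h1, h2).
        gen (mact M m0 h1, diag_act H K n (antipode H h2) (C_tens H K (cs @ [d a]))))
        (comult H h)) (coact M m))"
    using rotation_mtens[of cs k m h] cs by (simp add: rotation_value_def)
qed (simp_all add: linear_on_rotation rotation_0)

lemma coface_unique:
  assumes \<delta>': "coface_operators H K M \<delta>'" and n: "1 \<le> n" "i \<le> n"
    and t: "t \<in> carrier (cochain H K M (n - 1))"
  shows "\<delta>' n i t = coface n i t"
proof (rule linear_on_cochain_eqI[OF _ _ _ t])
  note \<delta> = coface_operators_coface
  show "linear_on (cochain H K M (n - 1)) (cochain H K M n) (\<delta>' n i)"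
    "linear_on (cochain H K M (n - 1)) (cochain H K M n) (coface n i)"
    using \<delta>' \<delta> n by (simp_all add: coface_operators_def)
  fix m cs assume cs: "cs \<in> tensors (n - 1)"
  consider "i = 0" | "1 \<le> i" "i \<le> n - 1" | "i = n" using n by linarith
  then show "\<delta>' n i (mtens H K M m cs) = coface n i (mtens H K M m cs)"
    by cases (use \<delta>' \<delta> n cs in \<open>simp_all add: coface_operators_def\<close>)
qed

lemma codegeneracy_unique:
  assumes \<sigma>': "codegeneracy_operators H K M \<sigma>'" and n: "i \<le> n"
    and t: "t \<in> carrier (cochain H K M (n + 1))"
  shows "\<sigma>' n i t = codegeneracy n i t"
proof (rule linear_on_cochain_eqI[OF _ _ _ t])
  note \<sigma> = codegeneracy_operators_codegeneracy
  show "linear_on (cochain H K M (n + 1)) (cochain H K M n) (\<sigma>' n i)"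
    "linear_on (cochain H K M (n + 1)) (cochain H K M n) (codegeneracy n i)"
    using \<sigma>' \<sigma> n by (simp_all add: codegeneracy_operators_def)
  show "\<sigma>' n i (mtens H K M m cs) = codegeneracy n i (mtens H K M m cs)"
    if "cs \<in> tensors (n + 1)" for m cs
    using \<sigma>' \<sigma> n that by (simp add: codegeneracy_operators_def)
qed

lemma rotation_unique:
  assumes \<tau>': "cyclic_operators H K M \<tau>'" and t: "t \<in> carrier (cochain H K M n)"
  shows "\<tau>' n t = rotation n t"
proof (cases n)
  case 0
  then show ?thesis using \<tau>' t by (simp add: cyclic_operators_def rotation_0)
next
  case (Suc k)
  note \<tau> = cyclic_operators_rotation
  show ?thesis
  proof (rule linear_on_cochain_eqI[OF _ _ _ t])
    show "linear_on (cochain H K M n) (cochain H K M n) (\<tau>' n)"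
      "linear_on (cochain H K M n) (cochain H K M n) (rotation n)"
      using \<tau>' \<tau> by (simp_all add: cyclic_operators_def)
    fix m cs assume "cs \<in> tensors n"
    then obtain c cs' where c: "cs = c # cs'" "c \<in> carrier C" "cs' \<in> tensors k"
      using Suc by (cases cs) auto
    then have "\<tau>' (Suc k) (mtens H K M m (d (undot c) # cs')) =
        rotation (Suc k) (mtens H K M m (d (undot c) # cs'))"
      using \<tau>' \<tau> by (simp add: cyclic_operators_def)
    then show "\<tau>' n (mtens H K M m cs) = rotation n (mtens H K M m cs)"
      using c Suc by (simp add: dot_undot)
  qed
qed

lemma rotation_power:
  assumes t: "t \<in> carrier (cochain H K M n)"
  shows "(rotation n ^^ k) t \<in> carrier (cochain H K M n) \<and>
    (\<forall>\<Psi>\<in>forms n. form_value \<Psi> ((rotation n ^^ k) t) = form_value ((rotate_form ^^ k) \<Psi>) t)"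
proof (induction k)
  case (Suc k)
  then show ?case
    by (auto simp: rotation_closed form_value_rotation rotate_form_forms
      funpow_swap1[of rotate_form])
qed (simp add: t)

lemma cocyclic_cochain: "cocyclic (cochain H K M) coface codegeneracy rotation"
  unfolding cocyclic_def
proof (intro conjI allI impI ballI)
  fix n i :: nat assume "1 \<le> n" "i \<le> n"
  then show "linear_on (cochain H K M (n - 1)) (cochain H K M n) (coface n i)"
    using coface_operators_coface by (simp add: coface_operators_def)
next
  fix n i :: nat assume "i \<le> n"
  then show "linear_on (cochain H K M (n + 1)) (cochain H K M n) (codegeneracy n i)"
    by (simp add: linear_on_codegeneracy)
next
  fix n show "linear_on (cochain H K M n) (cochain H K M n) (rotation n)"
    by (rule linear_on_rotation)
next
  fix n j i t assume n: "1 \<le> n" and ij: "j \<le> n + 1" "i < j"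
    and t: "t \<in> carrier (cochain H K M (n - 1))"
  obtain k j' where k: "n = Suc k" "j = Suc j'" using n ij by (cases n; cases j) auto
  have "coface (Suc (Suc k)) (Suc j') (coface (Suc k) i t) =
      coface (Suc (Suc k)) i (coface (Suc k) j' t)"
    by (rule forms_separate[where n = "Suc (Suc k)"])
      (use t k ij in \<open>simp_all add: coface_closed form_value_coface coface_form_forms
        coface_form_coface_form\<close>)
  then show "coface (n + 1) j (coface n i t) = coface (n + 1) i (coface n (j - 1) t)"
    by (simp add: k)
next
  fix n j i t assume "j \<le> n" "i \<le> j" "t \<in> carrier (cochain H K M (n + 2))"
  then show "codegeneracy n j (codegeneracy (n + 1) i t) =
      codegeneracy n i (codegeneracy (n + 1) (j + 1) t)"
    by (intro forms_separate[where n = n])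
      (simp_all add: codegeneracy_closed form_value_codegeneracy drop_slot_forms drop_slot_drop_slot)
next
  fix n j i t assume ij: "j \<le> n" "i < j" and t: "t \<in> carrier (cochain H K M n)"
  obtain k j' where k: "n = Suc k" "j = Suc j'" using ij by (cases n; cases j) auto
  have "codegeneracy (Suc k) (Suc j') (coface (Suc (Suc k)) i t) =
      coface (Suc k) i (codegeneracy k j' t)"
  proof (rule forms_separate[where n = "Suc k"])
    fix \<Psi> assume \<Psi>: "\<Psi> \<in> forms (Suc k)"
    have "coface_form (Suc (Suc k)) i (drop_slot (Suc (Suc j')) \<Psi>) =
        drop_slot (Suc j') (coface_form (Suc k) i \<Psi>)"
      using ij k by (simp add: coface_form_def double_slot_drop_slot_lt)
    then show "form_value \<Psi> (codegeneracy (Suc k) (Suc j') (coface (Suc (Suc k)) i t)) =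
        form_value \<Psi> (coface (Suc k) i (codegeneracy k j' t))"
      using \<Psi> t k ij
      by (simp add: coface_closed codegeneracy_closed form_value_coface form_value_codegeneracy
        coface_form_forms drop_slot_forms)
  qed (use t k ij in \<open>simp_all add: coface_closed codegeneracy_closed\<close>)
  then show "codegeneracy n j (coface (n + 1) i t) = coface n i (codegeneracy (n - 1) (j - 1) t)"
    by (simp add: k)
next
  fix n j i t assume j: "j \<le> n" and i: "i \<in> {j, j + 1}" and t: "t \<in> carrier (cochain H K M n)"
  have "codegeneracy n j (coface (Suc n) i t) = t"
  proof (rule forms_separate[where n = n])
    fix \<Psi> assume \<Psi>: "\<Psi> \<in> forms n"
    have "coface_form (Suc n) i (drop_slot (Suc j) \<Psi>) = \<Psi>"
      using i j double_slot_drop_slot_right[OF \<Psi> j] double_slot_drop_slot_left[OF \<Psi>, of "Suc j"]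
        double_slot_rotate_drop_last[OF \<Psi>]
      by (cases "i = Suc n") (auto simp: coface_form_def)
    then show "form_value \<Psi> (codegeneracy n j (coface (Suc n) i t)) = form_value \<Psi> t"
      using \<Psi> t i j
      by (auto simp: coface_closed form_value_coface form_value_codegeneracy drop_slot_forms)
  qed (use t i j in \<open>auto simp: coface_closed codegeneracy_closed\<close>)
  then show "codegeneracy n j (coface (n + 1) i t) = t" by simp
next
  fix n j i t assume ij: "j \<le> n" "i \<le> n + 1" "j + 1 < i" and t: "t \<in> carrier (cochain H K M n)"
  obtain k i' where k: "n = Suc k" "i = Suc i'" using ij by (cases n; cases i) auto
  have "codegeneracy (Suc k) j (coface (Suc (Suc k)) i t) =
      coface (Suc k) i' (codegeneracy k j t)"
    by (rule forms_separate[where n = "Suc k"])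
      (use t k ij coface_form_drop_slot_gt[of _ "Suc k" j i] in \<open>simp_all add: coface_closed
        codegeneracy_closed form_value_coface form_value_codegeneracy coface_form_forms drop_slot_forms\<close>)
  then show "codegeneracy n j (coface (n + 1) i t) = coface n (i - 1) (codegeneracy (n - 1) j t)"
    by (simp add: k)
next
  fix n i t assume n: "1 \<le> n" and i: "i \<in> {1..n}" and t: "t \<in> carrier (cochain H K M (n - 1))"
  obtain k i' where k: "n = Suc k" "i = Suc i'" using n i by (cases n; cases i) auto
  have "rotation (Suc k) (coface (Suc k) (Suc i') t) = coface (Suc k) i' (rotation k t)"
    by (rule forms_separate[where n = "Suc k"])
      (use t k i in \<open>simp_all add: coface_closed rotation_closed form_value_coface
        form_value_rotation coface_form_forms rotate_form_forms coface_form_rotate\<close>)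
  then show "rotation n (coface n i t) = coface n (i - 1) (rotation (n - 1) t)"
    by (simp add: k)
next
  fix n t assume n: "1 \<le> n" and t: "t \<in> carrier (cochain H K M (n - 1))"
  obtain k where k: "n = Suc k" using n by (cases n) auto
  have "rotation (Suc k) (coface (Suc k) 0 t) = coface (Suc k) (Suc k) t"
    by (rule forms_separate[where n = "Suc k"])
      (use t k in \<open>simp_all add: coface_closed rotation_closed form_value_coface
        form_value_rotation rotate_form_forms coface_form_def\<close>)
  then show "rotation n (coface n 0 t) = coface n n t" by (simp add: k)
next
  fix n i t assume i: "i \<in> {1..n}" and t: "t \<in> carrier (cochain H K M (n + 1))"
  obtain i' where k: "i = Suc i'" using i by (cases i) auto
  show "rotation n (codegeneracy n i t) = codegeneracy n (i - 1) (rotation (n + 1) t)"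
    by (rule forms_separate[where n = n])
      (use t k i in \<open>simp_all add: codegeneracy_closed rotation_closed form_value_codegeneracy
        form_value_rotation drop_slot_forms rotate_form_forms drop_slot_rotate\<close>)
next
  fix n t assume t: "t \<in> carrier (cochain H K M (n + 1))"
  show "rotation n (codegeneracy n 0 t) =
      codegeneracy n n (rotation (n + 1) (rotation (n + 1) t))"
    by (rule forms_separate[where n = n])
      (use t in \<open>simp_all add: codegeneracy_closed rotation_closed form_value_codegeneracy
        form_value_rotation drop_slot_forms rotate_form_forms drop_slot_rotate_rotate\<close>)
next
  fix n t assume t: "t \<in> carrier (cochain H K M n)"
  show "(rotation n ^^ (n + 1)) t = t"
  proof (rule forms_separate[where n = n])
    show "(rotation n ^^ (n + 1)) t \<in> carrier (cochain H K M n)"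
      using rotation_power[OF t] by blast
    fix \<Psi> assume \<Psi>: "\<Psi> \<in> forms n"
    then have "form_value \<Psi> ((rotation n ^^ (n + 1)) t) = form_value ((rotate_form ^^ (n + 1)) \<Psi>) t"
      using rotation_power[OF t] by blast
    then show "form_value \<Psi> ((rotation n ^^ (n + 1)) t) = form_value \<Psi> t"
      using rotate_form_cyclic[OF \<Psi>] by simp
  qed (rule t)
qed

end

theorem theorem12:
  fixes H :: "('f::field_char_0, 'h::ring_1) hopf"
    and K :: "'h set"
    and M :: "('f, 'h, 'm::ab_group_add) hmodule"
  assumes "hopf_algebra H"
    and "hopf_subalgebra H K"
    and "sayd_module H M"
  shows "\<exists>\<delta> \<sigma> \<tau>.
     coface_operators H K M \<delta> \<and> codegeneracy_operators H K M \<sigma> \<and> cyclic_operators H K M \<tau> \<and>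
     (\<forall>\<delta>'. coface_operators H K M \<delta>' \<longrightarrow>
        (\<forall>n\<ge>1. \<forall>i\<le>n. \<forall>t\<in>carrier (cochain H K M (n - 1)). \<delta>' n i t = \<delta> n i t)) \<and>
     (\<forall>\<sigma>'. codegeneracy_operators H K M \<sigma>' \<longrightarrow>
        (\<forall>n. \<forall>i\<le>n. \<forall>t\<in>carrier (cochain H K M (n + 1)). \<sigma>' n i t = \<sigma> n i t)) \<and>
     (\<forall>\<tau>'. cyclic_operators H K M \<tau>' \<longrightarrow>
        (\<forall>n. \<forall>t\<in>carrier (cochain H K M n). \<tau>' n t = \<tau> n t)) \<and>
     cocyclic (cochain H K M) \<delta> \<sigma> \<tau>"
proof -
  interpret hopf_pair_sayd H K M
    using assms by (simp add: hopf_pair_sayd_def)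
  show ?thesis
  proof (intro exI conjI)
    show "coface_operators H K M coface" by (rule coface_operators_coface)
    show "codegeneracy_operators H K M codegeneracy" by (rule codegeneracy_operators_codegeneracy)
    show "cyclic_operators H K M rotation" by (rule cyclic_operators_rotation)
    show "cocyclic (cochain H K M) coface codegeneracy rotation" by (rule cocyclic_cochain)
  qed (simp_all add: coface_unique codegeneracy_unique rotation_unique)
qed

end
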